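(* Let $n\ge m\ge 1$. Let $G$ be a finite nonabelian $2$-group with a central subgroup $N\cong\mathbb{Z}_{2^n}\times\mathbb{Z}_{2^m}$ such that $G/N$ is an elementary abelian $2$-group, and with $G'=\langle c\rangle\cong\mathbb{Z}_2$. Suppose that the center of $G$ is $$\zeta G=\langle z_1\rangle\times\langle z_2\rangle\times\cdots\times\langle z_r\rangle\cong\mathbb{Z}_{2^n}\times\mathbb{Z}_{2^m}\times\underbrace{\mathbb{Z}_2\times\cdots\times\mathbb{Z}_2}_{r-2},\qquad N=\langle z_1\rangle\times\langle z_2\rangle$$ (with $|z_1|=2^n$, $|z_2|=2^m$), and that $c\in\langle z_1\rangle$. Then $G$ is isomorphic to one of the following groups, for an integer $k$ in the indicated range, where $\mathbb{Z}_2^{(r-2)}$ is the direct product of $r-2$ copies of $\mathbb{Z}_2$: (i) $\bigl(M_2(n+1,m+1)\mathbin{\mathsf Y}D_8^{\mathsf Y(k-1)}\bigr)\times\mathbb{Z}_2^{(r-2)}$, $k\ge1$; (ii) $\bigl(M_2(n+1,m+1)\mathbin{\mathsf Y}Q_8\mathbin{\mathsf Y}D_8^{\mathsf Y(k-2)}\bigr)\times\mathbb{Z}_2^{(r-2)}$, $k\ge2$; (iii) $\bigl(M_2(n+1,1)\mathbin{\mathsf Y}M_2(m+1,1,1)\mathbin{\mathsf Y}D_8^{\mathsf Y(k-2)}\bigr)\times\mathbb{Z}_2^{(r-2)}$, $k\ge2$; (iv) $\bigl(M_2(n+1,1)\mathbin{\mathsf Y}M_2(m+1,1,1)\mathbin{\mathsf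 Y}Q_8\mathbin{\mathsf Y}D_8^{\mathsf Y(k-3)}\bigr)\times\mathbb{Z}_2^{(r-2)}$, $k\ge3$; (v) $\bigl(M_2(n+1,1)\mathbin{\mathsf Y}D_8^{\mathsf Y(k-1)}\bigr)\times\mathbb{Z}_{2^m}\times\mathbb{Z}_2^{(r-2)}$, $k\ge1$; (vi) $\bigl(M_2(n+1,1)\mathbin{\mathsf Y}Q_8\mathbin{\mathsf Y}D_8^{\mathsf Y(k-2)}\bigr)\times\mathbb{Z}_{2^m}\times\mathbb{Z}_2^{(r-2)}$, $k\ge2$; (vii) $\bigl(M_2(m+1,1,1)\mathbin{\mathsf Y}D_8^{\mathsf Y(k-1)}\mathbin{\mathsf Y}\mathbb{Z}_{2^n}\bigr)\times\mathbb{Z}_2^{(r-2)}$, $k\ge1$; (viii) $\bigl(M_2(m+1,1,1)\mathbin{\mathsf Y}Q_8\mathbin{\mathsf Y}D_8^{\mathsf Y(k-2)}\mathbin{\mathsf Y}\mathbb{Z}_{2^n}\bigr)\times\mathbb{Z}_2^{(r-2)}$, $k\ge2$; (ix) $\bigl(D_8^{\mathsf Y k}\mathbin{\mathsf Y}\mathbb{Z}_{2^n}\bigr)\times\mathbb{Z}_{2^m}\times\mathbb{Z}_2^{(r-2)}$, $k\ge1$; (x) $\bigl(Q_8\mathbin{\mathsf Y}D_8^{\mathsf Y(k-1)}\mathbin{\mathsf Y}\mathbb{Z}_{2^n}\bigr)\times\mathbb{Z}_{2^m}\times\mathbb{Z}_2^{(r-2)}$, $k\ge1$.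
   Context: $D_8$, $Q_8$ are the dihedral and quaternion groups of order $8$. $M_2(u,v)=\langle a,b\mid a^{2^u}=b^{2^v}=1,\ a^b=a^{1+2^{u-1}}\rangle$ for $u\ge2$, $v\ge1$. $M_2(w,1,1)=\langle a,b,d\mid a^{2^w}=b^{2}=d^2=1,\ [a,b]=d,\ [d,a]=[d,b]=1\rangle$ for $w\ge1$. $H\mathbin{\mathsf Y}K$ denotes the central product (a group $HK$ with $[H,K]=1$). In all the central products listed, the derived subgroups (of order $2$) of the nonabelian factors and the unique subgroup of order $2$ of a cyclic central factor are all identified with one common subgroup $\langle c\rangle$ of order $2$, and factors intersect exactly in $\langle c\rangle$. $D_8^{\mathsf Y j}$ is the central product of $j$ copies of $D_8$ (omitted if $j=0$). *)

theory Defs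
  imports "HOL-Algebra.Algebra"
begin

section \<open>Group presentations\<close>

text \<open>A letter \<open>(x, True)\<close> stands for the generator \<open>x\<close> and \<open>(x, False)\<close> for its inverse.\<close>

type_synonym 'x word = "('x \<times> bool) list"

definition words :: "'x set \<Rightarrow> 'x word set"
  where "words S = lists (S \<times> UNIV)"

definition word_pow :: "'x word \<Rightarrow> nat \<Rightarrow> 'x word"
  where "word_pow w k = concat (replicate k w)"

definition word_inv :: "'x word \<Rightarrow> 'x word"
  where "word_inv w = rev (map (\<lambda>(x, e). (x, \<not> e)) w)"

text \<open>\<open>x\<^sup>y = y\<^sup>-\<^sup>1 x y\<close> and \<open>[x, y] = x\<^sup>-\<^sup>1 y\<^sup>-\<^sup>1 x y\<close>.\<close>

definition word_conj :: "'x word \<Rightarrow> 'x word \<Rightarrow> 'x word"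
  where "word_conj x y = word_inv y @ x @ y"

definition word_comm :: "'x word \<Rightarrow> 'x word \<Rightarrow> 'x word"
  where "word_comm x y = word_inv x @ word_inv y @ x @ y"

text \<open>
  The congruence on the words over \<open>S\<close> generated by free cancellation and by the
  relations \<open>R\<close>, where a pair \<open>(s, t)\<close> in \<open>R\<close> is the relation \<open>s = t\<close>.
\<close>

inductive word_eq :: "'x set \<Rightarrow> ('x word \<times> 'x word) set \<Rightarrow> 'x word \<Rightarrow> 'x word \<Rightarrow> bool"
  for S R where
  refl: "w \<in> words S \<Longrightarrow> word_eq S R w w"
| sym: "word_eq S R v w \<Longrightarrow> word_eq S R w v"
| trans: "word_eq S R u v \<Longrightarrow> word_eq S R v w \<Longrightarrow> word_eq S R u w"
| cancel: "u \<in> words S \<Longrightarrow> v \<in> words S \<Longrightarrow> x \<in> S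
    \<Longrightarrow> word_eq S R (u @ [(x, e), (x, \<not> e)] @ v) (u @ v)"
| rel: "u \<in> words S \<Longrightarrow> v \<in> words S \<Longrightarrow> (s, t) \<in> R \<Longrightarrow> s \<in> words S \<Longrightarrow> t \<in> words S
    \<Longrightarrow> word_eq S R (u @ s @ v) (u @ t @ v)"

definition presented :: "'x set \<Rightarrow> ('x word \<times> 'x word) set \<Rightarrow> 'x word set monoid"
  where "presented S R =
    \<lparr>carrier = words S // {(v, w). word_eq S R v w},
     monoid.mult = (\<lambda>P Q. {w. \<exists>x\<in>P. \<exists>y\<in>Q. word_eq S R (x @ y) w}),
     one = {w. word_eq S R [] w}\<rparr>"

lemma word_eq_words: "word_eq S R v w \<Longrightarrow> v \<in> words S \<and> w \<in> words S"
  by (induction rule: word_eq.induct) (auto simp: words_def)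

lemma word_eq_context:
  assumes "word_eq S R v w" "p \<in> words S" "q \<in> words S"
  shows "word_eq S R (p @ v @ q) (p @ w @ q)"
  using assms
proof (induction rule: word_eq.induct)
  case (refl w)
  then show ?case by (intro word_eq.refl) (auto simp: words_def)
next
  case (sym v w)
  then show ?case by (blast intro: word_eq.sym)
next
  case (trans u v w)
  then show ?case by (blast intro: word_eq.trans)
next
  case (cancel u v x e)
  then show ?case
    using word_eq.cancel[of "p @ u" S "v @ q" x R e] by (simp add: words_def)
next
  case (rel u v s t)
  then show ?case
    using word_eq.rel[of "p @ u" S "v @ q" s t R] by (simp add: words_def)
qed

lemma word_eq_append:
  assumes "word_eq S R v v'" "word_eq S R w w'"
  shows "word_eq S R (v @ w) (v' @ w')"
  using word_eq_context[OF assms(1), of "[]" w] word_eq_context[OF assms(2), of v' "[]"]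
    word_eq_words[OF assms(1)] word_eq_words[OF assms(2)]
  by (auto simp: words_def intro: word_eq.trans)

lemma word_inv_words: "w \<in> words S \<Longrightarrow> word_inv w \<in> words S"
  by (auto simp: words_def word_inv_def)

lemma word_eq_inv_left: "w \<in> words S \<Longrightarrow> word_eq S R (word_inv w @ w) []"
proof (induction w)
  case Nil
  then show ?case by (simp add: word_inv_def word_eq.refl)
next
  case (Cons l w)
  obtain x e where l: "l = (x, e)" by (cases l)
  have w: "w \<in> words S" and x: "x \<in> S" using Cons.prems l by (auto simp: words_def)
  have "word_eq S R (word_inv w @ [(x, \<not> e), (x, \<not> \<not> e)] @ w) (word_inv w @ w)"
    by (rule word_eq.cancel) (use w x word_inv_words in auto)
  then have "word_eq S R (word_inv (l # w) @ l # w) (word_inv w @ w)"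
    by (simp add: l word_inv_def)
  then show ?case using Cons.IH[OF w] by (rule word_eq.trans)
qed

lemma equiv_word_eq: "equiv (words S) {(v, w). word_eq S R v w}"
  by (rule equivI)
    (auto simp: refl_on_def sym_def trans_def dest: word_eq_words
      intro: word_eq.refl word_eq.sym word_eq.trans)

lemma presented_mult:
  assumes "v \<in> words S" "w \<in> words S"
  shows "{u. word_eq S R v u} \<otimes>\<^bsub>presented S R\<^esub> {u. word_eq S R w u} = {u. word_eq S R (v @ w) u}"
  using assms
  by (auto simp: presented_def intro: word_eq.refl word_eq.trans dest: word_eq_append)

lemma presented_carrier:
  "carrier (presented S R) = (\<lambda>w. {u. word_eq S R w u}) ` words S"
  by (auto simp: presented_def quotient_def Image_def)

lemma group_presented: "group (presented S R)"
proof (rule groupI)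
  have one: "\<one>\<^bsub>presented S R\<^esub> = {u. word_eq S R [] u}" by (simp add: presented_def)
  have Nil: "[] \<in> words S" by (simp add: words_def)
  have app: "v @ w \<in> words S" if "v \<in> words S" "w \<in> words S" for v w
    using that by (simp add: words_def)
  show "\<one>\<^bsub>presented S R\<^esub> \<in> carrier (presented S R)"
    using Nil by (auto simp: one presented_carrier)
  fix P assume "P \<in> carrier (presented S R)"
  then obtain v where v: "v \<in> words S" "P = {u. word_eq S R v u}"
    by (auto simp: presented_carrier)
  show "\<one>\<^bsub>presented S R\<^esub> \<otimes>\<^bsub>presented S R\<^esub> P = P"
    using v Nil by (simp add: one presented_mult)
  have "{u. word_eq S R (word_inv v @ v) u} = {u. word_eq S R [] u}"
    using word_eq_inv_left[OF v(1), of R] by (auto intro: word_eq.trans word_eq.sym)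
  then show "\<exists>Q\<in>carrier (presented S R). Q \<otimes>\<^bsub>presented S R\<^esub> P = \<one>\<^bsub>presented S R\<^esub>"
    using v word_inv_words[OF v(1)]
    by (intro bexI[of _ "{u. word_eq S R (word_inv v) u}"])
      (auto simp: presented_mult one presented_carrier)
  fix Q assume "Q \<in> carrier (presented S R)"
  then obtain w where w: "w \<in> words S" "Q = {u. word_eq S R w u}"
    by (auto simp: presented_carrier)
  show "P \<otimes>\<^bsub>presented S R\<^esub> Q \<in> carrier (presented S R)"
    using v w app by (auto simp: presented_mult presented_carrier)
  fix T assume "T \<in> carrier (presented S R)"
  then obtain z where z: "z \<in> words S" "T = {u. word_eq S R z u}"
    by (auto simp: presented_carrier)
  show "P \<otimes>\<^bsub>presented S R\<^esub> Q \<otimes>\<^bsub>presented S R\<^esub> T = P \<otimes>\<^bsub>presented S R\<^esub> (Q \<otimes>\<^bsub>presented S R\<^esub> T)"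
    using v w z app by (simp add: presented_mult)
qed


section \<open>The factors\<close>

text \<open>
  All factors of a central product are presented over the same type of generators, so that
  they have one common type and can be collected in a list.
\<close>

datatype gen = Ga | Gb | Gd

abbreviation wa :: "gen word" where "wa \<equiv> [(Ga, True)]"
abbreviation wb :: "gen word" where "wb \<equiv> [(Gb, True)]"
abbreviation wd :: "gen word" where "wd \<equiv> [(Gd, True)]"

definition D8 :: "gen word set monoid"
  where "D8 = presented {Ga, Gb}
    {(word_pow wa 4, []), (word_pow wb 2, []), (word_conj wa wb, word_inv wa)}"

definition Q8 :: "gen word set monoid"
  where "Q8 = presented {Ga, Gb}
    {(word_pow wa 4, []), (word_pow wb 2, word_pow wa 2), (word_conj wa wb, word_inv wa)}"

definition M2 :: "nat \<Rightarrow> nat \<Rightarrow> gen word set monoid"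
  where "M2 u v = presented {Ga, Gb}
    {(word_pow wa (2 ^ u), []), (word_pow wb (2 ^ v), []),
     (word_conj wa wb, word_pow wa (1 + 2 ^ (u - 1)))}"

text \<open>\<open>M2_1_1 w\<close> is the group \<open>M\<^sub>2(w, 1, 1)\<close>.\<close>

definition M2_1_1 :: "nat \<Rightarrow> gen word set monoid"
  where "M2_1_1 w = presented {Ga, Gb, Gd}
    {(word_pow wa (2 ^ w), []), (word_pow wb 2, []), (word_pow wd 2, []),
     (word_comm wa wb, wd), (word_comm wd wa, []), (word_comm wd wb, [])}"

text \<open>
  The cyclic group of order \<open>k\<close> as a central factor; it is isomorphic to
  \<^term>\<open>integer_mod_group k\<close>, but has the type of the other factors.
\<close>

definition Cyc :: "nat \<Rightarrow> gen word set monoid"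
  where "Cyc k = presented {Ga} {(word_pow wa k, [])}"


section \<open>Central products\<close>

text \<open>
  The subgroup of order 2 along which a factor is amalgamated: the derived subgroup of a
  nonabelian factor, the unique subgroup of order 2 of a cyclic factor.
\<close>

definition amalg :: "('a, 'b) monoid_scheme \<Rightarrow> 'a set"
  where "amalg H =
    (if comm_group H then (THE K. subgroup K H \<and> card K = 2) else derived H (carrier H))"

text \<open>
  Let \<open>H\<^sub>i\<close> be the factors and \<open>{1, c\<^sub>i}\<close> their amalgamated subgroups of order 2. Identifying
  all the \<open>c\<^sub>i\<close> with one element \<open>c\<close> of order 2 means dividing the direct product by the kernel
  of the multiplication map from the product of the \<open>{1, c\<^sub>i}\<close> to \<open>{1, c}\<close>, that is, by the
  tuples with an even number of entries \<open>c\<^sub>i\<close> and all other entries 1.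
\<close>

definition central_product_kernel :: "'a monoid list \<Rightarrow> (nat \<Rightarrow> 'a) set"
  where "central_product_kernel Hs =
    {f \<in> (\<Pi>\<^sub>E i\<in>{..<length Hs}. amalg (Hs ! i)).
      even (card {i \<in> {..<length Hs}. f i \<noteq> \<one>\<^bsub>Hs ! i\<^esub>})}"

definition central_product :: "'a monoid list \<Rightarrow> (nat \<Rightarrow> 'a) set monoid"
  where "central_product Hs =
    product_group {..<length Hs} (\<lambda>i. Hs ! i) Mod central_product_kernel Hs"

definition Z2_power :: "nat \<Rightarrow> (nat \<Rightarrow> int) monoid"
  where "Z2_power s = product_group {..<s} (\<lambda>_. integer_mod_group 2)"


section \<open>Notions for the hypotheses\<close>

definition center :: "('a, 'b) monoid_scheme \<Rightarrow> 'a set"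
  where "center G = {x \<in> carrier G. \<forall>y\<in>carrier G. x \<otimes>\<^bsub>G\<^esub> y = y \<otimes>\<^bsub>G\<^esub> x}"

definition elementary_abelian_2 :: "('a, 'b) monoid_scheme \<Rightarrow> bool"
  where "elementary_abelian_2 G \<longleftrightarrow>
    comm_group G \<and> (\<forall>x\<in>carrier G. x [^]\<^bsub>G\<^esub> (2::nat) = \<one>\<^bsub>G\<^esub>)"

text \<open>The subgroup \<open>P\<close> of \<open>G\<close> is the internal direct product of the subgroups \<open>H i\<close>, \<open>i \<in> I\<close>.\<close>

definition internal_direct_product ::
    "('a, 'b) monoid_scheme \<Rightarrow> 'i set \<Rightarrow> ('i \<Rightarrow> 'a set) \<Rightarrow> 'a set \<Rightarrow> bool"
  where "internal_direct_product G I H P \<longleftrightarrow>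
    subgroup P G \<and>
    (\<forall>i\<in>I. H i \<lhd> G\<lparr>carrier := P\<rparr>) \<and>
    generate G (\<Union>i\<in>I. H i) = P \<and>
    (\<forall>i\<in>I. H i \<inter> generate G (\<Union>j\<in>I - {i}. H j) = {\<one>\<^bsub>G\<^esub>})"

end

theory Submission
  imports Defs
begin

text \<open>
  The commutator form makes \<open>G / Z(G)\<close> a symplectic space over the field with two elements.
  Since squares lie in \<open>N = \<langle>z\<^sub>1\<rangle> \<times> \<langle>z\<^sub>2\<rangle>\<close>, the parities of the exponents of \<open>z\<^sub>1\<close> and \<open>z\<^sub>2\<close> in \<open>x\<^sup>2\<close>
  give two functions on \<open>G / Z(G)\<close>. The second is always linear and the first is linear for
  \<open>n \<ge> 2\<close>, so that they are \<open>[u\<^sub>1, -]\<close> and \<open>[u\<^sub>2, -]\<close> for some \<open>u\<^sub>1, u\<^sub>2\<close>; for \<open>n = 1\<close> the first is a quadratic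
  form for the commutator form. The linear relations between the two functions and the
  commutator \<open>[u\<^sub>1, u\<^sub>2]\<close> (for \<open>n = 1\<close>, the value \<open>u\<^sub>2\<^sup>2\<close>) determine the factor that carries them.
  On its orthogonal complement every element squares into \<open>{1, c}\<close> after a central adjustment, and
  splitting off hyperbolic planes as long as there is a noncentral involution leaves copies of
  \<open>D\<^sub>8\<close> and at most one \<open>Q\<^sub>8\<close>. The presented factors map to \<open>G\<close> by von Dyck's theorem, and no
  injectivity has to be checked: a normal form bounds their orders from above, and the resulting
  surjection from the central product is an isomorphism by counting.
\<close>

section \<open>Evaluating words and von Dyck's theorem\<close>

text \<open>A plane that carries a parity function contains an element u that represents the
  function as [u, -]. The form is alternating, so the function vanishes at u itself, and it vanishes
  on the orthogonal complement of every plane through u; the partner of u in the plane carries the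
  odd exponent. For n >= 2 this removes both functions. For n = 1 the involution c is z_1 itself, so
  that an odd exponent of z_1 is harmless modulo c and only the second function has to be removed.

  The count balances for the following reason. A plane enlarges the group by the factor 4, while D_8
  or Q_8 has order at most 8, and the surplus 2 is lost when the involution of the factor is
  identified with c. The special factors behave in the same way, except that they also absorb one or
  both of the groups generated by z_1 and z_2. Hence upper bounds from normal forms meet the lower
  bound for the order of G that comes from the independent generators of the centre and the planes
  split off.\<close>

definition word_eval :: "('g, 'b) monoid_scheme \<Rightarrow> ('x \<Rightarrow> 'g) \<Rightarrow> 'x word \<Rightarrow> 'g"
  where "word_eval G f w =
    foldr (\<lambda>(x, e) y. (if e then f x else inv\<^bsub>G\<^esub> f x) \<otimes>\<^bsub>G\<^esub> y) w \<one>\<^bsub>G\<^esub>"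

definition word_class :: "'x set \<Rightarrow> ('x word \<times> 'x word) set \<Rightarrow> 'x word \<Rightarrow> 'x word set"
  where "word_class S R w = {u. word_eq S R w u}"

abbreviation gen_class :: "'x set \<Rightarrow> ('x word \<times> 'x word) set \<Rightarrow> 'x \<Rightarrow> 'x word set"
  where "gen_class S R x \<equiv> word_class S R [(x, True)]"

lemma words_Nil [simp]: "[] \<in> words S"
  by (simp add: words_def)

lemma words_Cons [simp]: "(x, e) # w \<in> words S \<longleftrightarrow> x \<in> S \<and> w \<in> words S"
  by (auto simp: words_def)

lemma words_append [simp]: "v @ w \<in> words S \<longleftrightarrow> v \<in> words S \<and> w \<in> words S"
  by (auto simp: words_def)

lemma words_inv [simp]: "word_inv w \<in> words S \<longleftrightarrow> w \<in> words S"
  using word_inv_words[of w S] word_inv_words[of "word_inv w" S]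
  by (auto simp: word_inv_def rev_map comp_def case_prod_unfold)

lemma words_pow: "w \<in> words S \<Longrightarrow> word_pow w k \<in> words S"
  by (induction k) (auto simp: word_pow_def)

lemma word_eval_Nil [simp]: "word_eval G f [] = \<one>\<^bsub>G\<^esub>"
  by (simp add: word_eval_def)

lemma word_eval_Cons:
  "word_eval G f ((x, e) # w) = (if e then f x else inv\<^bsub>G\<^esub> f x) \<otimes>\<^bsub>G\<^esub> word_eval G f w"
  by (simp add: word_eval_def)

context group
begin

lemma word_eval_closed:
  assumes "f \<in> S \<rightarrow> carrier G" "w \<in> words S"
  shows "word_eval G f w \<in> carrier G"
  using assms(2)
proof (induction w)
  case (Cons l w)
  then show ?case using assms(1) by (cases l) (auto simp: word_eval_Cons)
qed simp

lemma word_eval_append: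
  assumes f: "f \<in> S \<rightarrow> carrier G" and "v \<in> words S" and w: "w \<in> words S"
  shows "word_eval G f (v @ w) = word_eval G f v \<otimes> word_eval G f w"
  using assms(2)
proof (induction v)
  case Nil
  then show ?case using word_eval_closed[OF f w] by simp
next
  case (Cons l v)
  then show ?case using funcset_mem[OF f] word_eval_closed[OF f w] word_eval_closed[OF f, of v]
    by (cases l) (auto simp: word_eval_Cons m_assoc)
qed

lemma word_eval_letter:
  assumes "f \<in> S \<rightarrow> carrier G" "x \<in> S"
  shows "word_eval G f [(x, True)] = f x"
  using funcset_mem[OF assms] by (simp add: word_eval_Cons)

lemma word_eval_inv:
  assumes f: "f \<in> S \<rightarrow> carrier G" and "w \<in> words S"
  shows "word_eval G f (word_inv w) = inv (word_eval G f w)"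
  using assms(2)
proof (induction w)
  case (Cons l w)
  obtain x e where l: "l = (x, e)" by (cases l)
  have x: "x \<in> S" "f x \<in> carrier G" and w: "w \<in> words S" using Cons.prems l f by auto
  have "word_inv (l # w) = word_inv w @ [(x, \<not> e)]" by (simp add: word_inv_def l)
  then have "word_eval G f (word_inv (l # w)) =
      inv (word_eval G f w) \<otimes> (if e then inv f x else f x)"
    using Cons.IH[OF w] w x by (simp add: word_eval_append[OF f] word_eval_Cons)
  also have "\<dots> = inv (word_eval G f (l # w))"
    using x word_eval_closed[OF f w] by (simp add: l word_eval_Cons inv_mult_group)
  finally show ?case .
qed (simp add: word_inv_def)

lemma word_eval_pow:
  assumes f: "f \<in> S \<rightarrow> carrier G" and w: "w \<in> words S"
  shows "word_eval G f (word_pow w k) = word_eval G f w [^] k"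
proof (induction k)
  case (Suc k)
  have "word_pow w (Suc k) = w @ word_pow w k" by (simp add: word_pow_def)
  then show ?case
    using Suc words_pow[OF w] word_eval_closed[OF f w] w
    by (subst nat_pow_Suc2) (simp_all add: word_eval_append[OF f])
qed (simp add: word_pow_def)

lemma word_eval_conj:
  assumes f: "f \<in> S \<rightarrow> carrier G" and "v \<in> words S" "w \<in> words S"
  shows "word_eval G f (word_conj v w) =
    inv (word_eval G f w) \<otimes> (word_eval G f v \<otimes> word_eval G f w)"
  using assms by (simp add: word_conj_def word_eval_append[OF f] word_eval_inv[OF f])

lemma word_eval_comm:
  assumes f: "f \<in> S \<rightarrow> carrier G" and "v \<in> words S" "w \<in> words S"
  shows "word_eval G f (word_comm v w) = inv (word_eval G f v) \<otimes>
    (inv (word_eval G f w) \<otimes> (word_eval G f v \<otimes> word_eval G f w))"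
  using assms by (simp add: word_comm_def word_eval_append[OF f] word_eval_inv[OF f])

lemma word_eval_cong:
  assumes f: "f \<in> S \<rightarrow> carrier G"
    and R: "\<And>s t. (s, t) \<in> R \<Longrightarrow> word_eval G f s = word_eval G f t"
    and "word_eq S R v w"
  shows "word_eval G f v = word_eval G f w"
  using assms(3)
proof (induction rule: word_eq.induct)
  case (cancel u v x e)
  have "f x \<in> carrier G" using f cancel by auto
  then have "word_eval G f ([(x, e), (x, \<not> e)] @ v) = word_eval G f v"
    using word_eval_closed[OF f, of v] cancel
    by (cases e) (auto simp: word_eval_Cons m_assoc[symmetric])
  then show ?case using cancel
    by (subst (1 2) word_eval_append[OF f]) auto
next
  case (rel u v s t)
  then show ?case by (simp add: word_eval_append[OF f] R[OF rel(3)])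
qed auto

text \<open>Von Dyck's theorem. A class is mapped to the value of an arbitrary representative;
  \<open>word_eval_cong\<close> makes the choice immaterial.\<close>

lemma presented_lift:
  assumes f: "f \<in> S \<rightarrow> carrier G"
    and R: "\<And>s t. (s, t) \<in> R \<Longrightarrow> word_eval G f s = word_eval G f t"
  obtains h where "h \<in> hom (presented S R) G"
    and "\<And>x. x \<in> S \<Longrightarrow> h (gen_class S R x) = f x"
proof -
  define h where "h P = word_eval G f (SOME w. w \<in> P)" for P
  have h: "h (word_class S R w) = word_eval G f w" if "w \<in> words S" for w
  proof -
    have "w \<in> word_class S R w" using that by (auto simp: word_class_def intro: word_eq.refl)
    then have "(SOME u. u \<in> word_class S R w) \<in> word_class S R w" by (rule someI)
    then show ?thesis
      using word_eval_cong[OF f R] by (auto simp: h_def word_class_def)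
  qed
  have "h \<in> hom (presented S R) G"
  proof (rule homI)
    fix P assume "P \<in> carrier (presented S R)"
    then obtain v where v: "v \<in> words S" "P = word_class S R v"
      by (auto simp: presented_carrier word_class_def)
    then show "h P \<in> carrier G" using h word_eval_closed[OF f] by simp
    fix Q assume "Q \<in> carrier (presented S R)"
    then obtain w where w: "w \<in> words S" "Q = word_class S R w"
      by (auto simp: presented_carrier word_class_def)
    have "P \<otimes>\<^bsub>presented S R\<^esub> Q = word_class S R (v @ w)"
      using v w presented_mult by (simp add: word_class_def)
    then show "h (P \<otimes>\<^bsub>presented S R\<^esub> Q) = h P \<otimes> h Q"
      using v w by (simp add: h word_eval_append[OF f])
  qed
  moreover have "h (gen_class S R x) = f x" if "x \<in> S" for x
    using h[of "[(x, True)]"] that f by (simp add: word_eval_letter[OF f])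
  ultimately show thesis by (rule that)
qed

end

lemma word_class_closed: "w \<in> words S \<Longrightarrow> word_class S R w \<in> carrier (presented S R)"
  by (auto simp: presented_carrier word_class_def)

lemma gen_class_funcset: "gen_class S R \<in> S \<rightarrow> carrier (presented S R)"
  by (auto intro: word_class_closed)

lemma word_class_append:
  assumes "v \<in> words S" "w \<in> words S"
  shows "word_class S R (v @ w) = word_class S R v \<otimes>\<^bsub>presented S R\<^esub> word_class S R w"
  using presented_mult[OF assms] by (simp add: word_class_def)

lemma word_class_cong: "word_eq S R v w \<Longrightarrow> word_class S R v = word_class S R w"
  by (auto simp: word_class_def intro: word_eq.trans word_eq.sym)

lemma word_class_Nil: "word_class S R [] = \<one>\<^bsub>presented S R\<^esub>"
  by (simp add: word_class_def presented_def)

lemma word_class_inv_letter: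
  assumes "x \<in> S"
  shows "inv\<^bsub>presented S R\<^esub> gen_class S R x = word_class S R [(x, False)]"
proof -
  interpret P: group "presented S R" by (rule group_presented)
  have "word_class S R [(x, False)] \<otimes>\<^bsub>presented S R\<^esub> gen_class S R x = \<one>\<^bsub>presented S R\<^esub>"
    using assms word_eq.cancel[of "[]" S "[]" x R False]
    by (simp flip: word_class_append word_class_Nil add: word_class_cong)
  then show ?thesis using assms by (intro P.inv_equality) (auto intro: word_class_closed)
qed

lemma word_eval_gen_class:
  assumes "w \<in> words S"
  shows "word_eval (presented S R) (gen_class S R) w = word_class S R w"
  using assms
proof (induction w)
  case (Cons l w)
  obtain x e where l: "l = (x, e)" by (cases l)
  then show ?case
    using Cons word_class_append[of "[(x, e)]" S w R] word_class_inv_letter[of x S R]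
    by (auto simp: word_eval_Cons)
qed (simp add: word_class_Nil)

text \<open>Turns a relation between words into an equation between elements of the presented group,
  so that all further work is group theory.\<close>

lemma presented_relation:
  assumes "(s, t) \<in> R" "s \<in> words S" "t \<in> words S"
  shows "word_eval (presented S R) (gen_class S R) s =
    word_eval (presented S R) (gen_class S R) t"
  using word_eq.rel[of "[]" S "[]" s t R] assms
  by (simp add: word_eval_gen_class word_class_cong)

lemma presented_generate:
  "carrier (presented S R) = generate (presented S R) (gen_class S R ` S)" (is "_ = ?A")
proof
  interpret P: group "presented S R" by (rule group_presented)
  show "?A \<subseteq> carrier (presented S R)"
    by (rule P.generate_incl) (auto intro: word_class_closed)
  have "word_class S R w \<in> ?A" if "w \<in> words S" for w
    using that
  proof (induction w)
    case Nil
    then show ?case by (simp add: word_class_Nil generate.one)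
  next
    case (Cons l w)
    obtain x e where l: "l = (x, e)" by (cases l)
    have "word_class S R [(x, e)] \<in> ?A"
      using Cons.prems l word_class_inv_letter[of x S R, symmetric]
      by (cases e) (auto intro: generate.incl generate.inv)
    then show ?case
      using Cons l word_class_append[of "[(x, e)]" S w R] by (auto intro: generate.eng)
  qed
  then show "carrier (presented S R) \<subseteq> ?A"
    by (auto simp: presented_carrier word_class_def)
qed

section \<open>Homomorphisms out of central products\<close>

text \<open>The order of the factors is fixed because the target need not be abelian.\<close>

primrec ordered_prod :: "('g, 'b) monoid_scheme \<Rightarrow> (nat \<Rightarrow> 'x \<Rightarrow> 'g) \<Rightarrow> nat \<Rightarrow> (nat \<Rightarrow> 'x) \<Rightarrow> 'g"
  where
    "ordered_prod G \<phi> 0 f = \<one>\<^bsub>G\<^esub>"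
  | "ordered_prod G \<phi> (Suc k) f = ordered_prod G \<phi> k f \<otimes>\<^bsub>G\<^esub> \<phi> k (f k)"

definition commuting_sets :: "('g, 'b) monoid_scheme \<Rightarrow> 'g set \<Rightarrow> 'g set \<Rightarrow> bool"
  where "commuting_sets G A B \<longleftrightarrow> (\<forall>a\<in>A. \<forall>b\<in>B. a \<otimes>\<^bsub>G\<^esub> b = b \<otimes>\<^bsub>G\<^esub> a)"

lemma commuting_sets_sym: "commuting_sets G A B \<Longrightarrow> commuting_sets G B A"
  by (auto simp: commuting_sets_def)

context group
begin

lemma ordered_prod_closed:
  assumes "\<And>i. i < k \<Longrightarrow> \<phi> i (f i) \<in> carrier G"
  shows "ordered_prod G \<phi> k f \<in> carrier G"
  using assms by (induction k) auto

lemma commute_prod: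
  assumes "a \<in> carrier G" "b \<in> carrier G" "x \<in> carrier G" "a \<otimes> x = x \<otimes> a" "b \<otimes> x = x \<otimes> b"
  shows "(a \<otimes> b) \<otimes> x = x \<otimes> (a \<otimes> b)"
  using assms by (metis m_assoc)

lemma ordered_prod_commute:
  assumes "\<And>i. i < k \<Longrightarrow> \<phi> i (f i) \<in> carrier G" "x \<in> carrier G"
    and "\<And>i. i < k \<Longrightarrow> \<phi> i (f i) \<otimes> x = x \<otimes> \<phi> i (f i)"
  shows "ordered_prod G \<phi> k f \<otimes> x = x \<otimes> ordered_prod G \<phi> k f"
  using assms
proof (induction k)
  case (Suc k)
  then show ?case using ordered_prod_closed[of k \<phi> f] by (auto intro!: commute_prod)
qed auto

text \<open>Induction over initial segments: the new factor of \<open>f\<close> is moved to the left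
  past the product of the earlier factors of \<open>g\<close>, with which it commutes.\<close>

lemma ordered_prod_hom:
  assumes H: "\<And>i. i < k \<Longrightarrow> group (H i)"
    and \<phi>: "\<And>i. i < k \<Longrightarrow> \<phi> i \<in> hom (H i) G"
    and comm: "\<And>i j. i < j \<Longrightarrow> j < k \<Longrightarrow>
      commuting_sets G (\<phi> i ` carrier (H i)) (\<phi> j ` carrier (H j))"
  shows "ordered_prod G \<phi> k \<in> hom (product_group {..<k} H) G"
proof (rule homI)
  fix f assume "f \<in> carrier (product_group {..<k} H)"
  then have f: "f i \<in> carrier (H i)" if "i < k" for i using that by auto
  have \<phi>f: "\<phi> i (f i) \<in> carrier G" if "i < k" for i using that f \<phi> by (auto dest: hom_in_carrier)
  then show "ordered_prod G \<phi> k f \<in> carrier G" by (rule ordered_prod_closed)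
  fix g assume "g \<in> carrier (product_group {..<k} H)"
  then have g: "g i \<in> carrier (H i)" if "i < k" for i using that by auto
  have \<phi>g: "\<phi> i (g i) \<in> carrier G" if "i < k" for i using that g \<phi> by (auto dest: hom_in_carrier)
  have "ordered_prod G \<phi> j (\<lambda>i\<in>{..<k}. f i \<otimes>\<^bsub>H i\<^esub> g i) =
      ordered_prod G \<phi> j f \<otimes> ordered_prod G \<phi> j g" if "j \<le> k" for j
    using that
  proof (induction j)
    case (Suc j)
    then have j: "j < k" by simp
    let ?F = "ordered_prod G \<phi> j f" and ?G = "ordered_prod G \<phi> j g"
    have closed: "?F \<in> carrier G" "?G \<in> carrier G" "\<phi> j (f j) \<in> carrier G" "\<phi> j (g j) \<in> carrier G"
      using \<phi>f \<phi>g j by (auto intro!: ordered_prod_closed)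
    have "?G \<otimes> \<phi> j (f j) = \<phi> j (f j) \<otimes> ?G"
      using comm[OF _ j] f g j \<phi>f \<phi>g by (intro ordered_prod_commute) (auto simp: commuting_sets_def)
    then have "?F \<otimes> ?G \<otimes> (\<phi> j (f j) \<otimes> \<phi> j (g j)) = ?F \<otimes> \<phi> j (f j) \<otimes> (?G \<otimes> \<phi> j (g j))"
      using closed by (metis m_assoc m_closed)
    moreover have "\<phi> j (f j \<otimes>\<^bsub>H j\<^esub> g j) = \<phi> j (f j) \<otimes> \<phi> j (g j)"
      using \<phi>[OF j] f g j by (auto simp: hom_mult)
    ultimately show ?case using Suc j by simp
  qed simp
  from this[of k] show "ordered_prod G \<phi> k (f \<otimes>\<^bsub>product_group {..<k} H\<^esub> g) =
      ordered_prod G \<phi> k f \<otimes> ordered_prod G \<phi> k g" by simp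
qed

lemma ordered_prod_single:
  assumes H: "\<And>i. i < k \<Longrightarrow> group (H i)"
    and \<phi>: "\<And>i. i < k \<Longrightarrow> \<phi> i \<in> hom (H i) G"
    and j: "j < k" and x: "x \<in> carrier (H j)"
  shows "ordered_prod G \<phi> k (\<lambda>i\<in>{..<k}. if i = j then x else \<one>\<^bsub>H i\<^esub>) = \<phi> j x"
proof -
  let ?f = "\<lambda>i\<in>{..<k}. if i = j then x else \<one>\<^bsub>H i\<^esub>"
  have \<phi>x: "\<phi> j x \<in> carrier G" using \<phi>[OF j] x by (rule hom_in_carrier)
  have "ordered_prod G \<phi> l ?f = (if j < l then \<phi> j x else \<one>)" if "l \<le> k" for l
    using that
  proof (induction l)
    case (Suc l)
    then have "\<phi> l \<one>\<^bsub>H l\<^esub> = \<one>" using H \<phi> is_group by (auto intro!: hom_one)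
    then show ?case using Suc \<phi>x by (auto simp: less_Suc_eq)
  qed simp
  from this[of k] j show ?thesis by simp
qed

lemma DirProd_hom:
  assumes \<phi>: "\<phi> \<in> hom A G" and \<psi>: "\<psi> \<in> hom B G"
    and comm: "commuting_sets G (\<phi> ` carrier A) (\<psi> ` carrier B)"
  shows "(\<lambda>(x, y). \<phi> x \<otimes> \<psi> y) \<in> hom (A \<times>\<times> B) G"
proof (rule homI)
  fix p assume "p \<in> carrier (A \<times>\<times> B)"
  then obtain x y where p: "p = (x, y)" "x \<in> carrier A" "y \<in> carrier B" by auto
  have c1: "\<phi> x \<in> carrier G" "\<psi> y \<in> carrier G" using p \<phi> \<psi> by (auto dest: hom_in_carrier)
  then show "(case p of (x, y) \<Rightarrow> \<phi> x \<otimes> \<psi> y) \<in> carrier G" using p by simp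
  fix q assume "q \<in> carrier (A \<times>\<times> B)"
  then obtain u v where q: "q = (u, v)" "u \<in> carrier A" "v \<in> carrier B" by auto
  have c2: "\<phi> u \<in> carrier G" "\<psi> v \<in> carrier G" using q \<phi> \<psi> by (auto dest: hom_in_carrier)
  have "\<phi> u \<otimes> \<psi> y = \<psi> y \<otimes> \<phi> u" using comm p q by (auto simp: commuting_sets_def)
  then have "\<phi> x \<otimes> \<phi> u \<otimes> (\<psi> y \<otimes> \<psi> v) = \<phi> x \<otimes> \<psi> y \<otimes> (\<phi> u \<otimes> \<psi> v)"
    using c1 c2 by (metis m_assoc m_closed)
  then show "(case p \<otimes>\<^bsub>A \<times>\<times> B\<^esub> q of (x, y) \<Rightarrow> \<phi> x \<otimes> \<psi> y) =
      (case p of (x, y) \<Rightarrow> \<phi> x \<otimes> \<psi> y) \<otimes> (case q of (x, y) \<Rightarrow> \<phi> x \<otimes> \<psi> y)"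
    using p q \<phi> \<psi> by (simp add: hom_mult)
qed

end

section \<open>Central factors, the amalgamation kernel, and the isomorphism by counting\<close>

lemma (in group_hom) card_eq_image_times_kernel:
  assumes "finite (carrier G)" "h ` carrier G = carrier H"
  shows "order G = order H * card (kernel G H h)"
proof -
  have "card (carrier (G Mod kernel G H h)) = order H"
    using FactGroup_iso[OF assms(2)] unfolding order_def by (rule iso_same_card)
  moreover have "card (rcosets\<^bsub>G\<^esub> kernel G H h) * card (kernel G H h) = order G"
    using assms(1) by (intro group.lagrange) (auto intro: subgroup_kernel)
  ultimately show ?thesis by (simp add: FactGroup_def)
qed

text \<open>A factor is paired with a homomorphism to \<open>G\<close> instead of being identified
  with a subgroup. If \<open>c\<close> is not the identity, the condition that \<open>t\<close> goes
  to \<open>c\<close> guarantees that \<open>{1, t}\<close> really has order 2.\<close>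

definition central_factor ::
    "('g, 'b) monoid_scheme \<Rightarrow> 'g \<Rightarrow> 'x monoid \<times> ('x \<Rightarrow> 'g) \<Rightarrow> bool"
  where "central_factor G c F \<longleftrightarrow> group (fst F) \<and> finite (carrier (fst F)) \<and>
    snd F \<in> hom (fst F) G \<and>
    (\<exists>t\<in>carrier (fst F). amalg (fst F) = {\<one>\<^bsub>fst F\<^esub>, t} \<and> snd F t = c)"

definition factor_image :: "'x monoid \<times> ('x \<Rightarrow> 'g) \<Rightarrow> 'g set"
  where "factor_image F = snd F ` carrier (fst F)"

abbreviation factor_spanned ::
    "('g, 'b) monoid_scheme \<Rightarrow> 'g \<Rightarrow> 'x monoid \<times> ('x \<Rightarrow> 'g) \<Rightarrow> 'g set \<Rightarrow> bool"
  where "factor_spanned G c F A \<equiv> central_factor G c F \<and> factor_image F = generate G A"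

definition central_family ::
    "('g, 'b) monoid_scheme \<Rightarrow> 'g \<Rightarrow> ('x monoid \<times> ('x \<Rightarrow> 'g)) list \<Rightarrow> bool"
  where "central_family G c Fs \<longleftrightarrow> (\<forall>F\<in>set Fs. central_factor G c F) \<and>
    sorted_wrt (\<lambda>F F'. commuting_sets G (factor_image F) (factor_image F')) Fs"

text \<open>Amalgamation divides the order by 2 for every factor but one. This lower bound is the
  counterpart of the upper bounds for the orders of the factors.\<close>

lemma card_central_product_kernel_ge:
  assumes s: "length Hs = Suc s"
    and t: "\<And>i. i \<le> s \<Longrightarrow> amalg (Hs ! i) = {\<one>\<^bsub>Hs ! i\<^esub>, t i} \<and> t i \<noteq> \<one>\<^bsub>Hs ! i\<^esub>"
  shows "finite (central_product_kernel Hs)" "2 ^ s \<le> card (central_product_kernel Hs)"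
proof -
  have "finite (\<Pi>\<^sub>E i\<in>{..<length Hs}. amalg (Hs ! i))"
    using t s by (intro finite_PiE) (auto simp: less_Suc_eq_le)
  then show fin: "finite (central_product_kernel Hs)"
    by (simp add: central_product_kernel_def)
  \<comment> \<open>The last entry is determined by the parity of the support of the others.\<close>
  define F where "F T = (\<lambda>i\<in>{..<Suc s}. if i \<in> T \<or> (i = s \<and> odd (card T)) then t i else \<one>\<^bsub>Hs ! i\<^esub>)"
    for T :: "nat set"
  have supp: "{i \<in> {..<Suc s}. F T i \<noteq> \<one>\<^bsub>Hs ! i\<^esub>} = (if odd (card T) then insert s T else T)"
    if "T \<subseteq> {..<s}" for T
    using that t by (auto simp: F_def less_Suc_eq_le split: if_splits)
  have "F T \<in> central_product_kernel Hs" if "T \<subseteq> {..<s}" for T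
  proof -
    have "finite T" "s \<notin> T" using that finite_subset by auto
    then have "even (card {i \<in> {..<Suc s}. F T i \<noteq> \<one>\<^bsub>Hs ! i\<^esub>})"
      unfolding supp[OF that] by simp
    moreover have "F T \<in> (\<Pi>\<^sub>E i\<in>{..<Suc s}. amalg (Hs ! i))"
      using t by (auto simp: F_def less_Suc_eq_le)
    ultimately show ?thesis by (simp add: central_product_kernel_def s)
  qed
  moreover have "inj_on F (Pow {..<s})"
  proof (rule inj_onI)
    fix T U assume TU: "T \<in> Pow {..<s}" "U \<in> Pow {..<s}" "F T = F U"
    have "T = {i \<in> {..<Suc s}. F T i \<noteq> \<one>\<^bsub>Hs ! i\<^esub>} - {s}" using supp[of T] TU by auto
    also have "\<dots> = U" using supp[of U] TU by auto
    finally show "T = U" .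
  qed
  ultimately have "card (Pow {..<s}) \<le> card (central_product_kernel Hs)"
    using fin by (intro card_inj_on_le) auto
  then show "2 ^ s \<le> card (central_product_kernel Hs)" by (simp add: card_Pow)
qed

context group
begin

text \<open>A product of copies of an involution depends only on the parity of their number, which
  explains the parity condition in \<open>central_product_kernel\<close>.\<close>

lemma ordered_prod_on_amalg:
  assumes c: "c \<in> carrier G" "c \<otimes> c = \<one>"
    and f: "\<And>i. i < k \<Longrightarrow> \<phi> i (f i) = (if f i = u i then \<one> else c)"
  shows "ordered_prod G \<phi> k f = (if even (card {i \<in> {..<k}. f i \<noteq> u i}) then \<one> else c)"
  using f
proof (induction k)
  case (Suc k)
  have *: "{i \<in> {..<Suc k}. f i \<noteq> u i} =
      (if f k = u k then {i \<in> {..<k}. f i \<noteq> u i} else insert k {i \<in> {..<k}. f i \<noteq> u i})"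
    by (auto simp: less_Suc_eq)
  show ?case using Suc c unfolding * by simp
qed simp

text \<open>The factor maps and \<open>\<psi>\<close> combine to a surjection from the direct
  product onto \<open>G\<close>, whose kernel contains the amalgamation kernel times the trivial
  group. The hypothesis \<open>card\<close> bounds the order of the kernel by the known lower bound
  for this subset, so the two agree, and dividing by the amalgamation kernel leaves an
  isomorphism.\<close>

theorem central_product_iso:
  assumes fin: "finite (carrier G)"
    and c: "c \<in> carrier G" "c \<noteq> \<one>" "c \<otimes> c = \<one>"
    and Fs: "central_family G c Fs" "Fs \<noteq> []"
    and W: "group W" "finite (carrier W)" "\<psi> \<in> hom W G"
    and \<psi>: "\<And>w x. w \<in> carrier W \<Longrightarrow> x \<in> carrier G \<Longrightarrow> \<psi> w \<otimes> x = x \<otimes> \<psi> w"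
    and gen: "carrier G = generate G ((\<Union>F\<in>set Fs. factor_image F) \<union> \<psi> ` carrier W)"
    and card: "prod_list (map (\<lambda>F. order (fst F)) Fs) * order W \<le> order G * 2 ^ (length Fs - 1)"
  shows "G \<cong> central_product (map fst Fs) \<times>\<times> W"
proof -
  define s where "s = length Fs"
  define Hs where "Hs = map fst Fs"
  define H where "H i = Hs ! i" for i
  define \<phi> where "\<phi> i = snd (Fs ! i)" for i
  define P where "P = product_group {..<s} H"
  define \<Phi> where "\<Phi> = ordered_prod G \<phi> s"
  define C where "C = central_product_kernel Hs"
  have len: "length Hs = s" by (simp add: Hs_def s_def)
  have Hi: "H i = fst (Fs ! i)" if "i < s" for i using that by (simp add: H_def Hs_def s_def)
  have fac: "central_factor G c (H i, \<phi> i)" if "i < s" for i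
    using Fs that by (simp add: central_family_def Hi \<phi>_def s_def)
  have grp: "group (H i)" "finite (carrier (H i))" "\<phi> i \<in> hom (H i) G" if "i < s" for i
    using fac[OF that] by (auto simp: central_factor_def)
  have "\<exists>t. t \<in> carrier (H i) \<and> amalg (H i) = {\<one>\<^bsub>H i\<^esub>, t} \<and> \<phi> i t = c" if "i < s" for i
    using fac[OF that] by (auto simp: central_factor_def)
  then obtain t where t: "t i \<in> carrier (H i)" "amalg (H i) = {\<one>\<^bsub>H i\<^esub>, t i}" "\<phi> i (t i) = c"
    if "i < s" for i by metis
  have one: "\<phi> i \<one>\<^bsub>H i\<^esub> = \<one>" if "i < s" for i using grp[OF that] is_group by (auto intro!: hom_one)
  have t1: "t i \<noteq> \<one>\<^bsub>H i\<^esub>" if "i < s" for i using t[OF that] one[OF that] c by auto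
  have comm: "commuting_sets G (\<phi> i ` carrier (H i)) (\<phi> j ` carrier (H j))" if "i < j" "j < s" for i j
    using Fs that sorted_wrt_nth_less[of _ Fs i j]
    by (auto simp: central_family_def Hi \<phi>_def s_def factor_image_def)
  have P: "group P" unfolding P_def by (rule product_group) (use grp in auto)
  have \<Phi>: "\<Phi> \<in> hom P G" unfolding \<Phi>_def P_def by (rule ordered_prod_hom) (use grp comm in auto)
  have finP: "finite (carrier P)" unfolding P_def using grp by (auto intro!: finite_PiE)
  have ordP: "order P = prod_list (map (\<lambda>F. order (fst F)) Fs)"
  proof -
    have "order P = (\<Prod>i<s. order (H i))" by (simp add: order_def P_def card_PiE)
    also have "\<dots> = (\<Prod>i = 0..<s. map (\<lambda>F. order (fst F)) Fs ! i)"
      by (rule prod.cong) (auto simp: Hi s_def)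
    finally show ?thesis by (simp add: prod.list_conv_set_nth s_def)
  qed
  define \<Theta> where "\<Theta> = (\<lambda>(f, w). \<Phi> f \<otimes> \<psi> w)"
  have \<Theta>: "\<Theta> \<in> hom (P \<times>\<times> W) G"
    unfolding \<Theta>_def using \<Phi> W \<psi>
    by (intro DirProd_hom) (auto simp: commuting_sets_def dest: hom_in_carrier)
  have PW: "group (P \<times>\<times> W)" using P W by (intro DirProd_group)
  interpret \<Phi>: group_hom P G \<Phi> using P \<Phi> is_group by (simp add: group_hom_def group_hom_axioms_def)
  interpret \<psi>: group_hom W G \<psi> using W is_group by (simp add: group_hom_def group_hom_axioms_def)
  interpret \<Theta>: group_hom "P \<times>\<times> W" G \<Theta>
    using PW \<Theta> is_group by (simp add: group_hom_def group_hom_axioms_def)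
  have surj: "\<Theta> ` carrier (P \<times>\<times> W) = carrier G"
  proof
    show "\<Theta> ` carrier (P \<times>\<times> W) \<subseteq> carrier G" by (auto dest: \<Theta>.hom_closed)
    have "factor_image F \<subseteq> \<Theta> ` carrier (P \<times>\<times> W)" if "F \<in> set Fs" for F
    proof
      fix y assume y: "y \<in> factor_image F"
      obtain j where j: "j < s" "F = Fs ! j" using \<open>F \<in> set Fs\<close> by (auto simp: in_set_conv_nth s_def)
      then obtain x where x: "x \<in> carrier (H j)" "y = \<phi> j x"
        using y by (auto simp: factor_image_def Hi \<phi>_def)
      define f where "f = (\<lambda>i\<in>{..<s}. if i = j then x else \<one>\<^bsub>H i\<^esub>)"
      have f: "f \<in> carrier P"
        unfolding f_def P_def using x j grp by (auto simp: group.is_monoid monoid.one_closed)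
      have "\<Phi> f = y"
        unfolding f_def \<Phi>_def x(2) by (rule ordered_prod_single) (use grp x j in auto)
      moreover have "y \<in> carrier G" using grp x j by (auto dest: hom_in_carrier)
      ultimately have "\<Theta> (f, \<one>\<^bsub>W\<^esub>) = y" by (simp add: \<Theta>_def)
      then show "y \<in> \<Theta> ` carrier (P \<times>\<times> W)" using f by (intro image_eqI[of _ _ "(f, \<one>\<^bsub>W\<^esub>)"]) auto
    qed
    moreover have "\<psi> ` carrier W \<subseteq> \<Theta> ` carrier (P \<times>\<times> W)"
    proof
      fix y assume "y \<in> \<psi> ` carrier W"
      then obtain w where w: "w \<in> carrier W" "y = \<psi> w" by auto
      then have "\<Theta> (\<one>\<^bsub>P\<^esub>, w) = y" by (simp add: \<Theta>_def)
      then show "y \<in> \<Theta> ` carrier (P \<times>\<times> W)" using w by (intro image_eqI[of _ _ "(\<one>\<^bsub>P\<^esub>, w)"]) auto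
    qed
    ultimately show "carrier G \<subseteq> \<Theta> ` carrier (P \<times>\<times> W)"
      unfolding gen by (intro generate_subgroup_incl \<Theta>.img_is_subgroup) auto
  qed
  have C: "finite C" "2 ^ (s - 1) \<le> card C"
  proof -
    have s: "length Hs = Suc (s - 1)" using Fs(2) by (simp add: len s_def)
    then have "amalg (Hs ! i) = {\<one>\<^bsub>Hs ! i\<^esub>, t i} \<and> t i \<noteq> \<one>\<^bsub>Hs ! i\<^esub>" if "i \<le> s - 1" for i
      using t(2)[of i] t1[of i] that len by (simp add: H_def)
    from card_central_product_kernel_ge[OF s this] show "finite C" "2 ^ (s - 1) \<le> card C"
      by (auto simp: C_def)
  qed
  have C_ker: "f \<in> carrier P \<and> \<Phi> f = \<one>" if "f \<in> C" for f
  proof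
    have f: "f \<in> (\<Pi>\<^sub>E i\<in>{..<s}. amalg (H i))" "even (card {i \<in> {..<s}. f i \<noteq> \<one>\<^bsub>H i\<^esub>})"
      using that by (auto simp: C_def central_product_kernel_def len H_def)
    have fi: "f i = \<one>\<^bsub>H i\<^esub> \<or> f i = t i" if "i < s" for i
      using f(1) that t(2)[OF that] by (auto dest!: PiE_mem)
    have "f i \<in> carrier (H i)" if "i < s" for i
      using fi[OF that] t(1)[OF that] grp(1)[OF that] by (auto simp: group.is_monoid monoid.one_closed)
    then show "f \<in> carrier P" using f(1) by (auto simp: P_def PiE_iff)
    have "\<phi> i (f i) = (if f i = \<one>\<^bsub>H i\<^esub> then \<one> else c)" if "i < s" for i
      using fi[OF that] t(3)[OF that] one[OF that] by auto
    then have "\<Phi> f = (if even (card {i \<in> {..<s}. f i \<noteq> \<one>\<^bsub>H i\<^esub>}) then \<one> else c)"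
      unfolding \<Phi>_def using c by (intro ordered_prod_on_amalg) auto
    then show "\<Phi> f = \<one>" using f(2) by simp
  qed
  have ker\<Theta>: "kernel (P \<times>\<times> W) G \<Theta> = C \<times> {\<one>\<^bsub>W\<^esub>}"
  proof (rule card_seteq[symmetric])
    have fin: "finite (carrier (P \<times>\<times> W))" using finP W by simp
    show "finite (kernel (P \<times>\<times> W) G \<Theta>)" using fin by (simp add: kernel_def)
    show "C \<times> {\<one>\<^bsub>W\<^esub>} \<subseteq> kernel (P \<times>\<times> W) G \<Theta>" using C_ker by (auto simp: kernel_def \<Theta>_def)
    have "order (P \<times>\<times> W) = order G * card (kernel (P \<times>\<times> W) G \<Theta>)"
      using fin surj by (rule \<Theta>.card_eq_image_times_kernel)
    then have "order G * card (kernel (P \<times>\<times> W) G \<Theta>) \<le> order G * 2 ^ (s - 1)"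
      using card ordP by (simp add: order_def s_def card_cartesian_product)
    moreover have "0 < order G" using assms(1) order_gt_0_iff_finite by blast
    ultimately have "card (kernel (P \<times>\<times> W) G \<Theta>) \<le> 2 ^ (s - 1)" by simp
    then show "card (kernel (P \<times>\<times> W) G \<Theta>) \<le> card (C \<times> {\<one>\<^bsub>W\<^esub>})"
      using C(2) by (simp add: card_cartesian_product)
  qed
  \<comment> \<open>As the kernel of a homomorphism \<open>C\<close> is a normal subgroup, so the
    central product is a group and \<open>\<Phi>\<close> descends to it.\<close>
  have ker\<Phi>: "kernel P G \<Phi> = C"
  proof
    show "C \<subseteq> kernel P G \<Phi>" using C_ker by (auto simp: kernel_def)
    show "kernel P G \<Phi> \<subseteq> C"
    proof
      fix f assume "f \<in> kernel P G \<Phi>"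
      then have "(f, \<one>\<^bsub>W\<^esub>) \<in> kernel (P \<times>\<times> W) G \<Theta>" by (auto simp: kernel_def \<Theta>_def)
      then show "f \<in> C" by (simp add: ker\<Theta>)
    qed
  qed
  define M where "M = P Mod C"
  have M: "M = central_product (map fst Fs)"
    by (simp add: M_def P_def C_def central_product_def H_def[abs_def] Hs_def s_def)
  define \<kappa> where "\<kappa> K = the_elem (\<Phi> ` K)" for K
  have \<kappa>: "\<kappa> \<in> hom M G"
    using \<Phi>.FactGroup_hom by (simp add: \<kappa>_def[abs_def] M_def ker\<Phi>)
  have \<kappa>_coset: "\<kappa> (C #>\<^bsub>P\<^esub> f) = \<Phi> f" if "f \<in> carrier P" for f
  proof -
    have "\<Phi> ` (C #>\<^bsub>P\<^esub> f) = {\<Phi> f}"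
    proof -
      have const: "\<Phi> y \<in> {\<Phi> f}" if "y \<in> C #>\<^bsub>P\<^esub> f" for y
      proof -
        obtain g where "g \<in> C" "y = g \<otimes>\<^bsub>P\<^esub> f" using \<open>y \<in> C #>\<^bsub>P\<^esub> f\<close> by (auto simp: r_coset_def)
        then show ?thesis using C_ker[of g] \<open>f \<in> carrier P\<close> by simp
      qed
      moreover have "f \<in> C #>\<^bsub>P\<^esub> f"
        using group.rcos_self[OF P that] \<Phi>.subgroup_kernel ker\<Phi> by simp
      ultimately show ?thesis by (intro equalityI image_subsetI const) blast+
    qed
    then show ?thesis by (simp add: \<kappa>_def)
  qed
  have carM: "carrier M = (\<lambda>f. C #>\<^bsub>P\<^esub> f) ` carrier P" by (simp add: M_def carrier_FactGroup)
  have grpM: "group M" using \<Phi>.normal_kernel by (simp add: M_def ker\<Phi> normal.factorgroup_is_group)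
  have MW: "group (M \<times>\<times> W)" using grpM W by (intro DirProd_group)
  define \<Lambda> where "\<Lambda> = (\<lambda>(K, w). \<kappa> K \<otimes> \<psi> w)"
  have \<Lambda>: "\<Lambda> \<in> hom (M \<times>\<times> W) G"
    unfolding \<Lambda>_def using \<kappa> W \<psi>
    by (intro DirProd_hom) (auto simp: commuting_sets_def dest: hom_in_carrier)
  interpret \<Lambda>: group_hom "M \<times>\<times> W" G \<Lambda>
    using MW \<Lambda> is_group by (simp add: group_hom_def group_hom_axioms_def)
  have \<Lambda>_eq: "\<Lambda> (C #>\<^bsub>P\<^esub> f, w) = \<Theta> (f, w)" if "f \<in> carrier P" for f w
    using \<kappa>_coset[OF that] by (simp add: \<Lambda>_def \<Theta>_def)
  have "kernel (M \<times>\<times> W) G \<Lambda> = {\<one>\<^bsub>M \<times>\<times> W\<^esub>}"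
  proof
    show "{\<one>\<^bsub>M \<times>\<times> W\<^esub>} \<subseteq> kernel (M \<times>\<times> W) G \<Lambda>"
      using \<Lambda>.hom_one MW[THEN group.is_monoid, THEN monoid.one_closed] by (simp add: kernel_def)
    show "kernel (M \<times>\<times> W) G \<Lambda> \<subseteq> {\<one>\<^bsub>M \<times>\<times> W\<^esub>}"
    proof
      fix q assume q: "q \<in> kernel (M \<times>\<times> W) G \<Lambda>"
      then obtain f w where fw: "f \<in> carrier P" "w \<in> carrier W" "q = (C #>\<^bsub>P\<^esub> f, w)"
        by (auto simp: kernel_def carM)
      then have "(f, w) \<in> kernel (P \<times>\<times> W) G \<Theta>" using q \<Lambda>_eq by (simp add: kernel_def)
      then have "f \<in> C" "w = \<one>\<^bsub>W\<^esub>" by (auto simp: ker\<Theta>)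
      moreover have "C #>\<^bsub>P\<^esub> f = C"
        using \<open>f \<in> C\<close> \<Phi>.subgroup_kernel by (simp add: ker\<Phi> P group.coset_join2[OF P fw(1)])
      ultimately show "q \<in> {\<one>\<^bsub>M \<times>\<times> W\<^esub>}" by (simp add: fw M_def)
    qed
  qed
  then have inj: "inj_on \<Lambda> (carrier (M \<times>\<times> W))" by (rule \<Lambda>.trivial_ker_imp_inj)
  have "\<Lambda> ` carrier (M \<times>\<times> W) = carrier G"
  proof
    show "\<Lambda> ` carrier (M \<times>\<times> W) \<subseteq> carrier G" by (auto dest: \<Lambda>.hom_closed)
    show "carrier G \<subseteq> \<Lambda> ` carrier (M \<times>\<times> W)"
    proof
      fix y assume "y \<in> carrier G"
      then have "y \<in> \<Theta> ` carrier (P \<times>\<times> W)" by (simp only: surj)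
      then obtain f w where "f \<in> carrier P" "w \<in> carrier W" "y = \<Theta> (f, w)" by auto
      then show "y \<in> \<Lambda> ` carrier (M \<times>\<times> W)"
        by (intro image_eqI[of _ _ "(C #>\<^bsub>P\<^esub> f, w)"]) (auto simp: \<Lambda>_eq carM)
    qed
  qed
  then have "\<Lambda> \<in> iso (M \<times>\<times> W) G" using \<Lambda> inj by (simp add: iso_def bij_betw_def)
  then have "M \<times>\<times> W \<cong> G" by (rule is_isoI)
  then show ?thesis using group.iso_sym[OF MW] M by simp
qed

end

section \<open>Groups with two generators and a central commutator involution\<close>

context group
begin

lemma nat_pow_fold:
  assumes "x \<in> carrier G" "x [^] (p::nat) = y"
  shows "x [^] (k::nat) = x [^] (k mod p) \<otimes> y [^] (k div p)"
proof -
  have "x [^] k = x [^] (k mod p + p * (k div p))" by simp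
  also have "\<dots> = x [^] (k mod p) \<otimes> (x [^] p) [^] (k div p)"
    using assms(1) by (simp only: nat_pow_pow nat_pow_mult)
  finally show ?thesis by (simp add: assms(2))
qed

lemma nat_pow_mod:
  assumes "x \<in> carrier G" "x [^] (p::nat) = \<one>"
  shows "x [^] (k::nat) = x [^] (k mod p)"
  using nat_pow_fold[OF assms] assms(1) by simp

lemma subgroup_involution: "t \<in> carrier G \<Longrightarrow> t \<otimes> t = \<one> \<Longrightarrow> subgroup {\<one>, t} G"
  by (auto intro!: subgroupI simp: inv_equality)

lemma generate_commute:
  assumes A: "A \<subseteq> carrier G" and x: "x \<in> carrier G" and comm: "\<And>a. a \<in> A \<Longrightarrow> a \<otimes> x = x \<otimes> a"
    and g: "g \<in> generate G A"
  shows "g \<otimes> x = x \<otimes> g"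
  using g
proof (induction rule: generate.induct)
  case one
  then show ?case using x by simp
next
  case (incl h)
  then show ?case by (rule comm)
next
  case (inv h)
  then have h: "h \<in> carrier G" "h \<otimes> x = x \<otimes> h" using A comm by auto
  have "inv h \<otimes> x = inv h \<otimes> (x \<otimes> h) \<otimes> inv h" using h x by (simp add: m_assoc)
  also have "\<dots> = x \<otimes> inv h" using h x by (simp add: h(2)[symmetric] m_assoc[symmetric])
  finally show ?case .
next
  case (eng g h)
  then show ?case using x A generate_in_carrier by (blast intro: commute_prod)
qed

end

text \<open>
  All the noncyclic factors are generated by two elements whose commutator is a central
  involution.
\<close>

locale two_generated_class2 = group G for G (structure) +
  fixes a b t and p q l e v :: nat
  assumes gen: "carrier G = generate G {a, b, t}"
    and a: "a \<in> carrier G" and b: "b \<in> carrier G" and t: "t \<in> carrier G"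
    and ab: "a \<otimes> b = b \<otimes> a \<otimes> t" and ta: "t \<otimes> a = a \<otimes> t" and tb: "t \<otimes> b = b \<otimes> t"
    and tt: "t \<otimes> t = \<one>" and pos: "0 < p" "0 < q" "0 < e"
    and ap: "a [^] p = \<one>" and bq: "b [^] q = a [^] l" and te: "t [^] e = a [^] v"
begin

lemma class2_central: "g \<in> carrier G \<Longrightarrow> g \<otimes> t = t \<otimes> g"
  by (rule generate_commute[of "{a, b, t}"]) (use a b t ta tb gen in auto)

lemma class2_central_sub: "s \<in> {\<one>, t} \<Longrightarrow> s \<in> carrier G \<and> s \<otimes> s = \<one>"
  using t tt by auto

lemma t_pow_commute: "g \<in> carrier G \<Longrightarrow> t [^] (k::nat) \<otimes> g = g \<otimes> t [^] k"
  using class2_central[of g] t by (intro group_commutes_pow) simp_all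

lemma t_pow: "t [^] (k::nat) = t [^] (k mod 2)"
  using t tt by (intro nat_pow_mod) (simp_all add: numeral_2_eq_2)

text \<open>Bilinearity of the commutator: every exchange of one \<open>a\<close> with one
  \<open>b\<close> costs one central \<open>t\<close>.\<close>

lemma a_pow_b_pow: "a [^] (i::nat) \<otimes> b [^] (j::nat) = b [^] j \<otimes> a [^] i \<otimes> t [^] (i * j)"
proof -
  have a_b_pow: "a \<otimes> b [^] j = b [^] j \<otimes> a \<otimes> t [^] j" for j :: nat
  proof (induction j)
    case (Suc j)
    have "a \<otimes> b [^] Suc j = b [^] j \<otimes> a \<otimes> (t [^] j \<otimes> b)"
      using Suc a b t by (simp add: m_assoc[symmetric])
    also have "\<dots> = b [^] j \<otimes> (a \<otimes> b) \<otimes> t [^] j" using a b t by (simp add: t_pow_commute m_assoc)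
    also have "\<dots> = b [^] Suc j \<otimes> a \<otimes> t [^] Suc j"
      using a b t by (subst (2) nat_pow_Suc2) (simp_all add: ab m_assoc)
    finally show ?case .
  qed (use a in simp)
  show ?thesis
  proof (induction i)
    case (Suc i)
    have "a [^] Suc i \<otimes> b [^] j = a [^] i \<otimes> b [^] j \<otimes> a \<otimes> t [^] j"
      using a b t by (simp add: a_b_pow m_assoc)
    also have "\<dots> = b [^] j \<otimes> a [^] i \<otimes> (t [^] (i * j) \<otimes> a) \<otimes> t [^] j"
      using a b t by (simp add: Suc m_assoc)
    also have "\<dots> = b [^] j \<otimes> a [^] Suc i \<otimes> (t [^] (i * j) \<otimes> t [^] j)"
      using a b t by (simp add: t_pow_commute[OF a] m_assoc)
    finally show ?case using t by (simp add: nat_pow_mult add.commute)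
  qed (use b in simp)
qed

definition nform :: "nat \<Rightarrow> nat \<Rightarrow> nat \<Rightarrow> 'a"
  where "nform j i k = b [^] j \<otimes> a [^] i \<otimes> t [^] k"

text \<open>The multiplication of a Heisenberg group; the cocycle \<open>i * j'\<close> comes from
  moving the \<open>i\<close>-th power of \<open>a\<close> past the \<open>j'\<close>-th power of
  \<open>b\<close>.\<close>

lemma nform_mult: "nform j i k \<otimes> nform j' i' k' = nform (j + j') (i + i') (k + k' + i * j')"
proof -
  have "nform j i k \<otimes> nform j' i' k' =
      b [^] j \<otimes> a [^] i \<otimes> (t [^] k \<otimes> (b [^] j' \<otimes> a [^] i')) \<otimes> t [^] k'"
    using a b t by (simp add: nform_def m_assoc)
  also have "\<dots> = b [^] j \<otimes> (a [^] i \<otimes> b [^] j') \<otimes> a [^] i' \<otimes> (t [^] k \<otimes> t [^] k')"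
    using a b t by (simp add: t_pow_commute[of "b [^] j' \<otimes> a [^] i'"] m_assoc)
  also have "\<dots> = b [^] j \<otimes> b [^] j' \<otimes> a [^] i \<otimes> (t [^] (i * j') \<otimes> a [^] i') \<otimes> (t [^] k \<otimes> t [^] k')"
    using a b t by (simp add: a_pow_b_pow m_assoc)
  also have "t [^] (i * j') \<otimes> a [^] i' = a [^] i' \<otimes> t [^] (i * j')" using a by (simp add: t_pow_commute)
  also have "b [^] j \<otimes> b [^] j' \<otimes> a [^] i \<otimes> (a [^] i' \<otimes> t [^] (i * j')) \<otimes> (t [^] k \<otimes> t [^] k') =
      (b [^] j \<otimes> b [^] j') \<otimes> (a [^] i \<otimes> a [^] i') \<otimes> (t [^] (i * j') \<otimes> (t [^] k \<otimes> t [^] k'))"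
    using a b t by (simp add: m_assoc)
  finally show ?thesis using a b t by (simp add: nform_def nat_pow_mult add.commute)
qed

lemma class2_normal_form: "g \<in> carrier G \<Longrightarrow> \<exists>j i k. g = nform j i k"
  unfolding gen
proof (induction rule: generate.induct)
  case one
  have "\<one> = nform 0 0 0" by (simp add: nform_def)
  then show ?case by blast
next
  case (incl h)
  moreover have "a = nform 0 1 0" "b = nform 1 0 0" "t = nform 0 0 1" using a b t by (simp_all add: nform_def)
  ultimately show ?case by blast
next
  case (inv h)
  have inv_pow: "inv y = y [^] (k - 1)" if "y \<in> carrier G" "y [^] k = \<one>" "0 < k" for y and k :: nat
    using that nat_pow_Suc[of y "k - 1"] by (intro inv_equality) simp_all
  \<comment> \<open>The \<open>q\<close>-th power of \<open>b\<close> is a power of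
    \<open>a\<close>, hence killed by \<open>p\<close>. This gives \<open>inv b\<close> a natural
    exponent.\<close>
  have "b [^] (q * p) = \<one>" using a b ap bq by (metis mult.commute nat_pow_one nat_pow_pow)
  then have "inv a = nform 0 (p - 1) 0" "inv b = nform (q * p - 1) 0 0" "inv t = nform 0 0 1"
    using inv_pow[OF a ap] inv_pow[OF b, of "q * p"] inv_equality[OF tt t t] a b t pos
    by (simp_all add: nform_def)
  then show ?case using inv by blast
next
  case (eng g h)
  then show ?case using nform_mult by metis
qed

lemma class2_commute:
  assumes g: "g \<in> carrier G" and h: "h \<in> carrier G"
  shows "\<exists>s\<in>{\<one>, t}. g \<otimes> h = h \<otimes> g \<otimes> s"
proof -
  obtain j i k j' i' k' where gh: "g = nform j i k" "h = nform j' i' k'"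
    using class2_normal_form g h by metis
  define m where "m = k + k' + i * j'"
  define m' where "m' = k' + k + i' * j"
  have "h \<otimes> g \<otimes> t [^] (m' + m) = nform (j' + j) (i' + i) (m' + (m' + m))"
    unfolding gh nform_mult m'_def[symmetric] using a b t by (simp add: nform_def m_assoc nat_pow_mult)
  \<comment> \<open>Since \<open>t\<close> is an involution, adding \<open>m'\<close> replaces
    subtracting it: the factor between the two products has exponent \<open>m' + m\<close> instead
    of \<open>m - m'\<close>.\<close>
  also have "(m' + (m' + m)) mod 2 = m mod 2" by presburger
  then have "t [^] (m' + (m' + m)) = t [^] m" using t_pow[of "m' + (m' + m)"] t_pow[of m] by simp
  then have "nform (j' + j) (i' + i) (m' + (m' + m)) = nform (j + j') (i + i') m"
    by (simp add: nform_def add.commute)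
  also have "\<dots> = g \<otimes> h" by (simp only: gh nform_mult m_def)
  finally have "g \<otimes> h = h \<otimes> g \<otimes> t [^] (m' + m)" by simp
  moreover have "t [^] (m' + m) \<in> {\<one>, t}"
  proof -
    have "(m' + m) mod 2 = 0 \<or> (m' + m) mod 2 = 1" by auto
    then show ?thesis using t_pow[of "m' + m"] t by (elim disjE) simp_all
  qed
  ultimately show ?thesis by blast
qed

lemma class2_derived: "derived G (carrier G) = {\<one>, t}"
proof
  note sub = subgroup_involution[OF t tt]
  have "g \<otimes> h \<otimes> inv g \<otimes> inv h \<in> {\<one>, t}" if "g \<in> carrier G" "h \<in> carrier G" for g h
  proof -
    obtain s where s: "s \<in> {\<one>, t}" "g \<otimes> h = h \<otimes> g \<otimes> s" using class2_commute \<open>g \<in> carrier G\<close> \<open>h \<in> carrier G\<close> by blast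
    have "s \<otimes> (h \<otimes> g) = h \<otimes> g \<otimes> s" using s(1) class2_central[of "h \<otimes> g"] that by auto
    then have "s = g \<otimes> h \<otimes> inv (h \<otimes> g)"
      using class2_central_sub[OF s(1)] that by (subst inv_solve_right) (simp_all add: s(2))
    also have "\<dots> = g \<otimes> h \<otimes> inv g \<otimes> inv h" using that by (simp add: m_assoc inv_mult_group)
    finally show ?thesis using s(1) by simp
  qed
  then show "derived G (carrier G) \<subseteq> {\<one>, t}"
    unfolding derived_def using sub by (intro generate_subgroup_incl) auto
  have "t = a \<otimes> b \<otimes> inv a \<otimes> inv b"
  proof -
    have "t \<otimes> (b \<otimes> a) = a \<otimes> b" using class2_central[of "b \<otimes> a"] a b by (simp add: ab)
    then have "t = a \<otimes> b \<otimes> inv (b \<otimes> a)" using a b t by (simp add: inv_solve_right)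
    then show ?thesis using a b by (simp add: m_assoc inv_mult_group)
  qed
  then have "t \<in> derived_set G (carrier G)" using a b by blast
  then show "{\<one>, t} \<subseteq> derived G (carrier G)"
    unfolding derived_def by (auto intro: generate.one generate.incl)
qed

text \<open>The condition on \<open>t\<close> puts \<open>G\<close> into the nonabelian branch of
  \<open>amalg\<close>. For a presented factor it is verified in the target of the factor map, where
  \<open>t\<close> becomes \<open>c\<close>.\<close>

lemma class2_amalg:
  assumes "t \<noteq> \<one>"
  shows "amalg G = {\<one>, t}"
proof -
  have "\<not> comm_group G"
  proof
    assume "comm_group G"
    then have "a \<otimes> b = b \<otimes> a" using a b by (rule comm_groupE(4))
    then have "b \<otimes> a \<otimes> t = b \<otimes> a \<otimes> \<one>" unfolding ab using a b by simp
    then have "t = \<one>" using a b t by (simp only: l_cancel m_closed one_closed)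
    then show False using assms by contradiction
  qed
  then show ?thesis by (simp add: amalg_def class2_derived)
qed

text \<open>The exponents in the normal form can be reduced below \<open>q\<close>, \<open>p\<close>
  and \<open>e\<close>. The pair \<open>e\<close>, \<open>v\<close> covers two situations:
  \<open>e = 1\<close> if \<open>t\<close> is a power of \<open>a\<close>, and \<open>e = 2\<close>,
  \<open>v = 0\<close> if \<open>t\<close> is a further generator.\<close>

lemma class2_order:
  shows "finite (carrier G)" "order G \<le> q * p * e"
proof -
  let ?f = "\<lambda>(j, i, k). b [^] (j::nat) \<otimes> a [^] (i::nat) \<otimes> t [^] (k::nat)"
  let ?D = "{..<q} \<times> {..<p} \<times> {..<e}"
  have "carrier G \<subseteq> ?f ` ?D"
  proof
    fix g assume "g \<in> carrier G"
    then obtain j i k :: nat where g: "g = b [^] j \<otimes> a [^] i \<otimes> t [^] k"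
      using class2_normal_form unfolding nform_def by blast
    \<comment> \<open>Multiples of \<open>q\<close> in the exponent of \<open>b\<close> and of
      \<open>e\<close> in that of \<open>t\<close> turn into powers of \<open>a\<close>;
      \<open>i'\<close> collects them before it is reduced modulo \<open>p\<close>.\<close>
    define i' where "i' = l * (j div q) + i + v * (k div e)"
    have "g = b [^] (j mod q) \<otimes> a [^] (l * (j div q)) \<otimes> a [^] i \<otimes> (t [^] (k mod e) \<otimes> a [^] (v * (k div e)))"
      using nat_pow_fold[OF b bq, of j] nat_pow_fold[OF t te, of k] a
      by (simp add: g nat_pow_pow)
    also have "\<dots> = b [^] (j mod q) \<otimes> a [^] i' \<otimes> t [^] (k mod e)"
      using a b t by (simp add: t_pow_commute i'_def m_assoc nat_pow_mult[symmetric])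
    also have "a [^] i' = a [^] (i' mod p)" using nat_pow_mod[OF a ap] .
    finally have "g = ?f (j mod q, i' mod p, k mod e)" by simp
    then show "g \<in> ?f ` ?D" using pos
      by (intro image_eqI[of _ _ "(j mod q, i' mod p, k mod e)"]) auto
  qed
  then have sub: "carrier G \<subseteq> ?f ` ?D" .
  have fin: "finite ?D" by simp
  show "finite (carrier G)" by (rule finite_subset[OF sub]) (rule finite_imageI[OF fin])
  have "order G \<le> card ?D" unfolding order_def by (rule surj_card_le[OF fin sub])
  then show "order G \<le> q * p * e" by (simp add: card_cartesian_product)
qed

end

section \<open>The factors\<close>

lemma (in group) nat_pow_1_plus: "a \<in> carrier G \<Longrightarrow> a [^] (1 + k :: nat) = a \<otimes> a [^] k"
  using nat_pow_mult[of a 1 k] by simp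

lemma (in group) nat_pow_conj_mult:
  assumes "a \<in> carrier G" "b \<in> carrier G" "a \<otimes> b = b \<otimes> a [^] (e::nat)"
  shows "a [^] (k::nat) \<otimes> b = b \<otimes> a [^] (e * k)"
proof (induction k)
  case (Suc k)
  have "a [^] Suc k \<otimes> b = a [^] k \<otimes> b \<otimes> a [^] e" using assms by (simp add: m_assoc)
  also have "\<dots> = b \<otimes> a [^] (e * Suc k)"
    using assms by (simp add: Suc m_assoc nat_pow_mult add.commute)
  finally show ?case .
qed (use assms in simp)

text \<open>Conjugation by \<open>b\<close> raises the involution \<open>t\<close> to the power 1 +
  2^(u-1), which is odd for u >= 2, so \<open>t\<close> is fixed; it is the commutator of
  \<open>a\<close> and \<open>b\<close> by the conjugation relation.\<close>

lemma (in group) metacyclic_class2: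
  assumes u: "2 \<le> u" and a: "a \<in> carrier G" and b: "b \<in> carrier G"
    and au: "a [^] (2 ^ u :: nat) = \<one>"
    and conj: "inv b \<otimes> (a \<otimes> b) = a [^] (1 + 2 ^ (u - 1) :: nat)"
  defines "t \<equiv> a [^] (2 ^ (u - 1) :: nat)"
  shows "a \<otimes> b = b \<otimes> a \<otimes> t" "t \<otimes> a = a \<otimes> t" "t \<otimes> b = b \<otimes> t" "t \<otimes> t = \<one>"
proof -
  have ab: "a \<otimes> b = b \<otimes> a [^] (1 + 2 ^ (u - 1) :: nat)"
    using conj a b by (simp add: inv_solve_left' del: nat_pow_Suc)
  then show "a \<otimes> b = b \<otimes> a \<otimes> t"
    using a b by (simp only: t_def nat_pow_1_plus m_assoc nat_pow_closed)
  show "t \<otimes> a = a \<otimes> t" using a by (simp add: t_def group_commutes_pow)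
  have uu: "(2::nat) ^ (u - 1) + 2 ^ (u - 1) = 2 ^ u" using u by (cases u) auto
  then show "t \<otimes> t = \<one>" using a au by (simp add: t_def nat_pow_mult)
  \<comment> \<open>The square of 2^(u-1) is 2^u times 2^(u-2); this is where u >= 2 enters.\<close>
  define d :: nat where "d = 2 ^ (u - 2)"
  have "(2::nat) ^ (u - 1) * 2 ^ (u - 1) = 2 ^ u * d"
    using u by (simp add: d_def flip: power_add)
  then have "a [^] ((2::nat) ^ (u - 1) * 2 ^ (u - 1)) = \<one>"
    using a au by (metis nat_pow_one nat_pow_pow)
  then have "a [^] ((1 + 2 ^ (u - 1)) * 2 ^ (u - 1) :: nat) = t"
    using a by (simp add: distrib_right t_def flip: nat_pow_mult)
  then show "t \<otimes> b = b \<otimes> t"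
    using nat_pow_conj_mult[OF a b ab, of "2 ^ (u - 1)"] by (simp add: t_def)
qed

lemma (in group) class2_central_factor:
  assumes H: "two_generated_class2 H a b t p q l e s"
    and h: "h \<in> hom H G" "h t = c" "c \<noteq> \<one>"
  shows "factor_spanned G c (H, h) {h a, h b, c}"
proof
  interpret H: two_generated_class2 H a b t p q l e s by (rule H)
  interpret h: group_hom H G h using h(1) by unfold_locales
  have "t \<noteq> \<one>\<^bsub>H\<^esub>" using h by auto
  then show "central_factor G c (H, h)"
    using H.class2_amalg H.class2_order(1) H.t H.is_group h by (auto simp: central_factor_def)
  have "h ` generate H {a, b, t} = generate G (h ` {a, b, t})"
    using H.a H.b H.t by (intro h.generate_img[symmetric]) auto
  then show "factor_image (H, h) = generate G {h a, h b, c}"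
    using H.gen h(2) by (simp add: factor_image_def)
qed

context
  fixes S :: "gen set" and R :: "(gen word \<times> gen word) set"
begin

lemma presented_pow_relation:
  assumes "(word_pow [(x, True)] k, word_pow [(y, True)] l) \<in> R" "x \<in> S" "y \<in> S"
  shows "gen_class S R x [^]\<^bsub>presented S R\<^esub> k = gen_class S R y [^]\<^bsub>presented S R\<^esub> l"
proof -
  interpret group "presented S R" by (rule group_presented)
  show ?thesis
    using presented_relation[OF assms(1), of S] assms(2,3)
    by (simp add: words_pow word_eval_pow[OF gen_class_funcset] word_eval_letter[OF gen_class_funcset])
qed

lemma presented_pow_one_relation:
  assumes "(word_pow [(x, True)] k, []) \<in> R" "x \<in> S"
  shows "gen_class S R x [^]\<^bsub>presented S R\<^esub> k = \<one>\<^bsub>presented S R\<^esub>"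
  using presented_pow_relation[of x k x 0] assms by (simp add: word_pow_def)

lemma presented_conj_relation:
  assumes "(word_conj [(x, True)] [(y, True)], w) \<in> R" "x \<in> S" "y \<in> S" "w \<in> words S"
  shows "inv\<^bsub>presented S R\<^esub> gen_class S R y \<otimes>\<^bsub>presented S R\<^esub>
      (gen_class S R x \<otimes>\<^bsub>presented S R\<^esub> gen_class S R y) =
    word_eval (presented S R) (gen_class S R) w"
proof -
  interpret group "presented S R" by (rule group_presented)
  have "word_conj [(x, True)] [(y, True)] \<in> words S" using assms by (simp add: word_conj_def)
  then show ?thesis
    using presented_relation[OF assms(1), of S] assms(2-)
    by (simp add: word_eval_conj[OF gen_class_funcset] word_eval_letter[OF gen_class_funcset])
qed

lemma presented_comm_relation:
  assumes "(word_comm [(x, True)] [(y, True)], w) \<in> R" "x \<in> S" "y \<in> S" "w \<in> words S"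
  shows "inv\<^bsub>presented S R\<^esub> gen_class S R x \<otimes>\<^bsub>presented S R\<^esub>
      (inv\<^bsub>presented S R\<^esub> gen_class S R y \<otimes>\<^bsub>presented S R\<^esub>
      (gen_class S R x \<otimes>\<^bsub>presented S R\<^esub> gen_class S R y)) =
    word_eval (presented S R) (gen_class S R) w"
proof -
  interpret group "presented S R" by (rule group_presented)
  have "word_comm [(x, True)] [(y, True)] \<in> words S" using assms by (simp add: word_comm_def)
  then show ?thesis
    using presented_relation[OF assms(1), of S] assms(2-)
    by (simp add: word_eval_comm[OF gen_class_funcset] word_eval_letter[OF gen_class_funcset])
qed

end

text \<open>For u = 2 the exponent 1 + 2^(u-1) is 3, and the third power of an element of order
  dividing 4 is its inverse. Thus the relation of the dihedral and quaternion groups is an instance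
  of the one for M_2(u,v).\<close>

lemma (in group) word_eval_metacyclic:
  assumes f: "f \<in> {Ga, Gb} \<rightarrow> carrier G" and fa: "f Ga [^] (2 ^ u :: nat) = \<one>"
    and w: "w = word_pow wa (1 + 2 ^ (u - 1)) \<or> u = 2 \<and> w = word_inv wa"
  shows "w \<in> words {Ga, Gb}" "word_eval G f w = f Ga [^] (1 + 2 ^ (u - 1) :: nat)"
proof -
  show "w \<in> words {Ga, Gb}" using w by (auto simp: words_pow)
  have a: "f Ga \<in> carrier G" using f by auto
  from w show "word_eval G f w = f Ga [^] (1 + 2 ^ (u - 1) :: nat)"
  proof
    assume "w = word_pow wa (1 + 2 ^ (u - 1))"
    then show ?thesis by (simp only: word_eval_pow[OF f] word_eval_letter[OF f] words_Cons words_Nil insertI1 simp_thms)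
  next
    assume *: "u = 2 \<and> w = word_inv wa"
    have "f Ga [^] (3::nat) \<otimes> f Ga = \<one>" using fa * a nat_pow_mult[of "f Ga" 3 1] by simp
    then have "inv (f Ga) = f Ga [^] (3::nat)" using a by (simp add: inv_equality)
    then have "word_eval G f w = f Ga [^] (3::nat)"
      using * by (simp add: word_eval_inv[OF f] word_eval_letter[OF f])
    moreover have "1 + 2 ^ (u - 1) = (3::nat)" using * by simp
    ultimately show ?thesis by (simp only:)
  qed
qed

section \<open>A common presentation for D_8, Q_8 and M_2(u,v)\<close>

context
  fixes u q l :: nat and w :: "gen word" and S R and H :: "gen word set monoid" and a b
  assumes u: "2 \<le> u" and q: "0 < q"
    and w: "w = word_pow wa (1 + 2 ^ (u - 1)) \<or> u = 2 \<and> w = word_inv wa"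
  defines "S \<equiv> {Ga, Gb}"
    and "R \<equiv> {(word_pow wa (2 ^ u), []), (word_pow wb q, word_pow wa l), (word_conj wa wb, w)}"
    and "H \<equiv> presented S R" and "a \<equiv> gen_class S R Ga" and "b \<equiv> gen_class S R Gb"
begin

text \<open>D_8 and Q_8 are u = q = 2 with l = 0 and l = 2, and M_2(u,v) is q = 2^v with l = 0. The
  commutator is the power of \<open>a\<close> with exponent 2^(u-1), hence
  \<open>e = 1\<close>.\<close>

lemma metacyclic_presented:
  defines "t \<equiv> a [^]\<^bsub>H\<^esub> (2 ^ (u - 1) :: nat)"
  shows "two_generated_class2 H a b t (2 ^ u) q l 1 (2 ^ (u - 1))"
proof -
  interpret H: group H unfolding H_def by (rule group_presented)
  have a: "a \<in> carrier H" and b: "b \<in> carrier H"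
    unfolding H_def a_def b_def by (auto intro!: word_class_closed simp: S_def)
  have t: "t \<in> carrier H" using a by (simp add: t_def)
  have au: "a [^]\<^bsub>H\<^esub> (2 ^ u :: nat) = \<one>\<^bsub>H\<^esub>"
    unfolding a_def H_def by (rule presented_pow_one_relation) (simp_all add: R_def S_def)
  have bq: "b [^]\<^bsub>H\<^esub> q = a [^]\<^bsub>H\<^esub> l"
    unfolding a_def b_def H_def by (rule presented_pow_relation) (simp_all add: R_def S_def)
  have f: "gen_class S R \<in> {Ga, Gb} \<rightarrow> carrier H"
    using gen_class_funcset[of S R] by (simp add: S_def H_def)
  note w_eval = H.word_eval_metacyclic[OF f au[unfolded a_def] w]
  have "inv\<^bsub>H\<^esub> b \<otimes>\<^bsub>H\<^esub> (a \<otimes>\<^bsub>H\<^esub> b) = word_eval H (gen_class S R) w"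
    unfolding a_def b_def H_def
    by (rule presented_conj_relation) (use w_eval(1) in \<open>simp_all add: R_def S_def\<close>)
  then have "inv\<^bsub>H\<^esub> b \<otimes>\<^bsub>H\<^esub> (a \<otimes>\<^bsub>H\<^esub> b) = a [^]\<^bsub>H\<^esub> (1 + 2 ^ (u - 1) :: nat)"
    using w_eval(2) by (simp add: a_def del: nat_pow_Suc)
  note rels = H.metacyclic_class2[OF u a b au this, folded t_def]
  have t1: "t [^]\<^bsub>H\<^esub> (1::nat) = a [^]\<^bsub>H\<^esub> (2 ^ (u - 1) :: nat)" using t by (simp add: t_def)
  have "carrier H = generate H {a, b}"
    using presented_generate[of S R] by (simp add: H_def a_def b_def S_def)
  then have "carrier H \<subseteq> generate H {a, b, t}" using H.mono_generate[of "{a, b}" "{a, b, t}"] by auto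
  moreover have "generate H {a, b, t} \<subseteq> carrier H" using a b t by (intro H.generate_incl) auto
  ultimately have "carrier H = generate H {a, b, t}" by (rule equalityI)
  then show ?thesis
    by (intro two_generated_class2.intro two_generated_class2_axioms.intro H.is_group a b t rels q au bq t1)
      simp_all
qed

lemma metacyclic_presented_order: "order H \<le> q * 2 ^ u"
  using two_generated_class2.class2_order(2)[OF metacyclic_presented] by simp

text \<open>Because the commutator \<open>c\<close> of \<open>x\<close> and \<open>y\<close> is also
  the power of \<open>x\<close> with exponent 2^(u-1), the equation \<open>xy\<close> sends the
  conjugation relation of the presentation to a valid equation in \<open>G\<close>.\<close>

lemma metacyclic_presented_factor:
  fixes G :: "('z, 'y) monoid_scheme" (structure)
  assumes "group G"
    and xyc: "x \<in> carrier G" "y \<in> carrier G" "c \<in> carrier G"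
    and xy: "x \<otimes> y = y \<otimes> x \<otimes> c"
    and xu: "x [^] (2 ^ u :: nat) = \<one>" and yq: "y [^] q = x [^] l"
    and xc: "x [^] (2 ^ (u - 1) :: nat) = c" and c: "c \<noteq> \<one>"
  shows "\<exists>h. factor_spanned G c (H, h) {x, y, c}"
proof -
  interpret group G by fact
  define f where "f = (\<lambda>g. if g = Ga then x else y)"
  have fab: "f Ga = x" "f Gb = y" by (simp_all add: f_def)
  have f: "f \<in> {Ga, Gb} \<rightarrow> carrier G" using xyc by (auto simp: f_def)
  note w_eval = word_eval_metacyclic[OF f _ w, unfolded fab, OF xu]
  have "inv y \<otimes> (x \<otimes> y) = x \<otimes> c" using xyc by (simp add: xy m_assoc[symmetric])
  also have "\<dots> = x [^] (1 + 2 ^ (u - 1) :: nat)"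
    using xyc(1) by (simp only: xc[symmetric] nat_pow_1_plus)
  finally have conj: "inv y \<otimes> (x \<otimes> y) = word_eval G f w" using w_eval(2) by simp
  have R: "word_eval G f s = word_eval G f t" if "(s, t) \<in> R" for s t
    using that xu yq conj unfolding R_def
    by (elim insertE emptyE)
      (simp_all add: words_pow word_eval_pow[OF f] word_eval_letter[OF f] word_eval_conj[OF f] fab)
  obtain h where h: "h \<in> hom H G" "\<And>g. g \<in> S \<Longrightarrow> h (gen_class S R g) = f g"
    using presented_lift[of f S R] f R unfolding S_def H_def by blast
  have hab: "h a = x" "h b = y" using h(2) by (simp_all add: a_def b_def S_def fab)
  interpret H: two_generated_class2 H a b "a [^]\<^bsub>H\<^esub> (2 ^ (u - 1) :: nat)" "2 ^ u" q l 1 "2 ^ (u - 1)"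
    by (rule metacyclic_presented)
  interpret h: group_hom H G h using h(1) by unfold_locales
  have "h (a [^]\<^bsub>H\<^esub> (2 ^ (u - 1) :: nat)) = c" using h.hom_nat_pow[OF H.a] xc hab(1) by simp
  from class2_central_factor[OF metacyclic_presented h(1) this c] show ?thesis using hab by auto
qed

end

lemma word_pow_0: "word_pow w 0 = []"
  by (simp add: word_pow_def)

lemma D8_eq: "D8 = presented {Ga, Gb}
    {(word_pow wa (2 ^ 2), []), (word_pow wb 2, word_pow wa 0), (word_conj wa wb, word_inv wa)}"
  by (simp add: D8_def word_pow_0)

lemma Q8_eq: "Q8 = presented {Ga, Gb}
    {(word_pow wa (2 ^ 2), []), (word_pow wb 2, word_pow wa 2), (word_conj wa wb, word_inv wa)}"
  by (simp add: Q8_def)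

lemma M2_eq: "M2 u v = presented {Ga, Gb}
    {(word_pow wa (2 ^ u), []), (word_pow wb (2 ^ v), word_pow wa 0),
     (word_conj wa wb, word_pow wa (1 + 2 ^ (u - 1)))}"
  by (simp add: M2_def word_pow_0)

lemma order_D8: "order D8 \<le> 8"
  unfolding D8_eq using metacyclic_presented_order[of 2 2 "word_inv wa" 0] by simp

lemma order_Q8: "order Q8 \<le> 8"
  unfolding Q8_eq using metacyclic_presented_order[of 2 2 "word_inv wa" 2] by simp

lemma order_M2: "2 \<le> u \<Longrightarrow> order (M2 u v) \<le> 2 ^ (u + v)"
  using metacyclic_presented_order[of u "2 ^ v" "word_pow wa (1 + 2 ^ (u - 1))" 0]
  by (simp add: M2_eq power_add mult.commute)

context group
begin

lemma D8_factor:
  assumes "x \<in> carrier G" "y \<in> carrier G" "c \<in> carrier G" "x \<otimes> y = y \<otimes> x \<otimes> c"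
    and "x [^] (2::nat) = c" "y [^] (2::nat) = \<one>" "c [^] (2::nat) = \<one>" "c \<noteq> \<one>"
  shows "\<exists>h. factor_spanned G c (D8, h) {x, y, c}"
proof -
  have "x [^] (2 ^ 2 :: nat) = \<one>" using assms nat_pow_pow[of x 2 2] by simp
  then show ?thesis
    unfolding D8_eq using assms by (intro metacyclic_presented_factor is_group) auto
qed

lemma Q8_factor:
  assumes "x \<in> carrier G" "y \<in> carrier G" "c \<in> carrier G" "x \<otimes> y = y \<otimes> x \<otimes> c"
    and "x [^] (2::nat) = c" "y [^] (2::nat) = c" "c [^] (2::nat) = \<one>" "c \<noteq> \<one>"
  shows "\<exists>h. factor_spanned G c (Q8, h) {x, y, c}"
proof -
  have "x [^] (2 ^ 2 :: nat) = \<one>" using assms nat_pow_pow[of x 2 2] by simp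
  then show ?thesis
    unfolding Q8_eq using assms by (intro metacyclic_presented_factor is_group) auto
qed

lemma M2_factor:
  assumes "2 \<le> u" "x \<in> carrier G" "y \<in> carrier G" "c \<in> carrier G" "x \<otimes> y = y \<otimes> x \<otimes> c"
    and "x [^] (2 ^ (u - 1) :: nat) = c" "y [^] (2 ^ v :: nat) = \<one>" "c [^] (2::nat) = \<one>" "c \<noteq> \<one>"
  shows "\<exists>h. factor_spanned G c (M2 u v, h) {x, y, c}"
proof -
  have "(2::nat) ^ (u - 1) * 2 = 2 ^ u" using assms(1) by (cases u) auto
  then have "x [^] (2 ^ u :: nat) = \<one>" using assms nat_pow_pow[of x "2 ^ (u - 1)" 2] by simp
  then show ?thesis
    unfolding M2_eq using assms by (intro metacyclic_presented_factor is_group) auto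
qed

end

section \<open>The factor M_2(w,1,1)\<close>

context
  fixes w :: nat and S R and H :: "gen word set monoid" and a b d
  defines "S \<equiv> {Ga, Gb, Gd}"
    and "R \<equiv> {(word_pow wa (2 ^ w), []), (word_pow wb 2, []), (word_pow wd 2, []),
     (word_comm wa wb, wd), (word_comm wd wa, []), (word_comm wd wb, [])}"
    and "H \<equiv> M2_1_1 w" and "a \<equiv> gen_class S R Ga" and "b \<equiv> gen_class S R Gb"
    and "d \<equiv> gen_class S R Gd"
begin

text \<open>In contrast to the metacyclic factors the commutator \<open>d\<close> is an independent
  generator of order dividing 2, hence \<open>e = 2\<close> and \<open>v = 0\<close>.\<close>

lemma M2_1_1_presented:  "two_generated_class2 H a b d (2 ^ w) 2 0 2 0"
proof -
  have H: "H = presented S R" by (simp add: H_def M2_1_1_def S_def R_def)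
  interpret H: group H unfolding H by (rule group_presented)
  have a: "a \<in> carrier H" and b: "b \<in> carrier H" and d: "d \<in> carrier H"
    unfolding H a_def b_def d_def by (auto intro!: word_class_closed simp: S_def)
  have aw: "a [^]\<^bsub>H\<^esub> (2 ^ w :: nat) = \<one>\<^bsub>H\<^esub>"
    unfolding a_def H by (rule presented_pow_one_relation) (simp_all add: R_def S_def)
  have "b [^]\<^bsub>H\<^esub> (2::nat) = \<one>\<^bsub>H\<^esub>" and d2: "d [^]\<^bsub>H\<^esub> (2::nat) = \<one>\<^bsub>H\<^esub>"
    unfolding b_def d_def H by (rule presented_pow_one_relation; simp add: R_def S_def)+
  then have pows: "b [^]\<^bsub>H\<^esub> (2::nat) = a [^]\<^bsub>H\<^esub> (0::nat)" "d [^]\<^bsub>H\<^esub> (2::nat) = a [^]\<^bsub>H\<^esub> (0::nat)" by simp_all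
  have dd: "d \<otimes>\<^bsub>H\<^esub> d = \<one>\<^bsub>H\<^esub>" using d2 d by (simp add: numeral_2_eq_2)
  \<comment> \<open>Rewrites a relation [x, y] = e in the form xy = yxe.\<close>
  have swap: "x \<otimes>\<^bsub>H\<^esub> y = y \<otimes>\<^bsub>H\<^esub> x \<otimes>\<^bsub>H\<^esub> e"
    if "inv\<^bsub>H\<^esub> x \<otimes>\<^bsub>H\<^esub> (inv\<^bsub>H\<^esub> y \<otimes>\<^bsub>H\<^esub> (x \<otimes>\<^bsub>H\<^esub> y)) = e"
      "x \<in> carrier H" "y \<in> carrier H" for x y e
  proof -
    have "y \<otimes>\<^bsub>H\<^esub> x \<otimes>\<^bsub>H\<^esub> (inv\<^bsub>H\<^esub> x \<otimes>\<^bsub>H\<^esub> (inv\<^bsub>H\<^esub> y \<otimes>\<^bsub>H\<^esub> (x \<otimes>\<^bsub>H\<^esub> y))) =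
        y \<otimes>\<^bsub>H\<^esub> (x \<otimes>\<^bsub>H\<^esub> inv\<^bsub>H\<^esub> x) \<otimes>\<^bsub>H\<^esub> inv\<^bsub>H\<^esub> y \<otimes>\<^bsub>H\<^esub> (x \<otimes>\<^bsub>H\<^esub> y)"
      using that(2,3) by (simp only: H.m_assoc H.m_closed H.inv_closed)
    then show ?thesis using that by simp
  qed
  have f: "gen_class S R \<in> S \<rightarrow> carrier H" using gen_class_funcset[of S R] by (simp add: H)
  have "inv\<^bsub>H\<^esub> a \<otimes>\<^bsub>H\<^esub> (inv\<^bsub>H\<^esub> b \<otimes>\<^bsub>H\<^esub> (a \<otimes>\<^bsub>H\<^esub> b)) = word_eval H (gen_class S R) wd"
    unfolding a_def b_def H by (rule presented_comm_relation) (simp_all add: R_def S_def)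
  also have "\<dots> = d" unfolding d_def by (rule H.word_eval_letter[OF f]) (simp add: S_def)
  finally have ab: "a \<otimes>\<^bsub>H\<^esub> b = b \<otimes>\<^bsub>H\<^esub> a \<otimes>\<^bsub>H\<^esub> d" using a b by (rule swap)
  have "inv\<^bsub>H\<^esub> d \<otimes>\<^bsub>H\<^esub> (inv\<^bsub>H\<^esub> a \<otimes>\<^bsub>H\<^esub> (d \<otimes>\<^bsub>H\<^esub> a)) = word_eval H (gen_class S R) []"
    unfolding a_def d_def H by (rule presented_comm_relation) (simp_all add: R_def S_def)
  then have da: "d \<otimes>\<^bsub>H\<^esub> a = a \<otimes>\<^bsub>H\<^esub> d" using swap[of d a] a d by simp
  have "inv\<^bsub>H\<^esub> d \<otimes>\<^bsub>H\<^esub> (inv\<^bsub>H\<^esub> b \<otimes>\<^bsub>H\<^esub> (d \<otimes>\<^bsub>H\<^esub> b)) = word_eval H (gen_class S R) []"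
    unfolding b_def d_def H by (rule presented_comm_relation) (simp_all add: R_def S_def)
  then have db: "d \<otimes>\<^bsub>H\<^esub> b = b \<otimes>\<^bsub>H\<^esub> d" using swap[of d b] b d by simp
  have "carrier H = generate H {a, b, d}"
    using presented_generate[of S R] by (simp add: H a_def b_def d_def S_def)
  then show ?thesis
    by (intro two_generated_class2.intro two_generated_class2_axioms.intro H.is_group a b d ab da db dd aw pows)
      simp_all
qed

lemma order_M2_1_1: "order (M2_1_1 w) \<le> 2 ^ (w + 2)"
  using two_generated_class2.class2_order(2)[OF M2_1_1_presented] by (simp add: H_def)

lemma M2_1_1_factor:
  fixes G :: "('z, 'y) monoid_scheme" (structure)
  assumes "group G"
    and xyc: "x \<in> carrier G" "y \<in> carrier G" "c \<in> carrier G"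
    and xy: "x \<otimes> y = y \<otimes> x \<otimes> c" and cx: "c \<otimes> x = x \<otimes> c" and cy: "c \<otimes> y = y \<otimes> c"
    and xw: "x [^] (2 ^ w :: nat) = \<one>" and y2: "y [^] (2::nat) = \<one>" and c2: "c [^] (2::nat) = \<one>"
    and c: "c \<noteq> \<one>"
  shows "\<exists>h. factor_spanned G c (M2_1_1 w, h) {x, y, c}"
proof -
  interpret group G by fact
  define f where "f = (\<lambda>g. if g = Ga then x else if g = Gb then y else c)"
  have fab: "f Ga = x" "f Gb = y" "f Gd = c" by (simp_all add: f_def)
  have f: "f \<in> {Ga, Gb, Gd} \<rightarrow> carrier G" using xyc by (auto simp: f_def)
  have H: "H = presented S R" by (simp add: H_def M2_1_1_def S_def R_def)
  have swap: "inv u \<otimes> (inv v \<otimes> (u \<otimes> v)) = e"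
    if "u \<otimes> v = v \<otimes> u \<otimes> e" "u \<in> carrier G" "v \<in> carrier G" "e \<in> carrier G" for u v e
    using that by (simp add: inv_solve_left' m_assoc)
  have R: "word_eval G f s = word_eval G f t" if "(s, t) \<in> R" for s t
    using that xw y2 c2 swap[OF xy] swap[of c x \<one>] swap[of c y \<one>] cx cy xyc unfolding R_def
    by (elim insertE emptyE)
      (simp_all add: words_pow word_eval_pow[OF f] word_eval_letter[OF f] word_eval_comm[OF f] fab)
  obtain h where h: "h \<in> hom H G" "\<And>g. g \<in> S \<Longrightarrow> h (gen_class S R g) = f g"
    using presented_lift[of f S R] f R unfolding S_def H by blast
  have hab: "h a = x" "h b = y" "h d = c" using h(2) by (simp_all add: a_def b_def d_def S_def fab)
  from class2_central_factor[OF M2_1_1_presented h(1) hab(3) c] show ?thesis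
    using hab by (auto simp: H_def)
qed

end

section \<open>The cyclic factor\<close>

lemma (in group) generate_singleton_pow:
  assumes a: "a \<in> carrier G" "a [^] (k::nat) = \<one>" "0 < k"
  shows "generate G {a} = (\<lambda>i. a [^] i) ` {..<k}"
proof -
  have "ord a \<noteq> 0" using a by (auto simp: ord_eq_0)
  then have "generate G {a} = {a [^] i | i :: nat. True}" using generate_pow_nat[OF a(1)] by simp
  moreover have "a [^] i \<in> (\<lambda>i. a [^] i) ` {..<k}" for i :: nat
    using nat_pow_mod[OF a(1,2), of i] a(3) by (intro image_eqI[of _ _ "i mod k"]) auto
  ultimately show ?thesis by auto
qed

lemma Cyc_presented:
  fixes k :: nat
  defines "a \<equiv> gen_class {Ga} {(word_pow wa k, [])} Ga"
  assumes "0 < k"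
  shows "group (Cyc k)" "a \<in> carrier (Cyc k)" "a [^]\<^bsub>Cyc k\<^esub> k = \<one>\<^bsub>Cyc k\<^esub>"
    "carrier (Cyc k) = generate (Cyc k) {a}"
    "carrier (Cyc k) = (\<lambda>i. a [^]\<^bsub>Cyc k\<^esub> i) ` {..<k}"
proof -
  show grp: "group (Cyc k)" unfolding Cyc_def by (rule group_presented)
  show a: "a \<in> carrier (Cyc k)" unfolding Cyc_def a_def by (auto intro: word_class_closed)
  show ak: "a [^]\<^bsub>Cyc k\<^esub> k = \<one>\<^bsub>Cyc k\<^esub>"
    unfolding a_def Cyc_def by (rule presented_pow_one_relation) simp_all
  show gen: "carrier (Cyc k) = generate (Cyc k) {a}"
    using presented_generate[of "{Ga}" "{(word_pow wa k, [])}"] by (simp add: Cyc_def a_def)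
  show "carrier (Cyc k) = (\<lambda>i. a [^]\<^bsub>Cyc k\<^esub> i) ` {..<k}"
    unfolding gen by (rule group.generate_singleton_pow[OF grp a ak assms(2)])
qed

lemma order_Cyc: "0 < k \<Longrightarrow> order (Cyc k) \<le> k"
  using card_image_le[of "{..<k}"] by (simp add: order_def Cyc_presented(5))

text \<open>For an abelian factor \<open>amalg\<close> is a definite description, so all involutions
  of the presented group have to be known. This needs a lower bound for its order, which is read off
  from the element \<open>x\<close> of \<open>G\<close>.\<close>

lemma (in group) Cyc_factor:
  assumes x: "x \<in> carrier G" and n: "1 \<le> n" and xn: "x [^] (2 ^ n :: nat) = \<one>"
    and xc: "x [^] (2 ^ (n - 1) :: nat) = c" and c: "c \<noteq> \<one>"
  shows "\<exists>h. factor_spanned G c (Cyc (2 ^ n), h) {x}"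
proof -
  define H where "H = Cyc (2 ^ n)"
  define S where "S = {Ga}"
  define R where "R = {(word_pow wa (2 ^ n), [] :: gen word)}"
  define a where "a = gen_class S R Ga"
  have pos: "0 < (2::nat) ^ n" by simp
  note P = Cyc_presented[OF pos, folded S_def R_def, folded a_def H_def]
  interpret H: group H by (rule P(1))
  have H: "H = presented S R" by (simp add: H_def Cyc_def S_def R_def)
  have f: "(\<lambda>_. x) \<in> S \<rightarrow> carrier G" using x by simp
  have "word_eval G (\<lambda>_. x) (word_pow wa (2 ^ n)) = word_eval G (\<lambda>_. x) wa [^] (2 ^ n :: nat)"
    by (rule word_eval_pow[OF f]) (simp add: S_def)
  also have "word_eval G (\<lambda>_. x) wa = x" by (rule word_eval_letter[OF f]) (simp add: S_def)
  finally have "word_eval G (\<lambda>_. x) s = word_eval G (\<lambda>_. x) t" if "(s, t) \<in> R" for s t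
    using that xn by (simp add: R_def)
  then obtain h where h: "h \<in> hom H G" "h a = x"
    using presented_lift[OF f, of R] unfolding H a_def S_def by blast
  interpret h: group_hom H G h using h(1) by unfold_locales
  define t where "t = a [^]\<^bsub>H\<^esub> (2 ^ (n - 1) :: nat)"
  have t: "t \<in> carrier H" using P(2) by (simp add: t_def)
  have ht: "h t = c" using h.hom_nat_pow[OF P(2)] xc h(2) by (simp add: t_def)
  then have t1: "t \<noteq> \<one>\<^bsub>H\<^esub>" using c by auto
  have nn: "(2::nat) ^ (n - 1) + 2 ^ (n - 1) = 2 ^ n" using n by (cases n) auto
  then have tt: "t \<otimes>\<^bsub>H\<^esub> t = \<one>\<^bsub>H\<^esub>" using P(2,3) by (simp add: t_def H.nat_pow_mult)
  \<comment> \<open>The image of \<open>a\<close> has order \<open>2\<^sup>n\<close>, so \<open>t\<close> is the only involution.\<close>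
  have uniq: "g = t" if g: "g \<in> carrier H" "g \<otimes>\<^bsub>H\<^esub> g = \<one>\<^bsub>H\<^esub>" "g \<noteq> \<one>\<^bsub>H\<^esub>" for g
  proof -
    obtain i :: nat where i: "g = a [^]\<^bsub>H\<^esub> i" using g(1) P(5) by auto
    have "h (g \<otimes>\<^bsub>H\<^esub> g) = x [^] (i + i)"
      using g(1) P(2) h(2) x by (simp add: i h.hom_nat_pow nat_pow_mult)
    then have x1: "x [^] (i + i) = \<one>" using g(2) by simp
    have "\<not> ord x dvd 2 ^ (n - 1)" using x xc c pow_eq_id[OF x] by metis
    moreover have "ord x dvd 2 ^ n" using x xn pow_eq_id[OF x] by metis
    ultimately have "ord x = 2 ^ n"
      using divides_primepow_nat[OF two_is_prime_nat] by (metis Suc_diff_1 le_SucE le_imp_power_dvd n not_gr_zero not_one_le_zero)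
    then have "2 ^ n dvd i + i" using x1 pow_eq_id[OF x] by metis
    then have "2 ^ (n - 1) dvd i" using n by (cases n) (auto simp flip: mult_2)
    then obtain j where j: "i = 2 ^ (n - 1) * j" by (rule dvdE)
    then have "g = t [^]\<^bsub>H\<^esub> j" using P(2) by (simp add: i t_def H.nat_pow_pow)
    also have "\<dots> = t [^]\<^bsub>H\<^esub> (j mod 2)"
      using tt t by (intro H.nat_pow_mod) (simp_all add: numeral_2_eq_2)
    finally have "g = t [^]\<^bsub>H\<^esub> (j mod 2)" .
    moreover have "j mod 2 = 0 \<or> j mod 2 = 1" by auto
    ultimately show "g = t" using g(3) t by auto
  qed
  have "comm_group H"
  proof (rule H.group_comm_groupI)
    fix g k assume "g \<in> carrier H" "k \<in> carrier H"
    then obtain i j :: nat where "g = a [^]\<^bsub>H\<^esub> i" "k = a [^]\<^bsub>H\<^esub> j" using P(5) by auto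
    then show "g \<otimes>\<^bsub>H\<^esub> k = k \<otimes>\<^bsub>H\<^esub> g" using P(2) by (simp add: H.nat_pow_mult add.commute)
  qed
  moreover have "(THE K. subgroup K H \<and> card K = 2) = {\<one>\<^bsub>H\<^esub>, t}"
  proof (rule the_equality)
    show "subgroup {\<one>\<^bsub>H\<^esub>, t} H \<and> card {\<one>\<^bsub>H\<^esub>, t} = 2"
      using H.subgroup_involution[OF t tt] t1 by simp
    fix K assume K: "subgroup K H \<and> card K = 2"
    interpret K: subgroup K H using K by simp
    obtain g where g: "K = {\<one>\<^bsub>H\<^esub>, g}" "g \<noteq> \<one>\<^bsub>H\<^esub>"
    proof -
      obtain u v where uv: "K = {u, v}" "u \<noteq> v" using K by (meson card_2_iff)
      then have "u = \<one>\<^bsub>H\<^esub> \<or> v = \<one>\<^bsub>H\<^esub>" using K.one_closed by auto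
      then show thesis using uv that[of u] that[of v] by (auto simp: insert_commute)
    qed
    have gH: "g \<in> carrier H" using g(1) K.subset by auto
    have "g \<otimes>\<^bsub>H\<^esub> g \<in> K" using g(1) by (intro K.m_closed) simp_all
    then have "g \<otimes>\<^bsub>H\<^esub> g = \<one>\<^bsub>H\<^esub> \<or> g \<otimes>\<^bsub>H\<^esub> g = g \<otimes>\<^bsub>H\<^esub> \<one>\<^bsub>H\<^esub>"
      using g(1) gH by simp
    then have "g \<otimes>\<^bsub>H\<^esub> g = \<one>\<^bsub>H\<^esub>" using H.l_cancel[of g g "\<one>\<^bsub>H\<^esub>"] gH g(2) by blast
    then show "K = {\<one>\<^bsub>H\<^esub>, t}" using uniq[OF gH] g by simp
  qed
  ultimately have "amalg H = {\<one>\<^bsub>H\<^esub>, t}" by (simp add: amalg_def)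
  moreover have "finite (carrier H)" by (simp add: P(5))
  ultimately have "central_factor G c (H, h)" using t ht h(1) P(1) by (auto simp: central_factor_def)
  moreover have "factor_image (H, h) = generate G {x}"
    using h.generate_img[of "{a}"] P(2,4) h(2) by (simp add: factor_image_def)
  ultimately show ?thesis unfolding H_def by blast
qed

section \<open>Groups whose commutators lie in a central subgroup of order 2\<close>

type_synonym 'g factor = "gen word set monoid \<times> (gen word set \<Rightarrow> 'g)"

text \<open>The possible shapes of an orthogonal sum of \<open>k\<close> planes over the field with
  two elements, D_8 belonging to a plane with a singular vector and Q_8 to an anisotropic one. One
  Q_8 suffices because two anisotropic planes have a singular vector in their sum.\<close>

abbreviation hyperbolic_list :: "nat \<Rightarrow> gen word set monoid list \<Rightarrow> bool"
  where "hyperbolic_list k Qs \<equiv> Qs = replicate k D8 \<or> 1 \<le> k \<and> Qs = Q8 # replicate (k - 1) D8"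

locale involution_commutator_group = group G for G (structure) +
  fixes c
  assumes finite_carrier: "finite (carrier G)"
    and c_closed [simp]: "c \<in> carrier G" and c_neq_one: "c \<noteq> \<one>" and c_square: "c \<otimes> c = \<one>"
    and c_central: "x \<in> carrier G \<Longrightarrow> c \<otimes> x = x \<otimes> c"
    and commutator: "\<lbrakk>x \<in> carrier G; y \<in> carrier G\<rbrakk> \<Longrightarrow> x \<otimes> y = y \<otimes> x \<or> x \<otimes> y = y \<otimes> x \<otimes> c"
begin

text \<open>
  As a function on \<open>G / Z(G)\<close> with values in the field with two elements, \<open>noncomm\<close> is a
  nondegenerate alternating form.
\<close>

definition noncomm :: "'a \<Rightarrow> 'a \<Rightarrow> bool"
  where "noncomm x y \<longleftrightarrow> x \<otimes> y \<noteq> y \<otimes> x"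

lemma noncomm_sym: "noncomm x y \<longleftrightarrow> noncomm y x"
  by (auto simp: noncomm_def)

lemma noncomm_self [simp]: "\<not> noncomm x x"
  by (simp add: noncomm_def)

lemma noncomm_swap:
  assumes "x \<in> carrier G" "y \<in> carrier G"
  shows "x \<otimes> y = y \<otimes> x \<otimes> (if noncomm x y then c else \<one>)"
  using commutator[OF assms] assms by (auto simp: noncomm_def)

text \<open>Inequality of truth values is addition in the field with two elements, so this is
  linearity. The two central commutators multiply, and their product is trivial exactly if they
  agree.\<close>

lemma noncomm_mult_left:
  assumes x: "x \<in> carrier G" and y: "y \<in> carrier G" and z: "z \<in> carrier G"
  shows "noncomm (x \<otimes> y) z \<longleftrightarrow> noncomm x z \<noteq> noncomm y z"
proof -
  define s where "s = (if noncomm x z then c else \<one>)"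
  define u where "u = (if noncomm y z then c else \<one>)"
  have su: "s \<in> carrier G" "u \<in> carrier G" "s \<otimes> y = y \<otimes> s"
    using y c_central by (auto simp: s_def u_def)
  have "x \<otimes> y \<otimes> z = x \<otimes> (z \<otimes> y \<otimes> u)" using assms noncomm_swap[OF y z] by (simp add: m_assoc u_def)
  also have "\<dots> = x \<otimes> z \<otimes> (y \<otimes> u)" using assms su by (simp add: m_assoc)
  also have "\<dots> = z \<otimes> x \<otimes> s \<otimes> (y \<otimes> u)" using noncomm_swap[OF x z] by (simp add: s_def)
  also have "\<dots> = z \<otimes> x \<otimes> (s \<otimes> y) \<otimes> u" using assms su(1,2) by (simp add: m_assoc)
  also have "\<dots> = z \<otimes> (x \<otimes> y) \<otimes> (s \<otimes> u)"
    unfolding su(3) using assms su(1,2) by (simp add: m_assoc)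
  finally have eq: "x \<otimes> y \<otimes> z = z \<otimes> (x \<otimes> y) \<otimes> (s \<otimes> u)" .
  have "noncomm (x \<otimes> y) z \<longleftrightarrow> z \<otimes> (x \<otimes> y) \<otimes> (s \<otimes> u) \<noteq> z \<otimes> (x \<otimes> y) \<otimes> \<one>"
    using assms by (simp add: noncomm_def eq)
  also have "\<dots> \<longleftrightarrow> s \<otimes> u \<noteq> \<one>"
    using assms su l_cancel[of "z \<otimes> (x \<otimes> y)" "s \<otimes> u" \<one>] by auto
  also have "\<dots> \<longleftrightarrow> noncomm x z \<noteq> noncomm y z"
    using c_neq_one c_square by (auto simp: s_def u_def)
  finally show ?thesis .
qed

lemma noncomm_mult_right:
  assumes "x \<in> carrier G" "y \<in> carrier G" "z \<in> carrier G"
  shows "noncomm z (x \<otimes> y) \<longleftrightarrow> noncomm z x \<noteq> noncomm z y"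
  using noncomm_mult_left[OF assms] by (simp add: noncomm_sym)

lemma noncomm_one [simp]:
  assumes "x \<in> carrier G"
  shows "\<not> noncomm \<one> x" "\<not> noncomm x \<one>"
  using assms by (simp_all add: noncomm_def)

lemma noncomm_inv:
  assumes "x \<in> carrier G" "z \<in> carrier G"
  shows "noncomm (inv x) z \<longleftrightarrow> noncomm x z"
  using noncomm_mult_left[of "inv x" x z] assms by simp

text \<open>The commutator form is the polar form of squaring. All linear or quadratic behaviour of
  exponent parities comes from this identity.\<close>

lemma square_mult:
  assumes x: "x \<in> carrier G" and y: "y \<in> carrier G"
  shows "x \<otimes> y \<otimes> (x \<otimes> y) = x \<otimes> x \<otimes> (y \<otimes> y) \<otimes> (if noncomm x y then c else \<one>)"
proof -
  define s where "s = (if noncomm y x then c else \<one>)"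
  have s: "s \<in> carrier G" "s \<otimes> y = y \<otimes> s" using y c_central by (auto simp: s_def)
  have "x \<otimes> y \<otimes> (x \<otimes> y) = x \<otimes> (y \<otimes> x) \<otimes> y" using x y by (simp add: m_assoc)
  also have "\<dots> = x \<otimes> (x \<otimes> y \<otimes> s) \<otimes> y" using noncomm_swap[OF y x] by (simp add: s_def)
  also have "\<dots> = x \<otimes> x \<otimes> y \<otimes> (s \<otimes> y)" using x y s by (simp add: m_assoc)
  also have "\<dots> = x \<otimes> x \<otimes> (y \<otimes> y) \<otimes> s" using x y s by (simp add: m_assoc)
  finally show ?thesis by (simp add: s_def noncomm_sym)
qed

lemma center_iff: "z \<in> center G \<longleftrightarrow> z \<in> carrier G \<and> (\<forall>x\<in>carrier G. \<not> noncomm z x)"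
  by (auto simp: center_def noncomm_def)

lemma center_closed: "z \<in> center G \<Longrightarrow> z \<in> carrier G"
  by (simp add: center_iff)

lemma center_noncomm: "z \<in> center G \<Longrightarrow> x \<in> carrier G \<Longrightarrow> \<not> noncomm z x \<and> \<not> noncomm x z"
  by (simp add: center_iff noncomm_sym)

lemma one_center: "\<one> \<in> center G"
  by (simp add: center_iff)

lemma subgroup_center: "subgroup (center G) G"
proof (rule subgroupI)
  show "center G \<noteq> {}" using one_center by blast
qed (auto simp: center_iff noncomm_mult_left noncomm_inv)

lemma c_center: "c \<in> center G"
  using c_central by (simp add: center_def)

text \<open>The preimages of the subspaces of \<open>G / Z(G)\<close> on which the commutator form
  is nondegenerate. They are the objects over which the inductions run.\<close>

definition full_subgroup :: "'a set \<Rightarrow> bool"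
  where "full_subgroup H \<longleftrightarrow> subgroup H G \<and> center G \<subseteq> H \<and>
    (\<forall>x\<in>H. (\<forall>y\<in>H. \<not> noncomm x y) \<longrightarrow> x \<in> center G)"

definition orthogonal :: "'a set \<Rightarrow> 'a \<Rightarrow> 'a \<Rightarrow> 'a set"
  where "orthogonal H x y = {h \<in> H. \<not> noncomm h x \<and> \<not> noncomm h y}"

lemma full_subgroup_carrier: "full_subgroup (carrier G)"
  using subgroup_self by (auto simp: full_subgroup_def center_iff)

lemma full_subgroupD:
  assumes "full_subgroup H"
  shows "subgroup H G" "H \<subseteq> carrier G" "center G \<subseteq> H"
  using assms subgroup.subset by (auto simp: full_subgroup_def)

lemma full_subgroup_partner:
  assumes "full_subgroup H" "x \<in> H" "x \<notin> center G"
  obtains y where "y \<in> H" "noncomm x y"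
  using assms by (auto simp: full_subgroup_def)

context
  fixes H x y
  assumes H: "full_subgroup H" and x: "x \<in> H" and y: "y \<in> H" and xy: "noncomm x y"
begin

lemma hyperbolic_closed: "x \<in> carrier G" "y \<in> carrier G"
  using full_subgroupD(2)[OF H] x y by auto

lemma subgroup_orthogonal: "subgroup (orthogonal H x y) G"
proof -
  interpret H: subgroup H G using full_subgroupD(1)[OF H] .
  have "h \<in> carrier G" if "h \<in> H" for h using H.subset that by auto
  then show ?thesis
    using hyperbolic_closed
    by (intro subgroupI) (auto simp: orthogonal_def noncomm_mult_left noncomm_inv intro: exI[of _ \<one>])
qed

text \<open>Projection along a hyperbolic pair: the coefficient of \<open>x\<close> is the pairing
  of \<open>h\<close> with \<open>y\<close>, and that of \<open>y\<close> is the pairing with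
  \<open>x\<close>.\<close>

lemma hyperbolic_split:
  assumes h: "h \<in> H"
  obtains a b h' where "a \<in> {\<one>, x}" "b \<in> {\<one>, y}" "h' \<in> orthogonal H x y" "h = a \<otimes> b \<otimes> h'"
proof
  interpret H: subgroup H G using full_subgroupD(1)[OF H] .
  note xyG = hyperbolic_closed
  have hG: "h \<in> carrier G" using h H.subset by auto
  define a where "a = (if noncomm h y then x else \<one>)"
  define b where "b = (if noncomm h x then y else \<one>)"
  have ab: "a \<in> H" "b \<in> H" "a \<in> carrier G" "b \<in> carrier G" using x y xyG by (auto simp: a_def b_def)
  show "a \<in> {\<one>, x}" "b \<in> {\<one>, y}" by (auto simp: a_def b_def)
  show "h = a \<otimes> b \<otimes> (inv (a \<otimes> b) \<otimes> h)" using ab hG by (simp add: m_assoc[symmetric])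
  have "noncomm a x = False" "noncomm a y = noncomm h y" "noncomm b y = False" "noncomm b x = noncomm h x"
    using xy xyG by (auto simp: a_def b_def noncomm_sym)
  then have "\<not> noncomm (inv (a \<otimes> b) \<otimes> h) x" "\<not> noncomm (inv (a \<otimes> b) \<otimes> h) y"
    using ab hG xyG by (auto simp: noncomm_mult_left noncomm_inv simp del: inv_mult_group)
  then show "inv (a \<otimes> b) \<otimes> h \<in> orthogonal H x y" using ab h by (simp add: orthogonal_def)
qed

text \<open>An element of the complement that is orthogonal to the complement is also orthogonal to
  \<open>x\<close> and \<open>y\<close>, hence to all of \<open>H\<close> by
  \<open>hyperbolic_split\<close>.\<close>

lemma full_subgroup_orthogonal: "full_subgroup (orthogonal H x y)"
  unfolding full_subgroup_def
proof (intro conjI ballI impI)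
  show "subgroup (orthogonal H x y) G" by (rule subgroup_orthogonal)
  show "center G \<subseteq> orthogonal H x y"
    using full_subgroupD(3)[OF H] center_noncomm hyperbolic_closed by (auto simp: orthogonal_def)
  fix u assume u: "u \<in> orthogonal H x y" and *: "\<forall>v\<in>orthogonal H x y. \<not> noncomm u v"
  have uH: "u \<in> H" "u \<in> carrier G" "\<not> noncomm u x" "\<not> noncomm u y"
    using u full_subgroupD(2)[OF H] by (auto simp: orthogonal_def)
  have "\<not> noncomm u h" if hH: "h \<in> H" for h
  proof -
    obtain a b h' where h: "a \<in> {\<one>, x}" "b \<in> {\<one>, y}" "h' \<in> orthogonal H x y" "h = a \<otimes> b \<otimes> h'"
      by (rule hyperbolic_split[OF hH])
    moreover have "h' \<in> carrier G" using h(3) full_subgroupD(2)[OF H] by (auto simp: orthogonal_def)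
    moreover have "\<not> noncomm u a" "\<not> noncomm u b" "\<not> noncomm u h'" using h uH * by auto
    ultimately show ?thesis using uH hyperbolic_closed by (auto simp: noncomm_mult_right)
  qed
  then show "u \<in> center G" using H uH by (simp add: full_subgroup_def)
qed

text \<open>The coefficients of \<open>x\<close> and \<open>y\<close> in a product can be recovered
  by pairing it with \<open>y\<close> and \<open>x\<close>, so the four products of coefficients lie
  in different cosets of the complement.\<close>

lemma card_orthogonal: "4 * card (orthogonal H x y) \<le> card H"
proof -
  interpret H: subgroup H G using full_subgroupD(1)[OF H] .
  note xyG = hyperbolic_closed
  let ?D = "{\<one>, x} \<times> {\<one>, y} \<times> orthogonal H x y" and ?f = "\<lambda>(a, b, h). a \<otimes> b \<otimes> h"
  have fin: "finite H" using finite_carrier H.subset finite_subset by blast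
  have inj: "inj_on ?f ?D"
  proof (rule inj_onI)
    fix p q assume pq: "p \<in> ?D" "q \<in> ?D" "?f p = ?f q"
    obtain a b h where p: "p = (a, b, h)" by (cases p)
    obtain a' b' h' where q: "q = (a', b', h')" by (cases q)
    have ab: "a \<in> {\<one>, x}" "b \<in> {\<one>, y}" "a' \<in> {\<one>, x}" "b' \<in> {\<one>, y}"
      and h: "h \<in> orthogonal H x y" "h' \<in> orthogonal H x y"
      and eq: "a \<otimes> b \<otimes> h = a' \<otimes> b' \<otimes> h'"
      using pq by (auto simp: p q)
    have hG: "h \<in> carrier G" "h' \<in> carrier G" "\<not> noncomm h x" "\<not> noncomm h y" "\<not> noncomm h' x" "\<not> noncomm h' y"
      using h H.subset by (auto simp: orthogonal_def)
    have abG: "a \<in> carrier G" "b \<in> carrier G" "a' \<in> carrier G" "b' \<in> carrier G" using ab xyG by auto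
    have "noncomm a y = noncomm (a \<otimes> b \<otimes> h) y" "noncomm a' y = noncomm (a' \<otimes> b' \<otimes> h') y"
      using ab abG hG xyG by (auto simp: noncomm_mult_left)
    then have aa: "a = a'" using ab xy xyG eq by auto
    have "noncomm b x = noncomm (a \<otimes> b \<otimes> h) x" "noncomm b' x = noncomm (a' \<otimes> b' \<otimes> h') x"
      using ab abG hG xyG by (auto simp: noncomm_mult_left)
    then have bb: "b = b'" using ab xy xyG eq by (auto simp: noncomm_sym)
    have "h = h'" using aa bb eq abG hG by (metis l_cancel m_closed)
    then show "p = q" using aa bb by (simp add: p q)
  qed
  have sub: "?f ` ?D \<subseteq> H" using x y by (auto simp: orthogonal_def)
  have "x \<noteq> \<one>" "y \<noteq> \<one>" using xy xyG by auto
  then have "card ?D = 4 * card (orthogonal H x y)" by (simp add: card_cartesian_product)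
  then show ?thesis using card_inj_on_le[OF inj sub fin] by simp
qed

lemma orthogonal_subset: "orthogonal H x y \<subseteq> H"
  by (auto simp: orthogonal_def)

lemma card_orthogonal_less: "card (orthogonal H x y) < card H"
proof (rule psubset_card_mono)
  show "finite H" using finite_carrier full_subgroupD(2)[OF H] finite_subset by blast
  show "orthogonal H x y \<subset> H" using x xy by (auto simp: orthogonal_def)
qed

end

text \<open>A linear functional on a symplectic space is the pairing with a vector. The induction
  represents it on the complement of a hyperbolic pair and then corrects the two remaining
  values.\<close>

lemma additive_functional_repr:
  assumes "full_subgroup H"
    and "\<And>g h. \<lbrakk>g \<in> H; h \<in> H\<rbrakk> \<Longrightarrow> f (g \<otimes> h) \<longleftrightarrow> f g \<noteq> f h"
    and "\<And>z. z \<in> center G \<Longrightarrow> \<not> f z"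
  shows "\<exists>u\<in>H. \<forall>h\<in>H. f h \<longleftrightarrow> noncomm u h"
  using assms
proof (induction "card H" arbitrary: H rule: less_induct)
  case less
  interpret H: subgroup H G using full_subgroupD(1)[OF less.prems(1)] .
  show ?case
  proof (cases "H = center G")
    case True
    then show ?thesis using less.prems(3) H.subset by (intro bexI[of _ \<one>]) auto
  next
    case False
    then obtain x where x: "x \<in> H" "x \<notin> center G" using full_subgroupD(3)[OF less.prems(1)] by auto
    then obtain y where y: "y \<in> H" "noncomm x y" using full_subgroup_partner less.prems(1) by blast
    note xy = less.prems(1) x(1) y
    let ?O = "orthogonal H x y"
    have "\<exists>u\<in>?O. \<forall>h\<in>?O. f h \<longleftrightarrow> noncomm u h"
    proof (rule less.hyps)
      show "card ?O < card H" by (rule card_orthogonal_less[OF xy])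
      show "full_subgroup ?O" by (rule full_subgroup_orthogonal[OF xy])
    qed (use less.prems in \<open>auto simp: orthogonal_def\<close>)
    then obtain v where v: "v \<in> ?O" "\<And>h. h \<in> ?O \<Longrightarrow> f h \<longleftrightarrow> noncomm v h" by blast
    \<comment> \<open>The correction is crosswise: \<open>x\<close> pairs nontrivially with
      \<open>y\<close> but not with itself, so it enters according to the value at
      \<open>y\<close>.\<close>
    define a where "a = (if f y then x else \<one>)"
    define b where "b = (if f x then y else \<one>)"
    have ab: "a \<in> H" "b \<in> H" using x y by (auto simp: a_def b_def)
    have vH: "v \<in> H" "\<not> noncomm v x" "\<not> noncomm v y" using v(1) by (auto simp: orthogonal_def)
    have G: "h \<in> carrier G" if "h \<in> H" for h using that H.subset by auto
    note closed = G[OF ab(1)] G[OF ab(2)] G[OF vH(1)] G[OF x(1)] G[OF y(1)]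
    define u where "u = v \<otimes> a \<otimes> b"
    have uH: "u \<in> H" using vH ab by (simp add: u_def)
    have "f \<one> = False" using less.prems(3) subgroup.one_closed[OF subgroup_center] by auto
    have yx: "noncomm y x" using y(2) by (simp add: noncomm_sym)
    have ux: "noncomm u x = f x" and uy: "noncomm u y = f y"
      using y yx vH closed by (auto simp: u_def noncomm_mult_left a_def b_def)
    have "f h \<longleftrightarrow> noncomm u h" if hH: "h \<in> H" for h
    proof -
      obtain a' b' h' where *: "a' \<in> {\<one>, x}" "b' \<in> {\<one>, y}" "h' \<in> ?O" "h = a' \<otimes> b' \<otimes> h'"
        by (rule hyperbolic_split[OF xy hH])
      have H': "a' \<in> H" "b' \<in> H" "h' \<in> H" using * x y by (auto simp: orthogonal_def)
      have "f a' = noncomm u a'" "f b' = noncomm u b'"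
        using * ux uy \<open>f \<one> = False\<close> G[OF uH] by auto
      moreover have "noncomm u h' = f h'"
      proof -
        have "\<not> noncomm x h'" "\<not> noncomm y h'"
          using *(3) by (auto simp: orthogonal_def noncomm_sym)
        then show ?thesis
          using v(2)[OF *(3)] closed G[OF H'(3)] by (auto simp: u_def noncomm_mult_left a_def b_def)
      qed
      ultimately show ?thesis
        using H' G uH less.prems(2) by (simp add: *(4) noncomm_mult_right)
    qed
    then show ?thesis using uH by blast
  qed
qed

section \<open>Splitting a nondegenerate subgroup into hyperbolic planes\<close>

definition factor_union :: "('x monoid \<times> ('x \<Rightarrow> 'a)) list \<Rightarrow> 'a set"
  where "factor_union Fs = (\<Union>F\<in>set Fs. factor_image F)"

lemma factor_union_simps [simp]:
  "factor_union [] = {}"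
  "factor_union (F # Fs) = factor_image F \<union> factor_union Fs"
  "factor_union (Fs @ Fs') = factor_union Fs \<union> factor_union Fs'"
  by (auto simp: factor_union_def)

lemma generate_hyperbolic:
  assumes H: "full_subgroup H" and xy: "x \<in> H" "y \<in> H" "noncomm x y"
    and A: "x \<in> generate G A" "y \<in> generate G A" "orthogonal H x y \<subseteq> generate G A"
  shows "H \<subseteq> generate G A"
proof
  fix h assume "h \<in> H"
  then obtain a b h' where h: "a \<in> {\<one>, x}" "b \<in> {\<one>, y}" "h' \<in> orthogonal H x y" "h = a \<otimes> b \<otimes> h'"
    by (rule hyperbolic_split[OF H xy])
  then have "a \<in> generate G A" "b \<in> generate G A" "h' \<in> generate G A"
    using A generate.one by auto
  then show "h \<in> generate G A" by (simp add: h(4) generate.eng)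
qed

lemma commuting_sets_orthogonal:
  assumes H: "full_subgroup H" and xy: "x \<in> H" "y \<in> H"
    and B: "B \<subseteq> orthogonal H x y" and A: "A \<subseteq> generate G {x, y, c}"
  shows "commuting_sets G A B"
  unfolding commuting_sets_def
proof (intro ballI)
  fix a b assume "a \<in> A" "b \<in> B"
  have xyG: "{x, y, c} \<subseteq> carrier G" using full_subgroupD(2)[OF H] xy by auto
  have b: "b \<in> carrier G" "\<not> noncomm b x" "\<not> noncomm b y"
    using \<open>b \<in> B\<close> B full_subgroupD(2)[OF H] by (auto simp: orthogonal_def)
  show "a \<otimes> b = b \<otimes> a"
  proof (rule generate_commute[OF xyG b(1)])
    show "a \<in> generate G {x, y, c}" using \<open>a \<in> A\<close> A by auto
    show "g \<otimes> b = b \<otimes> g" if "g \<in> {x, y, c}" for g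
      using that b c_central by (auto simp: noncomm_def)
  qed
qed

text \<open>The bound for the order of \<open>H\<close> feeds the final count; the clause on
  \<open>H \<noteq> center G\<close> later yields \<open>1 \<le> k\<close> in the shapes without a
  special plane.\<close>

definition hyperbolic_factors :: "'a set \<Rightarrow> nat \<Rightarrow> 'a factor list \<Rightarrow> bool"
  where "hyperbolic_factors H k Fs \<longleftrightarrow>
    hyperbolic_list k (map fst Fs) \<and>
    (H \<noteq> center G \<longrightarrow> 1 \<le> k) \<and> central_family G c Fs \<and> factor_union Fs \<subseteq> H \<and>
    H \<subseteq> generate G (center G \<union> factor_union Fs) \<and> card (center G) * 4 ^ k \<le> card H"

text \<open>
  The quadratic form \<open>x \<mapsto> x\<^sup>2\<close> on \<open>H\<close>, with values in \<open>{1, c}\<close> after adjusting by central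
  elements: hyperbolic planes are split off as long as there is a singular vector.
\<close>

lemma hyperbolic_decomposition:
  assumes "full_subgroup H"
    and "\<And>h. h \<in> H \<Longrightarrow> \<exists>w\<in>center G. h \<otimes> h = w \<otimes> w \<or> h \<otimes> h = w \<otimes> w \<otimes> c"
  shows "\<exists>k Fs. hyperbolic_factors H k Fs"
  using assms
proof (induction "card H" arbitrary: H rule: less_induct)
  case less
  note H = full_subgroupD[OF less.prems(1)]
  interpret H: subgroup H G using H(1) .
  \<comment> \<open>Dividing \<open>h\<close> by the central element \<open>w\<close> removes the
    square of \<open>w\<close> and leaves all commutators unchanged.\<close>
  have adjust: "\<exists>w\<in>center G. h \<otimes> w \<in> H \<and> h \<otimes> w \<otimes> (h \<otimes> w) \<in> {\<one>, c}" if h: "h \<in> H" for h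
  proof -
    obtain w where w: "w \<in> center G" "h \<otimes> h = w \<otimes> w \<or> h \<otimes> h = w \<otimes> w \<otimes> c"
      using less.prems(2)[OF h] by blast
    have wG: "w \<in> carrier G" "inv w \<in> center G"
      using w(1) subgroup.m_inv_closed[OF subgroup_center] center_closed by auto
    have "h \<otimes> inv w \<otimes> (h \<otimes> inv w) = h \<otimes> h \<otimes> (inv w \<otimes> inv w)"
      using square_mult[of h "inv w"] center_noncomm[OF wG(2)] h H(2) wG by auto
    also have "\<dots> = h \<otimes> h \<otimes> inv (w \<otimes> w)" using wG by (simp add: inv_mult_group)
    also have "\<dots> \<in> {\<one>, c}"
    proof -
      have q: "w \<otimes> w \<in> carrier G" using wG by simp
      have "w \<otimes> w \<otimes> c \<otimes> inv (w \<otimes> w) = c \<otimes> (w \<otimes> w) \<otimes> inv (w \<otimes> w)" using c_central[OF q] by simp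
      also have "\<dots> = c" using q by (simp only: m_assoc[of c] inv_closed c_closed r_inv r_one)
      finally show ?thesis using w(2) q by auto
    qed
    finally show ?thesis using wG h H(3) by (intro bexI[of _ "inv w"]) auto
  qed
  have ww: "noncomm (g \<otimes> w) h = noncomm g h" "noncomm h (g \<otimes> w) = noncomm h g"
    if "w \<in> center G" "g \<in> carrier G" "h \<in> carrier G" for g h w
    using that center_noncomm center_closed by (auto simp: noncomm_mult_left noncomm_mult_right)
  show ?case
  proof (cases "H = center G")
    case True
    then show ?thesis
      by (intro exI[of _ 0] exI[of _ "[]"])
        (auto simp: hyperbolic_factors_def central_family_def intro: generate.incl)
  next
    case False
    then obtain g where g: "g \<in> H" "g \<notin> center G" using H(3) by auto
    show ?thesis
    proof (cases "\<exists>x\<in>H - center G. x \<otimes> x = \<one>")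
      case True
      then obtain x where x: "x \<in> H" "x \<notin> center G" "x \<otimes> x = \<one>" by blast
      obtain y0 where y0: "y0 \<in> H" "noncomm x y0" using full_subgroup_partner less.prems(1) x by blast
      obtain w where w: "w \<in> center G" "y0 \<otimes> w \<in> H" "y0 \<otimes> w \<otimes> (y0 \<otimes> w) \<in> {\<one>, c}"
        using adjust[OF y0(1)] by blast
      define y1 where "y1 = y0 \<otimes> w"
      have y1: "y1 \<in> H" "noncomm x y1" "y1 \<otimes> y1 = \<one> \<or> y1 \<otimes> y1 = c"
        using w y0 x(1) H(2) ww(2)[OF w(1), of y0 x] by (auto simp: y1_def)
      \<comment> \<open>If \<open>y1\<close> has square \<open>c\<close>, then the square of the
        product of \<open>x\<close> and \<open>y1\<close> is \<open>c\<close> times the commutator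
        \<open>c\<close>, hence trivial. So both vectors of the pair can be taken singular.\<close>
      define y where "y = (if y1 \<otimes> y1 = \<one> then y1 else x \<otimes> y1)"
      have xy1: "x \<in> carrier G" "y1 \<in> carrier G" using x y1 H(2) by auto
      have y: "y \<in> H" "noncomm x y" "y \<otimes> y = \<one>"
        using y1 x(1,3) xy1 square_mult[OF xy1] c_square by (auto simp: y_def noncomm_mult_right)
      note xy = less.prems(1) x(1) y(1,2)
      let ?O = "orthogonal H x y"
      have "\<exists>k Fs. hyperbolic_factors ?O k Fs"
      proof (rule less.hyps)
        show "card ?O < card H" by (rule card_orthogonal_less[OF xy])
        show "full_subgroup ?O" by (rule full_subgroup_orthogonal[OF xy])
      qed (use less.prems(2) in \<open>auto simp: orthogonal_def\<close>)
      then obtain k Fs where "hyperbolic_factors ?O k Fs" by blast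
      then have Fs: "hyperbolic_list k (map fst Fs)"
          "central_family G c Fs" "factor_union Fs \<subseteq> ?O"
          "?O \<subseteq> generate G (center G \<union> factor_union Fs)" "card (center G) * 4 ^ k \<le> card ?O"
        by (simp_all add: hyperbolic_factors_def)
      have xyG: "x \<in> carrier G" "y \<in> carrier G" using x y H(2) by auto
      \<comment> \<open>Two noncommuting involutions generate a dihedral group, whose generator of
        order 4 is their product.\<close>
      have "\<exists>h. factor_spanned G c (D8, h) {x \<otimes> y, y, c}"
      proof (rule D8_factor)
        have "noncomm (x \<otimes> y) y" using xyG y by (simp add: noncomm_mult_left)
        then show "x \<otimes> y \<otimes> y = y \<otimes> (x \<otimes> y) \<otimes> c" using noncomm_swap[of "x \<otimes> y" y] xyG by simp
        show "(x \<otimes> y) [^] (2::nat) = c"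
          using square_mult[OF xyG] x(3) y(2,3) xyG by (simp add: numeral_2_eq_2)
      qed (use xyG y c_square c_neq_one in \<open>auto simp: numeral_2_eq_2\<close>)
      then obtain h where h: "central_factor G c (D8, h)" "factor_image (D8, h) = generate G {x \<otimes> y, y, c}"
        by blast
      have yim: "y \<in> factor_image (D8, h)" by (auto simp: h(2) intro: generate.incl)
      have "x \<otimes> y \<otimes> y \<in> factor_image (D8, h)"
        unfolding h(2) by (intro generate.eng generate.incl) auto
      then have xim: "x \<in> factor_image (D8, h)" using y(3) xyG by (simp add: m_assoc)
      have im: "factor_image (D8, h) \<subseteq> generate G {x, y, c}"
        unfolding h(2)
        by (rule generate_subgroup_incl[OF _ generate_is_subgroup])
          (use xyG in \<open>auto intro: generate.eng generate.incl\<close>)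
      have "commuting_sets G (factor_image F) (factor_image (D8, h))" if "F \<in> set Fs" for F
        using Fs(3) that commuting_sets_orthogonal[OF less.prems(1) x(1) y(1) _ im, of "factor_image F"]
        by (auto simp: factor_union_def intro: commuting_sets_sym)
      \<comment> \<open>The new D_8 is appended at the end so that a Q_8, if present, stays at the
        head of the list.\<close>
      then have fam: "central_family G c (Fs @ [(D8, h)])"
        using Fs(2) h(1) by (auto simp: central_family_def sorted_wrt_append)
      have "hyperbolic_factors H (Suc k) (Fs @ [(D8, h)])"
        unfolding hyperbolic_factors_def
      proof (intro conjI)
        show "map fst (Fs @ [(D8, h)]) = replicate (Suc k) D8 \<or>
            1 \<le> Suc k \<and> map fst (Fs @ [(D8, h)]) = Q8 # replicate (Suc k - 1) D8"
          using Fs(1) by (cases k) (auto simp: replicate_append_same)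
        show "central_family G c (Fs @ [(D8, h)])" by (rule fam)
        have "generate G {x, y, c} \<subseteq> H"
          by (rule generate_subgroup_incl[OF _ H(1)]) (use x y H(3) c_center in auto)
        then show "factor_union (Fs @ [(D8, h)]) \<subseteq> H"
          using im Fs(3) orthogonal_subset[OF xy] by auto
        show "H \<subseteq> generate G (center G \<union> factor_union (Fs @ [(D8, h)]))"
        proof (rule generate_hyperbolic[OF xy])
          show "?O \<subseteq> generate G (center G \<union> factor_union (Fs @ [(D8, h)]))"
            using Fs(4) mono_generate[of "center G \<union> factor_union Fs" "center G \<union> factor_union (Fs @ [(D8, h)])"]
            by auto
        qed (use xim yim in \<open>auto intro: generate.incl\<close>)
        show "card (center G) * 4 ^ Suc k \<le> card H"
          using Fs(5) card_orthogonal[OF xy] by simp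
      qed simp
      then show ?thesis by blast
    next
      case False
      \<comment> \<open>There is no noncentral involution in \<open>H\<close> in this case, so the
        adjusted square cannot be trivial.\<close>
      have square_c: "\<exists>w\<in>center G. h \<otimes> w \<in> H \<and> h \<otimes> w \<otimes> (h \<otimes> w) = c"
        if h: "h \<in> H" "h \<notin> center G" for h
      proof -
        obtain w where w: "w \<in> center G" "h \<otimes> w \<in> H" "h \<otimes> w \<otimes> (h \<otimes> w) \<in> {\<one>, c}"
          using adjust[OF h(1)] by blast
        have "h \<otimes> w \<notin> center G"
          using h H(2) ww[OF w(1)] w(1) center_closed[OF w(1)] by (auto simp: center_iff)
        then show ?thesis using w False by blast
      qed
      obtain w where w: "w \<in> center G" "g \<otimes> w \<in> H" "g \<otimes> w \<otimes> (g \<otimes> w) = c"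
        using square_c[OF g] by blast
      obtain y0 where y0: "y0 \<in> H" "noncomm g y0" using full_subgroup_partner less.prems(1) g by blast
      have "y0 \<notin> center G" using y0 g(1) H(2) center_noncomm[of y0 g] by auto
      then obtain v where v: "v \<in> center G" "y0 \<otimes> v \<in> H" "y0 \<otimes> v \<otimes> (y0 \<otimes> v) = c"
        using square_c[OF y0(1)] by blast
      define x where "x = g \<otimes> w"
      define y where "y = y0 \<otimes> v"
      have xH: "x \<in> H" "y \<in> H" "x \<otimes> x = c" "y \<otimes> y = c" using w v by (auto simp: x_def y_def)
      have nc: "noncomm x y"
        using ww[OF w(1), of g y] ww[OF v(1), of y0 g] y0 g(1) H(2) xH(2) by (auto simp: x_def y_def)
      note xy = less.prems(1) xH(1,2) nc
      have xyG: "x \<in> carrier G" "y \<in> carrier G" using xH H(2) by auto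
      let ?O = "orthogonal H x y"
      \<comment> \<open>The anisotropic part has only one plane: the product of orthogonal elements
        \<open>x\<close> and \<open>s\<close> of square \<open>c\<close> has trivial square, and it
        is noncentral because it does not commute with \<open>y\<close>.\<close>
      have O: "?O = center G"
      proof (rule ccontr)
        assume "?O \<noteq> center G"
        then obtain u where u: "u \<in> ?O" "u \<notin> center G"
          using full_subgroupD(3)[OF full_subgroup_orthogonal[OF xy]] by auto
        then obtain t where t: "t \<in> center G" "u \<otimes> t \<in> H" "u \<otimes> t \<otimes> (u \<otimes> t) = c"
          using square_c[of u] by (auto simp: orthogonal_def)
        define s where "s = u \<otimes> t"
        have uG: "u \<in> carrier G" "\<not> noncomm u x" "\<not> noncomm u y" using u H(2) by (auto simp: orthogonal_def)
        have s: "s \<in> H" "s \<in> carrier G" "s \<otimes> s = c" "\<not> noncomm s x" "\<not> noncomm s y"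
          using t H(2) ww[OF t(1) uG(1)] uG xyG by (auto simp: s_def)
        have "x \<otimes> s \<otimes> (x \<otimes> s) = \<one>"
          using square_mult[OF xyG(1) s(2)] s xH(3) c_square by (simp add: noncomm_sym)
        moreover have "noncomm (x \<otimes> s) y" using nc s xyG by (simp add: noncomm_mult_left)
        then have "x \<otimes> s \<notin> center G" using xyG center_noncomm by blast
        moreover have "x \<otimes> s \<in> H" using xH s by simp
        ultimately show False using False by blast
      qed
      have "\<exists>h. factor_spanned G c (Q8, h) {x, y, c}"
      proof (rule Q8_factor)
        show "x \<otimes> y = y \<otimes> x \<otimes> c" using noncomm_swap[OF xyG] nc by simp
      qed (use xyG xH c_square c_neq_one in \<open>auto simp: numeral_2_eq_2\<close>)
      then obtain h where h: "central_factor G c (Q8, h)" "factor_image (Q8, h) = generate G {x, y, c}"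
        by blast
      have "hyperbolic_factors H 1 [(Q8, h)]"
        unfolding hyperbolic_factors_def
      proof (intro conjI)
        show "map fst [(Q8, h)] = replicate 1 D8 \<or> 1 \<le> (1::nat) \<and> map fst [(Q8, h)] = Q8 # replicate (1 - 1) D8"
          by simp
        show "central_family G c [(Q8, h)]" using h(1) by (simp add: central_family_def)
        show "factor_union [(Q8, h)] \<subseteq> H"
          unfolding factor_union_simps h(2) Un_empty_right
          by (rule generate_subgroup_incl[OF _ H(1)]) (use xH H(3) c_center in auto)
        show "H \<subseteq> generate G (center G \<union> factor_union [(Q8, h)])"
          by (rule generate_hyperbolic[OF xy]) (auto simp: O h(2) intro: generate.incl)
        show "card (center G) * 4 ^ 1 \<le> card H" using card_orthogonal[OF xy] O by simp
      qed simp
      then show ?thesis by blast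
    qed
  qed
qed

end

section \<open>Recognising the central products\<close>

lemma prod_list_le_power:
  fixes xs :: "nat list"
  shows "(\<And>x. x \<in> set xs \<Longrightarrow> x \<le> b) \<Longrightarrow> prod_list xs \<le> b ^ length xs"
  by (induction xs) (auto intro!: mult_mono)

lemma (in group) integer_mod_group_hom:
  assumes g: "g \<in> carrier G" "g [^] (k::nat) = \<one>"
  shows "(\<lambda>x::int. g [^] x) \<in> hom (integer_mod_group k) G"
proof (rule homI)
  fix x y
  have "g [^] (int k * q) = \<one>" for q
    using g int_pow_pow[of g "int k" q] by (simp add: int_pow_int)
  then have "g [^] (x + y) = g [^] ((x + y) mod int k)"
    using g(1) int_pow_mult[of g "int k * ((x + y) div int k)" "(x + y) mod int k"] by simp
  then show "g [^] (x \<otimes>\<^bsub>integer_mod_group k\<^esub> y) = g [^] x \<otimes> g [^] y"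
    using g(1) by (simp add: int_pow_mult)
qed (use g in simp)

lemma order_integer_mod_group: "0 < k \<Longrightarrow> order (integer_mod_group k) = k"
  by (simp add: order_def carrier_integer_mod_group)

lemma finite_integer_mod_group: "0 < k \<Longrightarrow> finite (carrier (integer_mod_group k))"
  by (simp add: carrier_integer_mod_group)

lemma Z2_power_group: "group (Z2_power s)" "finite (carrier (Z2_power s))" "order (Z2_power s) = 2 ^ s"
proof -
  show "group (Z2_power s)" by (simp add: Z2_power_def)
  show "finite (carrier (Z2_power s))"
    by (auto simp: Z2_power_def finite_integer_mod_group intro!: finite_PiE)
  show "order (Z2_power s) = 2 ^ s"
    by (simp add: order_def Z2_power_def card_PiE carrier_integer_mod_group)
qed

lemma generate_superset: "A \<subseteq> generate G A"
  by (auto intro: generate.incl)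

context involution_commutator_group
begin

lemma center_commuting:
  assumes "A \<subseteq> center G" "B \<subseteq> carrier G"
  shows "commuting_sets G A B"
  using assms by (auto simp: commuting_sets_def center_def)

text \<open>\<open>Ps\<close> and \<open>Ss\<close> are the special factors listed before and after
  the hyperbolic ones, and \<open>j\<close> is the number of planes they occupy. A hyperbolic factor
  costs at most 8, of which 4 appears in the order of \<open>H\<close> and 2 in the amalgamation
  kernel, so it is enough that \<open>card\<close> holds for the special factors alone.\<close>

lemma central_product_assembly:
  fixes Ps Ss :: "'a factor list"
  assumes H: "full_subgroup H"
    and sq: "\<And>h. h \<in> H \<Longrightarrow> \<exists>w\<in>center G. h \<otimes> h = w \<otimes> w \<or> h \<otimes> h = w \<otimes> w \<otimes> c"
    and fam: "central_family G c (Ps @ Ss)" and ne: "Ps @ Ss \<noteq> []"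
    and comm: "\<And>F. F \<in> set (Ps @ Ss) \<Longrightarrow> commuting_sets G (factor_image F) H"
    and W: "group W" "finite (carrier W)" "\<psi> \<in> hom W G" "\<psi> ` carrier W \<subseteq> center G"
    and genG: "carrier G \<subseteq> generate G (H \<union> factor_union (Ps @ Ss))"
    and genZ: "center G \<subseteq> generate G (factor_union (Ps @ Ss) \<union> \<psi> ` carrier W)"
    and cardG: "4 ^ j * card H \<le> order G"
    and card: "prod_list (map (\<lambda>F. order (fst F)) (Ps @ Ss)) * order W
      \<le> 4 ^ j * card (center G) * 2 ^ (length (Ps @ Ss) - 1)"
  shows "\<exists>k Qs. hyperbolic_list k Qs \<and>
    (H \<noteq> center G \<longrightarrow> 1 \<le> k) \<and> G \<cong> central_product (map fst Ps @ Qs @ map fst Ss) \<times>\<times> W"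
proof -
  obtain k Fs where "hyperbolic_factors H k Fs" using hyperbolic_decomposition[OF H sq] by blast
  then have Fs: "hyperbolic_list k (map fst Fs)"
    "H \<noteq> center G \<longrightarrow> 1 \<le> k" "central_family G c Fs" "factor_union Fs \<subseteq> H"
    "H \<subseteq> generate G (center G \<union> factor_union Fs)" "card (center G) * 4 ^ k \<le> card H"
    unfolding hyperbolic_factors_def by blast+
  have FsH: "factor_image F \<subseteq> H" if "F \<in> set Fs" for F using Fs(4) that by (auto simp: factor_union_def)
  have c1: "commuting_sets G (factor_image F) (factor_image F')" if "F \<in> set (Ps @ Ss)" "F' \<in> set Fs" for F F'
    using comm[OF that(1)] FsH[OF that(2)] by (auto simp: commuting_sets_def)
  have fam': "central_family G c (Ps @ Fs @ Ss)"
    using fam Fs(3) c1 commuting_sets_sym[OF c1]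
    by (auto simp: central_family_def sorted_wrt_append)
  have "length (map fst Fs) = k" using Fs(1) by (elim disjE) auto
  then have len: "length Fs = k" by simp
  have imG: "factor_image F \<subseteq> carrier G" if "F \<in> set (Ps @ Fs @ Ss)" for F
    using fam' that by (fastforce simp: central_family_def central_factor_def factor_image_def dest: hom_in_carrier)
  define A where "A = factor_union (Ps @ Fs @ Ss) \<union> \<psi> ` carrier W"
  have AG: "A \<subseteq> carrier G"
    using imG W(4) center_closed by (auto simp: A_def factor_union_def)
  have sub: "subgroup (generate G A) G" using AG by (rule generate_is_subgroup)
  have "center G \<subseteq> generate G A"
    using genZ mono_generate[of "factor_union (Ps @ Ss) \<union> \<psi> ` carrier W" A] by (auto simp: A_def)
  then have "generate G (center G \<union> factor_union Fs) \<subseteq> generate G A"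
    by (intro generate_subgroup_incl[OF _ sub]) (auto simp: A_def intro: generate.incl)
  then have "generate G (H \<union> factor_union (Ps @ Ss)) \<subseteq> generate G A"
    using Fs(5) by (intro generate_subgroup_incl[OF _ sub]) (auto simp: A_def intro: generate.incl)
  then have gen: "carrier G = generate G A" using genG generate_incl[OF AG] by auto
  have iso: "G \<cong> central_product (map fst (Ps @ Fs @ Ss)) \<times>\<times> W"
  proof (rule central_product_iso[OF finite_carrier c_closed c_neq_one c_square fam' _ W(1-3)])
    show "\<psi> w \<otimes> x = x \<otimes> \<psi> w" if "w \<in> carrier W" "x \<in> carrier G" for w x
      using W(4) that by (auto simp: center_def)
    show "carrier G = generate G ((\<Union>F\<in>set (Ps @ Fs @ Ss). factor_image F) \<union> \<psi> ` carrier W)"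
      using gen by (simp only: A_def factor_union_def)
    have set: "set (map fst Fs) \<subseteq> {D8, Q8}"
      using Fs(1) by (elim disjE conjE) (auto simp del: set_map)
    have "order (fst F) \<le> 8" if "F \<in> set Fs" for F
    proof -
      have "fst F = D8 \<or> fst F = Q8" using set that by auto
      then show ?thesis using order_D8 order_Q8 by auto
    qed
    then have "x \<le> 8" if "x \<in> set (map (\<lambda>F. order (fst F)) Fs)" for x using that by auto
    then have "prod_list (map (\<lambda>F. order (fst F)) Fs) \<le> 8 ^ length (map (\<lambda>F. order (fst F)) Fs)"
      by (rule prod_list_le_power)
    then have "prod_list (map (\<lambda>F. order (fst F)) Fs) \<le> 8 ^ k" by (simp add: len)
    then have "prod_list (map (\<lambda>F. order (fst F)) (Ps @ Fs @ Ss)) * order W \<le>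
        8 ^ k * (prod_list (map (\<lambda>F. order (fst F)) (Ps @ Ss)) * order W)"
      by (simp add: mult.commute mult.left_commute)
    also have "\<dots> \<le> 8 ^ k * (4 ^ j * card (center G) * 2 ^ (length (Ps @ Ss) - 1))"
      using card by (rule mult_le_mono2)
    also have "(8::nat) ^ k = 4 ^ k * 2 ^ k" by (simp flip: power_mult_distrib)
    also have "4 ^ k * 2 ^ k * (4 ^ j * card (center G) * 2 ^ (length (Ps @ Ss) - 1)) =
        4 ^ j * (card (center G) * 4 ^ k) * 2 ^ (k + (length (Ps @ Ss) - 1))"
      by (simp add: power_add)
    also have "\<dots> \<le> 4 ^ j * card H * 2 ^ (k + (length (Ps @ Ss) - 1))"
      using Fs(6) by simp
    also have "\<dots> \<le> order G * 2 ^ (k + (length (Ps @ Ss) - 1))" using cardG by simp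
    \<comment> \<open>The list of special factors is nonempty, so the truncated subtraction is
      exact.\<close>
    also have "k + (length (Ps @ Ss) - 1) = length (Ps @ Fs @ Ss) - 1"
    proof -
      have "0 < length (Ps @ Ss)" using ne by (metis length_greater_0_conv)
      then show ?thesis by (simp only: length_append len)
    qed
    finally show "prod_list (map (\<lambda>F. order (fst F)) (Ps @ Fs @ Ss)) * order W
        \<le> order G * 2 ^ (length (Ps @ Fs @ Ss) - 1)" .
  qed (use ne in auto)
  show ?thesis
    using iso Fs(1,2) by (intro exI[of _ k] exI[of _ "map fst Fs"]) simp
qed

end

text \<open>The decomposition of the centre is recorded by generators together with a lower bound
  for its order, the form in which the count uses it. The two conditions force \<open>\<psi>\<close>
  to be injective and the product to be direct.\<close>

locale split_center_group = involution_commutator_group G c for G (structure) and c +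
  fixes n m s :: nat and z1 z2 :: 'a and \<psi> :: "(nat \<Rightarrow> int) \<Rightarrow> 'a"
  assumes nm: "m \<le> n" "1 \<le> m"
    and z1: "z1 \<in> center G" "z1 [^] (2 ^ n :: nat) = \<one>" "z1 [^] (2 ^ (n - 1) :: nat) = c"
    and z2: "z2 \<in> center G" "z2 [^] (2 ^ m :: nat) = \<one>"
    and \<psi>: "\<psi> \<in> hom (Z2_power s) G" "\<psi> ` carrier (Z2_power s) \<subseteq> center G"
    and center_generate: "center G \<subseteq> generate G ({z1, z2} \<union> \<psi> ` carrier (Z2_power s))"
    and card_center: "2 ^ (n + m + s) \<le> card (center G)"
begin

abbreviation E :: "'a set"
  where "E \<equiv> \<psi> ` carrier (Z2_power s)"

abbreviation square_mod_c :: "'a \<Rightarrow> bool"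
  where "square_mod_c h \<equiv> \<exists>w\<in>center G. h \<otimes> h = w \<otimes> w \<or> h \<otimes> h = w \<otimes> w \<otimes> c"

lemma z_closed [simp]: "z1 \<in> carrier G" "z2 \<in> carrier G"
  using z1 z2 center_closed by auto

lemma \<psi>_closed: "E \<subseteq> carrier G"
  using \<psi>(2) center_closed by auto

lemma nat_pow_center: "z \<in> center G \<Longrightarrow> z [^] (k::nat) \<in> center G"
  using subgroup_center by (induction k) (auto simp: subgroup.one_closed subgroup.m_closed one_center)

lemma center_le_generateI:
  assumes "A \<subseteq> carrier G" "B \<subseteq> A" "z1 \<in> generate G B" "z2 \<in> generate G B"
    and "E \<subseteq> A"
  shows "center G \<subseteq> generate G A"
proof -
  have "generate G B \<subseteq> generate G A" using assms(2) by (rule mono_generate)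
  then have "{z1, z2} \<union> E \<subseteq> generate G A"
    using assms(3-5) generate_superset[of A] by blast
  then have "generate G ({z1, z2} \<union> E) \<subseteq> generate G A"
    using assms(1) by (intro generate_subgroup_incl generate_is_subgroup)
  then show ?thesis using center_generate by auto
qed

text \<open>Supplies the direct factor for the shapes in which no plane absorbs the cyclic group of
  order 2^m.\<close>

lemma Z_m_power_factor:
  assumes w: "w \<in> center G" "w [^] (2 ^ m :: nat) = \<one>"
  defines "W \<equiv> integer_mod_group (2 ^ m) \<times>\<times> Z2_power s"
    and "\<theta> \<equiv> \<lambda>(x, y). w [^] (x::int) \<otimes> \<psi> y"
  shows "group W" "finite (carrier W)" "order W = 2 ^ m * 2 ^ s" "\<theta> \<in> hom W G" "\<theta> ` carrier W \<subseteq> center G"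
    "w \<in> \<theta> ` carrier W" "E \<subseteq> \<theta> ` carrier W"
proof -
  have wG: "w \<in> carrier G" using w center_closed by simp
  have m2: "1 < (2::int) ^ m" using nm by (intro one_less_power) auto
  show "group W" unfolding W_def by (intro DirProd_group Z2_power_group) simp
  show "finite (carrier W)"
    using Z2_power_group(2)[of s] by (simp add: W_def finite_integer_mod_group)
  show "order W = 2 ^ m * 2 ^ s"
    using Z2_power_group(3)[of s] order_integer_mod_group[of "2 ^ m"]
    by (simp add: W_def order_def card_cartesian_product)
  have hw: "(\<lambda>x::int. w [^] x) \<in> hom (integer_mod_group (2 ^ m)) G"
    using wG w(2) by (rule integer_mod_group_hom)
  have wpow: "w [^] (x::int) \<in> center G" for x
  proof -
    have "subgroup (center G) G" by (rule subgroup_center)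
    then show ?thesis using w(1) by (rule subgroup_int_pow_closed)
  qed
  show "\<theta> \<in> hom W G" unfolding \<theta>_def W_def
    using hw \<psi>(1) by (rule DirProd_hom) (rule center_commuting, use wpow \<psi>_closed in auto)
  show "\<theta> ` carrier W \<subseteq> center G"
    using wpow \<psi>(2) by (auto simp: \<theta>_def W_def intro!: subgroup.m_closed[OF subgroup_center])
  interpret Z: group "Z2_power s" by (rule Z2_power_group)
  have one: "\<psi> \<one>\<^bsub>Z2_power s\<^esub> = \<one>" by (rule hom_one[OF \<psi>(1) Z2_power_group(1) is_group])
  show "w \<in> \<theta> ` carrier W"
    using m2 wG one by (intro image_eqI[of _ _ "(1, \<one>\<^bsub>Z2_power s\<^esub>)"]) (auto simp: \<theta>_def W_def int_pow_1 carrier_integer_mod_group)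
  show "E \<subseteq> \<theta> ` carrier W"
  proof
    fix u assume "u \<in> E"
    then obtain y where "y \<in> carrier (Z2_power s)" "u = \<psi> y" by blast
    then show "u \<in> \<theta> ` carrier W"
      using \<psi>_closed by (intro image_eqI[of _ _ "(0, y)"]) (auto simp: \<theta>_def W_def)
  qed
qed

section \<open>Sufficient conditions for the individual shapes\<close>

lemma Cyc_z1_factor:
  "\<exists>h. factor_spanned G c (Cyc (2 ^ n), h) {z1}"
  using z1 nm c_neq_one by (intro Cyc_factor) auto

lemma generate_z1_center: "generate G {z1} \<subseteq> center G"
  by (rule generate_subgroup_incl[OF _ subgroup_center]) (use z1 in simp)

text \<open>No special plane is needed here, so all of \<open>G\<close> is split into hyperbolic
  planes (\<open>j = 0\<close>); the cyclic factor provides \<open>z1\<close>, and the direct factor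
  provides the rest of the centre.\<close>

lemma shape_IX:
  assumes nonab: "center G \<noteq> carrier G" and sq: "\<And>h. h \<in> carrier G \<Longrightarrow> square_mod_c h"
  shows "\<exists>k\<ge>1. G \<cong> central_product (replicate k D8 @ [Cyc (2 ^ n)]) \<times>\<times> integer_mod_group (2 ^ m) \<times>\<times> Z2_power s
    \<or> G \<cong> central_product (Q8 # replicate (k - 1) D8 @ [Cyc (2 ^ n)]) \<times>\<times> integer_mod_group (2 ^ m) \<times>\<times> Z2_power s"
proof -
  define W where "W = integer_mod_group (2 ^ m) \<times>\<times> Z2_power s"
  define \<theta> where "\<theta> = (\<lambda>(x, y). z2 [^] (x::int) \<otimes> \<psi> y)"
  note W = Z_m_power_factor[OF z2, folded W_def \<theta>_def]
  obtain h where h: "central_factor G c (Cyc (2 ^ n), h)" "factor_image (Cyc (2 ^ n), h) = generate G {z1}"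
    using Cyc_z1_factor by blast
  let ?Nil = "[] :: 'a factor list"
  have "\<exists>k Qs. hyperbolic_list k Qs \<and>
    (carrier G \<noteq> center G \<longrightarrow> 1 \<le> k) \<and>
    G \<cong> central_product (map fst ?Nil @ Qs @ map fst [(Cyc (2 ^ n), h)]) \<times>\<times> W"
  proof (rule central_product_assembly[OF full_subgroup_carrier sq _ _ _ W(1,2,4,5), where j = 0])
    show "central_family G c (?Nil @ [(Cyc (2 ^ n), h)])" using h by (simp add: central_family_def)
    show "commuting_sets G (factor_image F) (carrier G)" if "F \<in> set (?Nil @ [(Cyc (2 ^ n), h)])" for F
      using that h(2) generate_z1_center by (auto intro!: center_commuting)
    show "carrier G \<subseteq> generate G (carrier G \<union> factor_union (?Nil @ [(Cyc (2 ^ n), h)]))"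
      by (auto intro: generate.incl)
    show "center G \<subseteq> generate G (factor_union (?Nil @ [(Cyc (2 ^ n), h)]) \<union> \<theta> ` carrier W)"
    proof (rule center_le_generateI)
      let ?A = "factor_union (?Nil @ [(Cyc (2 ^ n), h)]) \<union> \<theta> ` carrier W"
      show "?A \<subseteq> carrier G" using W(5) generate_z1_center center_closed by (auto simp: h(2))
      have "z1 \<in> ?A" by (simp add: h(2) generate.incl)
      then show "z1 \<in> generate G ?A" by (rule generate.incl)
      have "z2 \<in> ?A" using W(6) by blast
      then show "z2 \<in> generate G ?A" by (rule generate.incl)
      show "E \<subseteq> ?A" using W(7) by blast
    qed simp
    have "order (Cyc (2 ^ n)) \<le> 2 ^ n" by (rule order_Cyc) simp
    then have "order (Cyc (2 ^ n)) * order W \<le> 2 ^ n * (2 ^ m * 2 ^ s)"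
      using W(3) by simp
    also have "\<dots> \<le> card (center G)" using card_center by (simp add: power_add mult.assoc)
    finally show "prod_list (map (\<lambda>F. order (fst F)) (?Nil @ [(Cyc (2 ^ n), h)])) * order W
      \<le> 4 ^ 0 * card (center G) * 2 ^ (length (?Nil @ [(Cyc (2 ^ n), h)]) - 1)" by simp
  qed (simp_all add: order_def)
  then show ?thesis using nonab by (auto simp: W_def)
qed

text \<open>The common part of the shapes with one special plane, spanned by \<open>a\<close> and
  \<open>b\<close>. In the bound \<open>card\<close> the factor 4 stands for this plane and each
  member of \<open>Ss\<close> brings one more amalgamation.\<close>

lemma shape_hyperbolic:
  fixes Ss :: "'a factor list"
  assumes ab: "a \<in> carrier G" "b \<in> carrier G" "noncomm a b"
    and sq: "\<And>h. h \<in> orthogonal (carrier G) a b \<Longrightarrow> square_mod_c h"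
    and F: "central_factor G c F" "factor_image F = generate G {a, b, c}"
    and Ss: "Ss = [] \<or> (\<exists>h. Ss = [(Cyc (2 ^ n), h)] \<and> factor_spanned G c (Cyc (2 ^ n), h) {z1})"
    and W: "group W" "finite (carrier W)" "\<theta> \<in> hom W G" "\<theta> ` carrier W \<subseteq> center G"
    and genZ: "center G \<subseteq> generate G ({a, b, c} \<union> factor_union Ss \<union> \<theta> ` carrier W)"
    and card: "order (fst F) * prod_list (map (\<lambda>F. order (fst F)) Ss) * order W
      \<le> 4 * 2 ^ (n + m + s) * 2 ^ length Ss"
  shows "\<exists>k Qs. hyperbolic_list k Qs \<and>
    G \<cong> central_product (fst F # Qs @ map fst Ss) \<times>\<times> W"
proof -
  let ?O = "orthogonal (carrier G) a b"
  note full = full_subgroup_carrier ab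
  have abc: "{a, b, c} \<subseteq> carrier G" using ab by simp
  have SsZ: "factor_union Ss \<subseteq> center G" using Ss generate_z1_center by auto
  have FG: "factor_image F \<subseteq> carrier G" unfolding F(2) using abc by (rule generate_incl)
  have "\<exists>k Qs. hyperbolic_list k Qs \<and>
    (?O \<noteq> center G \<longrightarrow> 1 \<le> k) \<and> G \<cong> central_product (map fst [F] @ Qs @ map fst Ss) \<times>\<times> W"
  proof (rule central_product_assembly[OF full_subgroup_orthogonal[OF full] sq _ _ _ W, where j = 1])
    show "central_family G c ([F] @ Ss)"
      using F Ss FG generate_z1_center commuting_sets_sym[OF center_commuting[OF _ FG]]
      by (auto simp: central_family_def)
    show "commuting_sets G (factor_image F') ?O" if "F' \<in> set ([F] @ Ss)" for F'
    proof (cases "F' = F")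
      case True
      then show ?thesis using commuting_sets_orthogonal[OF full_subgroup_carrier ab(1,2)] F(2) by simp
    next
      case False
      then have "factor_image F' \<subseteq> center G" using that SsZ by (auto simp: factor_union_def)
      then show ?thesis by (rule center_commuting) (auto simp: orthogonal_def)
    qed
    show "carrier G \<subseteq> generate G (?O \<union> factor_union ([F] @ Ss))"
      by (rule generate_hyperbolic[OF full]) (auto simp: F(2) intro: generate.incl)
    have G: "factor_union ([F] @ Ss) \<union> \<theta> ` carrier W \<subseteq> carrier G"
      using FG SsZ W(4) center_closed by auto
    have "generate G ({a, b, c} \<union> factor_union Ss \<union> \<theta> ` carrier W) \<subseteq>
        generate G (factor_union ([F] @ Ss) \<union> \<theta> ` carrier W)"
      by (rule mono_generate) (auto simp: F(2) intro: generate.incl)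
    then show "center G \<subseteq> generate G (factor_union ([F] @ Ss) \<union> \<theta> ` carrier W)"
      using genZ by blast
    show "4 ^ 1 * card ?O \<le> order G" using card_orthogonal[OF full] by (simp add: order_def)
    have "4 * 2 ^ (n + m + s) * 2 ^ length Ss \<le> 4 * card (center G) * 2 ^ length Ss"
      using card_center by simp
    with card have "order (fst F) * prod_list (map (\<lambda>F. order (fst F)) Ss) * order W
      \<le> 4 * card (center G) * 2 ^ length Ss" by (rule le_trans)
    then show "prod_list (map (\<lambda>F. order (fst F)) ([F] @ Ss)) * order W
      \<le> 4 ^ 1 * card (center G) * 2 ^ (length ([F] @ Ss) - 1)" by simp
  qed simp_all
  then show ?thesis by auto
qed

text \<open>The plane absorbs both \<open>z1\<close> and \<open>z2\<close>, so only an elementary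
  abelian group remains as direct factor.\<close>

lemma shape_I:
  assumes ab: "a \<in> carrier G" "b \<in> carrier G" "noncomm a b"
    and sq: "\<And>h. h \<in> orthogonal (carrier G) a b \<Longrightarrow> square_mod_c h"
    and an: "a [^] (2 ^ n :: nat) = c" and bm: "b [^] (2 ^ (m + 1) :: nat) = \<one>"
    and gen: "z1 \<in> generate G {a, b, c}" "z2 \<in> generate G {a, b, c}"
  shows "\<exists>k Qs. hyperbolic_list k Qs \<and>
    G \<cong> central_product (M2 (n + 1) (m + 1) # Qs) \<times>\<times> Z2_power s"
proof -
  have "\<exists>h. factor_spanned G c (M2 (n + 1) (m + 1), h) {a, b, c}"
    using ab an bm nm noncomm_swap[OF ab(1,2)] c_square c_neq_one
    by (intro M2_factor) (auto simp: numeral_2_eq_2)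
  then obtain h where h: "central_factor G c (M2 (n + 1) (m + 1), h)"
    "factor_image (M2 (n + 1) (m + 1), h) = generate G {a, b, c}" by blast
  let ?Nil = "[] :: 'a factor list"
  have Z: "center G \<subseteq> generate G ({a, b, c} \<union> factor_union ?Nil \<union> E)"
    by (rule center_le_generateI[of _ "{a, b, c}"]) (use ab gen \<psi>_closed in auto)
  have "order (M2 (n + 1) (m + 1)) * 2 ^ s \<le> 2 ^ (n + 1 + (m + 1)) * 2 ^ s"
    using order_M2[of "n + 1" "m + 1"] nm by (intro mult_le_mono1) simp
  then have ord: "order (M2 (n + 1) (m + 1)) * order (Z2_power s) \<le> 4 * 2 ^ (n + m + s)"
    by (simp add: Z2_power_group(3) power_add)
  have "\<exists>k Qs. hyperbolic_list k Qs \<and>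
    G \<cong> central_product (fst (M2 (n + 1) (m + 1), h) # Qs @ map fst ?Nil) \<times>\<times> Z2_power s"
    by (rule shape_hyperbolic[OF ab sq h _ Z2_power_group(1,2) \<psi> Z]) (use ord in simp_all)
  then show ?thesis by simp
qed

text \<open>The plane absorbs \<open>z1\<close> up to the central element \<open>w\<close>, whose
  cyclic group becomes a direct factor.\<close>

lemma shape_V:
  assumes ab: "a \<in> carrier G" "b \<in> carrier G" "noncomm a b"
    and sq: "\<And>h. h \<in> orthogonal (carrier G) a b \<Longrightarrow> square_mod_c h"
    and an: "a [^] (2 ^ n :: nat) = c" and b2: "b \<otimes> b = \<one>"
    and w: "w \<in> center G" "w [^] (2 ^ m :: nat) = \<one>"
    and gen: "z1 \<in> generate G {a, b, c, w}" "z2 \<in> generate G {a, b, c, w}"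
  shows "\<exists>k Qs. hyperbolic_list k Qs \<and>
    G \<cong> central_product (M2 (n + 1) 1 # Qs) \<times>\<times> integer_mod_group (2 ^ m) \<times>\<times> Z2_power s"
proof -
  define W where "W = integer_mod_group (2 ^ m) \<times>\<times> Z2_power s"
  define \<theta> where "\<theta> = (\<lambda>(x, y). w [^] (x::int) \<otimes> \<psi> y)"
  note W = Z_m_power_factor[OF w, folded W_def \<theta>_def]
  have "\<exists>h. factor_spanned G c (M2 (n + 1) 1, h) {a, b, c}"
    using ab an b2 nm noncomm_swap[OF ab(1,2)] c_square c_neq_one
    by (intro M2_factor) (auto simp: numeral_2_eq_2)
  then obtain h where h: "central_factor G c (M2 (n + 1) 1, h)"
    "factor_image (M2 (n + 1) 1, h) = generate G {a, b, c}" by blast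
  let ?Nil = "[] :: 'a factor list"
  have Z: "center G \<subseteq> generate G ({a, b, c} \<union> factor_union ?Nil \<union> \<theta> ` carrier W)"
  proof (rule center_le_generateI[of _ "{a, b, c, w}"])
    show "{a, b, c} \<union> factor_union ?Nil \<union> \<theta> ` carrier W \<subseteq> carrier G"
      using ab W(5) center_closed by auto
    show "{a, b, c, w} \<subseteq> {a, b, c} \<union> factor_union ?Nil \<union> \<theta> ` carrier W" using W(6) by blast
    show "E \<subseteq> {a, b, c} \<union> factor_union ?Nil \<union> \<theta> ` carrier W"
      using W(7) by blast
  qed (rule gen)+
  have "order (M2 (n + 1) 1) * (2 ^ m * 2 ^ s) \<le> 2 ^ (n + 1 + 1) * (2 ^ m * 2 ^ s)"
    using order_M2[of "n + 1" 1] nm by (intro mult_le_mono1) simp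
  then have ord: "order (M2 (n + 1) 1) * order W \<le> 4 * 2 ^ (n + m + s)"
    by (simp add: W(3) power_add mult.assoc)
  have "\<exists>k Qs. hyperbolic_list k Qs \<and>
    G \<cong> central_product (fst (M2 (n + 1) 1, h) # Qs @ map fst ?Nil) \<times>\<times> W"
    by (rule shape_hyperbolic[OF ab sq h _ W(1,2,4,5) Z]) (use ord in simp_all)
  then show ?thesis by (simp add: W_def)
qed

text \<open>The plane absorbs \<open>z2\<close> modulo \<open>z1\<close>. Nothing in it need be a
  root of \<open>c\<close>, so \<open>z1\<close> enters through an amalgamated cyclic
  factor.\<close>

lemma shape_VII:
  assumes ab: "a \<in> carrier G" "b \<in> carrier G" "noncomm a b"
    and sq: "\<And>h. h \<in> orthogonal (carrier G) a b \<Longrightarrow> square_mod_c h"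
    and am: "a [^] (2 ^ (m + 1) :: nat) = \<one>" and b2: "b \<otimes> b = \<one>"
    and gen: "z2 \<in> generate G {a, b, c, z1}"
  shows "\<exists>k Qs. hyperbolic_list k Qs \<and>
    G \<cong> central_product (M2_1_1 (m + 1) # Qs @ [Cyc (2 ^ n)]) \<times>\<times> Z2_power s"
proof -
  have "\<exists>h. factor_spanned G c (M2_1_1 (m + 1), h) {a, b, c}"
    using ab am b2 noncomm_swap[OF ab(1,2)] c_square c_neq_one c_central[OF ab(1)] c_central[OF ab(2)]
    by (intro M2_1_1_factor is_group) (auto simp: numeral_2_eq_2)
  then obtain h where h: "central_factor G c (M2_1_1 (m + 1), h)"
    "factor_image (M2_1_1 (m + 1), h) = generate G {a, b, c}" by blast
  obtain h' where h': "central_factor G c (Cyc (2 ^ n), h')"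
    "factor_image (Cyc (2 ^ n), h') = generate G {z1}" using Cyc_z1_factor by blast
  let ?Ss = "[(Cyc (2 ^ n), h')]"
  let ?A = "{a, b, c} \<union> factor_union ?Ss \<union> E"
  have Z: "center G \<subseteq> generate G ?A"
  proof (rule center_le_generateI[of _ "{a, b, c, z1}"])
    show "?A \<subseteq> carrier G"
      using ab generate_z1_center \<psi>_closed center_closed by (auto simp: h'(2))
    show "{a, b, c, z1} \<subseteq> ?A" by (auto simp: h'(2) intro: generate.incl)
    show "E \<subseteq> ?A" by blast
  qed (use gen in \<open>auto intro: generate.incl\<close>)
  have "order (M2_1_1 (m + 1)) * order (Cyc (2 ^ n)) * 2 ^ s \<le> 2 ^ (m + 1 + 2) * 2 ^ n * 2 ^ s"
    using order_M2_1_1[of "m + 1"] order_Cyc[of "2 ^ n"] by (intro mult_le_mono) auto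
  then have ord: "order (M2_1_1 (m + 1)) * order (Cyc (2 ^ n)) * order (Z2_power s) \<le> 8 * 2 ^ (n + m + s)"
    by (simp add: Z2_power_group(3) power_add mult.commute mult.left_commute)
  have "\<exists>k Qs. hyperbolic_list k Qs \<and>
    G \<cong> central_product (fst (M2_1_1 (m + 1), h) # Qs @ map fst ?Ss) \<times>\<times> Z2_power s"
    by (rule shape_hyperbolic[OF ab sq h _ Z2_power_group(1,2) \<psi> Z]) (use ord h' in simp_all)
  then show ?thesis by simp
qed

text \<open>Two orthogonal planes: the first has a generator whose 2^n-th power is \<open>c\<close>,
  the second one of order dividing 2^(m+1), and together they absorb \<open>z1\<close> and
  \<open>z2\<close>.\<close>

lemma shape_III:
  assumes ab: "a \<in> carrier G" "b \<in> carrier G" "noncomm a b"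
    and xy: "x \<in> orthogonal (carrier G) a b" "y \<in> orthogonal (carrier G) a b" "noncomm x y"
    and sq: "\<And>h. h \<in> orthogonal (orthogonal (carrier G) a b) x y \<Longrightarrow> square_mod_c h"
    and an: "a [^] (2 ^ n :: nat) = c" and b2: "b \<otimes> b = \<one>"
    and xm: "x [^] (2 ^ (m + 1) :: nat) = \<one>" and y2: "y \<otimes> y = \<one>"
    and gen: "z1 \<in> generate G {a, b, c, x, y}" "z2 \<in> generate G {a, b, c, x, y}"
  shows "\<exists>k Qs. hyperbolic_list k Qs \<and>
    G \<cong> central_product (M2 (n + 1) 1 # M2_1_1 (m + 1) # Qs) \<times>\<times> Z2_power s"
proof -
  let ?O = "orthogonal (carrier G) a b"
  let ?H = "orthogonal ?O x y"
  note full = full_subgroup_carrier ab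
  note fullO = full_subgroup_orthogonal[OF full] xy
  have xyG: "x \<in> carrier G" "y \<in> carrier G" using xy by (auto simp: orthogonal_def)
  have "\<exists>h. factor_spanned G c (M2 (n + 1) 1, h) {a, b, c}"
    using ab an b2 nm noncomm_swap[OF ab(1,2)] c_square c_neq_one
    by (intro M2_factor) (auto simp: numeral_2_eq_2)
  then obtain h where h: "central_factor G c (M2 (n + 1) 1, h)"
    "factor_image (M2 (n + 1) 1, h) = generate G {a, b, c}" by blast
  have "\<exists>h. factor_spanned G c (M2_1_1 (m + 1), h) {x, y, c}"
    using xyG xy(3) xm y2 noncomm_swap[OF xyG] c_square c_neq_one c_central[OF xyG(1)] c_central[OF xyG(2)]
    by (intro M2_1_1_factor is_group) (auto simp: numeral_2_eq_2)
  then obtain h' where h': "central_factor G c (M2_1_1 (m + 1), h')"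
    "factor_image (M2_1_1 (m + 1), h') = generate G {x, y, c}" by blast
  define Ps where "Ps = [(M2 (n + 1) 1, h), (M2_1_1 (m + 1), h')]"
  let ?Nil = "[] :: 'a factor list"
  have U: "factor_union Ps = generate G {a, b, c} \<union> generate G {x, y, c}"
    by (simp only: Ps_def factor_union_simps h(2) h'(2) Un_empty_right)
  have "generate G {x, y, c} \<subseteq> ?O"
    using xy c_center full_subgroupD(3)[OF fullO(1)]
    by (intro generate_subgroup_incl full_subgroupD(1)[OF fullO(1)]) auto
  then have "commuting_sets G (generate G {a, b, c}) (generate G {x, y, c})"
    by (intro commuting_sets_orthogonal[OF full(1-3)]) auto
  then have fam: "central_family G c (Ps @ ?Nil)"
    using h h' by (simp add: central_family_def Ps_def)
  have "\<exists>k Qs. hyperbolic_list k Qs \<and>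
    (?H \<noteq> center G \<longrightarrow> 1 \<le> k) \<and>
    G \<cong> central_product (map fst Ps @ Qs @ map fst ?Nil) \<times>\<times> Z2_power s"
  proof (rule central_product_assembly[OF full_subgroup_orthogonal[OF fullO] sq fam _ _ Z2_power_group(1,2) \<psi>,
        where j = 2])
    show "commuting_sets G (factor_image F) ?H" if "F \<in> set (Ps @ ?Nil)" for F
    proof -
      have "commuting_sets G (generate G {a, b, c}) ?H"
        by (rule commuting_sets_orthogonal[OF full(1-3)]) (auto simp: orthogonal_def)
      moreover have "commuting_sets G (generate G {x, y, c}) ?H"
        by (rule commuting_sets_orthogonal[OF fullO(1-3)]) auto
      ultimately show ?thesis using that h h' by (auto simp: Ps_def)
    qed
    let ?A = "?H \<union> factor_union (Ps @ ?Nil)"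
    have "a \<in> ?A" "b \<in> ?A" "x \<in> ?A" "y \<in> ?A" by (auto simp: U intro: generate.incl)
    then have A: "a \<in> generate G ?A" "b \<in> generate G ?A" "x \<in> generate G ?A" "y \<in> generate G ?A"
      "?H \<subseteq> generate G ?A"
      using generate_superset[of ?A] by blast+
    have "?O \<subseteq> generate G ?A" using A by (intro generate_hyperbolic[OF fullO])
    then show "carrier G \<subseteq> generate G ?A" using A by (intro generate_hyperbolic[OF full])
    let ?B = "factor_union (Ps @ ?Nil) \<union> E"
    have B: "?B \<subseteq> carrier G"
      using \<psi>_closed generate_incl[of "{a, b, c}"] generate_incl[of "{x, y, c}"] ab xyG by (auto simp: U)
    have "{a, b, c, x, y} \<subseteq> ?B" by (auto simp: U intro: generate.incl)
    with B show "center G \<subseteq> generate G ?B"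
      by (rule center_le_generateI) (use gen in auto)
    have "4 * (4 * card ?H) \<le> 4 * card ?O" using card_orthogonal[OF fullO] by simp
    also have "\<dots> \<le> order G" using card_orthogonal[OF full] by (simp add: order_def)
    finally show "4 ^ 2 * card ?H \<le> order G" by simp
    have "order (M2 (n + 1) 1) * order (M2_1_1 (m + 1)) * 2 ^ s \<le> 2 ^ (n + 1 + 1) * 2 ^ (m + 1 + 2) * 2 ^ s"
      using order_M2_1_1[of "m + 1"] order_M2[of "n + 1" 1] nm by (intro mult_le_mono) auto
    \<comment> \<open>32 is 4^2 for the two planes times 2 for the single amalgamation between their
      factors.\<close>
    also have "\<dots> = 32 * 2 ^ (n + m + s)" by (simp add: power_add)
    also have "\<dots> \<le> 32 * card (center G)" using card_center by simp
    finally show "prod_list (map (\<lambda>F. order (fst F)) (Ps @ ?Nil)) * order (Z2_power s)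
      \<le> 4 ^ 2 * card (center G) * 2 ^ (length (Ps @ ?Nil) - 1)"
      using Z2_power_group(3)[of s] by (simp add: Ps_def)
  qed (simp_all add: Ps_def)
  then show ?thesis by (auto simp: Ps_def)
qed

end

section \<open>The case distinction\<close>

lemma (in split_center_group) z_commute: "z1 [^] (i::nat) \<otimes> z2 [^] (j::nat) = z2 [^] j \<otimes> z1 [^] i"
  using nat_pow_center[OF z1(1), of i] by (simp add: center_def)

lemma (in split_center_group) z_mult:
  "z1 [^] (i::nat) \<otimes> z2 [^] (j::nat) \<otimes> (z1 [^] (i'::nat) \<otimes> z2 [^] (j'::nat)) = z1 [^] (i + i') \<otimes> z2 [^] (j + j')"
proof -
  have "z1 [^] i \<otimes> z2 [^] j \<otimes> (z1 [^] i' \<otimes> z2 [^] j') = z1 [^] i \<otimes> (z2 [^] j \<otimes> z1 [^] i') \<otimes> z2 [^] j'"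
    by (simp add: m_assoc)
  also have "z2 [^] j \<otimes> z1 [^] i' = z1 [^] i' \<otimes> z2 [^] j" by (simp only: z_commute)
  also have "z1 [^] i \<otimes> (z1 [^] i' \<otimes> z2 [^] j) \<otimes> z2 [^] j' = z1 [^] (i + i') \<otimes> z2 [^] (j + j')"
    by (simp add: m_assoc nat_pow_mult[symmetric])
  finally show ?thesis .
qed

text \<open>\<open>independent\<close> makes the parities of the exponents well defined, and
  \<open>center_squares\<close> makes them invariant under central adjustments.\<close>

locale two_generated_squares = split_center_group G c n m s z1 z2 \<psi>
  for G (structure) and c and n m s :: nat and z1 z2 :: 'a and \<psi> :: "(nat \<Rightarrow> int) \<Rightarrow> 'a" +
  assumes squares: "h \<in> carrier G \<Longrightarrow> \<exists>(i::nat) (j::nat). h \<otimes> h = z1 [^] i \<otimes> z2 [^] j"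
    and center_squares: "w \<in> center G \<Longrightarrow> \<exists>(i::nat) (j::nat). w \<otimes> w = z1 [^] (2 * i) \<otimes> z2 [^] (2 * j)"
    and independent: "z1 [^] (i::nat) \<otimes> z2 [^] (j::nat) = z1 [^] (i'::nat) \<otimes> z2 [^] (j'::nat)
      \<Longrightarrow> even i = even i' \<and> even j = even j'"
    and nonabelian: "center G \<noteq> carrier G"
begin

definition odd1 :: "'a \<Rightarrow> bool"
  where "odd1 h \<longleftrightarrow> (\<exists>(i::nat) (j::nat). h \<otimes> h = z1 [^] i \<otimes> z2 [^] j \<and> odd i)"

definition odd2 :: "'a \<Rightarrow> bool"
  where "odd2 h \<longleftrightarrow> (\<exists>(i::nat) (j::nat). h \<otimes> h = z1 [^] i \<otimes> z2 [^] j \<and> odd j)"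

lemma odd_iff:
  assumes "h \<otimes> h = z1 [^] (i::nat) \<otimes> z2 [^] (j::nat)"
  shows "odd1 h \<longleftrightarrow> odd i" "odd2 h \<longleftrightarrow> odd j"
  using assms independent[of i j] unfolding odd1_def odd2_def by metis+

lemma center_odd:
  assumes "w \<in> center G"
  shows "\<not> odd1 w" "\<not> odd2 w"
  using center_squares[OF assms] odd_iff by fastforce+

lemma odd_mult:
  assumes g: "g \<in> carrier G" and h: "h \<in> carrier G"
  shows "odd2 (g \<otimes> h) \<longleftrightarrow> odd2 g \<noteq> odd2 h"
    and "2 \<le> n \<Longrightarrow> odd1 (g \<otimes> h) \<longleftrightarrow> odd1 g \<noteq> odd1 h"
proof -
  obtain i j :: nat where ij: "g \<otimes> g = z1 [^] i \<otimes> z2 [^] j" using squares[OF g] by blast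
  obtain i' j' :: nat where ij': "h \<otimes> h = z1 [^] i' \<otimes> z2 [^] j'" using squares[OF h] by blast
  \<comment> \<open>The commutator contributes the exponent 2^(n-1) to \<open>z1\<close> and nothing
    to \<open>z2\<close>. It therefore never affects \<open>odd2\<close>, and it affects
    \<open>odd1\<close> only for n = 1.\<close>
  define e where "e = (if noncomm g h then 2 ^ (n - 1) else 0 :: nat)"
  have e: "(if noncomm g h then c else \<one>) = z1 [^] e \<otimes> z2 [^] (0::nat)" using z1(3) by (simp add: e_def)
  have "g \<otimes> h \<otimes> (g \<otimes> h) = z1 [^] (i + i' + e) \<otimes> z2 [^] (j + j' + 0)"
    unfolding square_mult[OF g h] e ij ij' z_mult ..
  note * = odd_iff[OF this] odd_iff[OF ij] odd_iff[OF ij']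
  show "odd2 (g \<otimes> h) \<longleftrightarrow> odd2 g \<noteq> odd2 h" using * by auto
  show "odd1 (g \<otimes> h) \<longleftrightarrow> odd1 g \<noteq> odd1 h" if "2 \<le> n"
    using * that by (auto simp: e_def)
qed

text \<open>Equal commutators mean that \<open>g\<close> and \<open>h\<close> lie in the same coset
  of the centre. Within it \<open>g\<close> is chosen with both exponents of its square reduced to 0
  or 1.\<close>

definition adjusted :: "'a \<Rightarrow> 'a \<Rightarrow> bool"
  where "adjusted h g \<longleftrightarrow> g \<in> carrier G \<and>
    g \<otimes> g = z1 [^] (of_bool (odd1 h) :: nat) \<otimes> z2 [^] (of_bool (odd2 h) :: nat) \<and>
    (\<forall>x\<in>carrier G. noncomm g x \<longleftrightarrow> noncomm h x) \<and> (\<exists>w\<in>center G. h \<otimes> h = g \<otimes> g \<otimes> (w \<otimes> w))"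

lemma adjustedD:
  assumes "adjusted h g"
  shows "g \<in> carrier G" "g \<otimes> g = z1 [^] (of_bool (odd1 h) :: nat) \<otimes> z2 [^] (of_bool (odd2 h) :: nat)"
    "\<And>x. x \<in> carrier G \<Longrightarrow> noncomm g x \<longleftrightarrow> noncomm h x"
  using assms by (auto simp: adjusted_def)

lemma normalize:
  assumes h: "h \<in> carrier G"
  shows "\<exists>g. adjusted h g"
proof -
  obtain i j :: nat where ij: "h \<otimes> h = z1 [^] i \<otimes> z2 [^] j" using squares[OF h] by blast
  \<comment> \<open>Halving the exponents gives a central element whose square is the even part of
    the square of \<open>h\<close>.\<close>
  define w where "w = z1 [^] (i div 2) \<otimes> z2 [^] (j div 2)"
  have w: "w \<in> center G"
    unfolding w_def using nat_pow_center z1(1) z2(1) by (intro subgroup.m_closed[OF subgroup_center])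
  have wG: "w \<in> carrier G" using w center_closed by simp
  have iw: "inv w \<in> center G" using subgroup.m_inv_closed[OF subgroup_center w] .
  define e1 e2 :: nat where "e1 = of_bool (odd1 h)" and "e2 = of_bool (odd2 h)"
  have "i = e1 + (i div 2 + i div 2)" "j = e2 + (j div 2 + j div 2)"
  proof -
    have *: "k = of_bool (odd k) + (k div 2 + k div 2)" for k :: nat
      by (cases "even k") (auto elim!: evenE oddE)
    show "i = e1 + (i div 2 + i div 2)" "j = e2 + (j div 2 + j div 2)"
      unfolding e1_def e2_def odd_iff[OF ij] by (rule *)+
  qed
  then have "h \<otimes> h = z1 [^] (e1 + (i div 2 + i div 2)) \<otimes> z2 [^] (e2 + (j div 2 + j div 2))"
    using ij by simp
  also have "\<dots> = z1 [^] e1 \<otimes> z2 [^] e2 \<otimes> (w \<otimes> w)" by (simp only: w_def z_mult)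
  finally have hh: "h \<otimes> h = z1 [^] e1 \<otimes> z2 [^] e2 \<otimes> (w \<otimes> w)" .
  have "h \<otimes> inv w \<otimes> (h \<otimes> inv w) = h \<otimes> h \<otimes> (inv w \<otimes> inv w)"
    using square_mult[OF h, of "inv w"] center_noncomm[OF iw h] wG h by simp
  also have "inv w \<otimes> inv w = inv (w \<otimes> w)" using wG by (simp add: inv_mult_group)
  also have "h \<otimes> h \<otimes> inv (w \<otimes> w) = z1 [^] e1 \<otimes> z2 [^] e2 \<otimes> (w \<otimes> w \<otimes> inv (w \<otimes> w))"
    unfolding hh using wG by (simp only: m_assoc m_closed inv_closed nat_pow_closed z_closed)
  also have "\<dots> = z1 [^] e1 \<otimes> z2 [^] e2" using wG by simp
  finally have gg: "h \<otimes> inv w \<otimes> (h \<otimes> inv w) = z1 [^] e1 \<otimes> z2 [^] e2" .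
  have "noncomm (h \<otimes> inv w) x \<longleftrightarrow> noncomm h x" if "x \<in> carrier G" for x
    using center_noncomm[OF iw that] h wG that by (simp add: noncomm_mult_left)
  moreover have "\<exists>w'\<in>center G. h \<otimes> h = h \<otimes> inv w \<otimes> (h \<otimes> inv w) \<otimes> (w' \<otimes> w')"
    using w hh gg by metis
  ultimately have "adjusted h (h \<otimes> inv w)"
    using h wG gg unfolding adjusted_def e1_def e2_def by simp
  then show ?thesis by blast
qed

lemma square_mod_c_if_even:
  assumes h: "h \<in> carrier G" "\<not> odd2 h" "\<not> odd1 h \<or> n = 1"
  shows "square_mod_c h"
proof -
  obtain g w where g: "g \<otimes> g = z1 [^] (of_bool (odd1 h) :: nat) \<otimes> z2 [^] (of_bool (odd2 h) :: nat)"
    and w: "w \<in> center G" "h \<otimes> h = g \<otimes> g \<otimes> (w \<otimes> w)"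
    using normalize[OF h(1)] unfolding adjusted_def by blast
  have wG: "w \<otimes> w \<in> carrier G" using w center_closed by simp
  \<comment> \<open>If \<open>odd1 h\<close> holds, then n = 1, and so
    \<open>z1 = c\<close>.\<close>
  have "g \<otimes> g = \<one> \<or> g \<otimes> g = c" using g h z1(3) by auto
  then have "h \<otimes> h = w \<otimes> w \<or> h \<otimes> h = w \<otimes> w \<otimes> c"
    using w(2) wG c_central[OF wG] by auto
  then show ?thesis using w(1) by blast
qed

lemma odd2_repr: obtains u where "u \<in> carrier G" "\<And>h. h \<in> carrier G \<Longrightarrow> odd2 h \<longleftrightarrow> noncomm u h"
  using additive_functional_repr[OF full_subgroup_carrier, of odd2] odd_mult(1) center_odd(2) by blast

lemma odd1_repr:
  assumes "2 \<le> n"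
  obtains u where "u \<in> carrier G" "\<And>h. h \<in> carrier G \<Longrightarrow> odd1 h \<longleftrightarrow> noncomm u h"
  using additive_functional_repr[OF full_subgroup_carrier, of odd1] odd_mult(2)[OF _ _ assms] center_odd(1)
  by blast

lemma pow_double: "x \<in> carrier G \<Longrightarrow> x [^] (2 ^ Suc k :: nat) = (x \<otimes> x) [^] (2 ^ k :: nat)"
  using nat_pow_pow[of x 2 "2 ^ k"] by (simp add: numeral_2_eq_2)

lemma z_prod_pow: "(z1 [^] (i::nat) \<otimes> z2 [^] (j::nat)) [^] (k::nat) = z1 [^] (i * k) \<otimes> z2 [^] (j * k)"
proof (induction k)
  case (Suc k)
  then show ?case by (simp add: z_mult add.commute)
qed simp

lemma z1_pow: "2 ^ n dvd i \<Longrightarrow> z1 [^] (i::nat) = \<one>"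
  using z1(2) nat_pow_pow[of z1 "2 ^ n"] by (metis dvdE nat_pow_one z_closed(1))

lemma z2_pow: "2 ^ m dvd i \<Longrightarrow> z2 [^] (i::nat) = \<one>"
  using z2(2) nat_pow_pow[of z2 "2 ^ m"] by (metis dvdE nat_pow_one z_closed(2))

text \<open>Suppose n >= 2. If \<open>odd1\<close> and \<open>odd2\<close> both vanish, no special
  plane occurs. If only \<open>odd1\<close> is nonzero, its plane gives \<open>M2 (n + 1) 1\<close>;
  if only \<open>odd2\<close> is, it gives \<open>M2_1_1 (m + 1)\<close>. If they are equal and
  nonzero, one of these two arises, according to m < n or m = n. If they are independent, the
  representing elements \<open>u1\<close> and \<open>u2\<close> either fail to commute and span one
  plane for \<open>M2 (n + 1) (m + 1)\<close>, or they commute and belong to two orthogonal planes.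
  For n = 1 only \<open>odd2\<close> matters; if it is nonzero, the adjusted square of
  \<open>u2\<close>, which is 1 or \<open>c\<close>, chooses between \<open>M2_1_1 (m + 1)\<close>
  and \<open>M2 (n + 1) (m + 1)\<close>.\<close>

theorem classification:
  "(\<exists>k Qs. hyperbolic_list k Qs \<and> G \<cong> central_product (M2 (n + 1) (m + 1) # Qs) \<times>\<times> Z2_power s) \<or>
   (\<exists>k Qs. hyperbolic_list k Qs \<and> G \<cong> central_product (M2 (n + 1) 1 # M2_1_1 (m + 1) # Qs) \<times>\<times> Z2_power s) \<or>
   (\<exists>k Qs. hyperbolic_list k Qs \<and> G \<cong> central_product (M2 (n + 1) 1 # Qs) \<times>\<times> integer_mod_group (2 ^ m) \<times>\<times> Z2_power s) \<or>
   (\<exists>k Qs. hyperbolic_list k Qs \<and> G \<cong> central_product (M2_1_1 (m + 1) # Qs @ [Cyc (2 ^ n)]) \<times>\<times> Z2_power s) \<or>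
   (\<exists>k\<ge>1. G \<cong> central_product (replicate k D8 @ [Cyc (2 ^ n)]) \<times>\<times> integer_mod_group (2 ^ m) \<times>\<times> Z2_power s
    \<or> G \<cong> central_product (Q8 # replicate (k - 1) D8 @ [Cyc (2 ^ n)]) \<times>\<times> integer_mod_group (2 ^ m) \<times>\<times> Z2_power s)"
  (is "?I \<or> ?III \<or> ?V \<or> ?VII \<or> ?IX")
proof -
  obtain u2 where u2: "u2 \<in> carrier G" "\<And>h. h \<in> carrier G \<Longrightarrow> odd2 h \<longleftrightarrow> noncomm u2 h"
    by (rule odd2_repr) blast
  have n1: "1 \<le> n" using nm by simp
  have nS: "Suc (n - 1) = n" using n1 by simp
  show ?thesis
  proof (cases "\<forall>h\<in>carrier G. \<not> odd2 h \<and> (\<not> odd1 h \<or> n = 1)")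
    case True
    then have ?IX using nonabelian square_mod_c_if_even by (intro shape_IX) auto
    then show ?thesis by blast
  next
    case not_IX: False
    show ?thesis
    proof (cases "n = 1")
      case n: True
      then have m: "m = 1" using nm by simp
      have z1c: "z1 = c" using z1(3) n by simp
      obtain x where x: "x \<in> carrier G" "odd2 x" using not_IX n by blast
      obtain a where "adjusted x a" using normalize[OF x(1)] by blast
      note a = adjustedD[OF this]
      obtain b where "adjusted u2 b" using normalize[OF u2(1)] by blast
      note b = adjustedD[OF this]
      \<comment> \<open>The pairing of \<open>x\<close> with \<open>u2\<close> is
        \<open>odd2 x\<close>, and adjusting does not change pairings.\<close>
      have ab: "noncomm a b" using a(3) b u2 x a(1) by (metis noncomm_sym)
      have sq: "square_mod_c h" if "h \<in> orthogonal (carrier G) a b" for h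
      proof (rule square_mod_c_if_even)
        show "h \<in> carrier G" using that by (simp add: orthogonal_def)
        then show "\<not> odd2 h" using that u2(2) b(3) by (simp add: orthogonal_def noncomm_sym)
      qed (use n in simp)
      define e where "e = (of_bool (odd1 x) :: nat)"
      have aa: "a \<otimes> a = z1 [^] e \<otimes> z2" using a(2) x(2) by (simp add: e_def)
      have "(a \<otimes> a) [^] (2 ^ m :: nat) = \<one>"
        using z_prod_pow[of e 1 "2 ^ m"] z1_pow[of "e * 2 ^ m"] z2_pow[of "2 ^ m"] n m by (simp add: aa)
      then have a4: "a [^] (2 ^ (m + 1) :: nat) = \<one>" using pow_double[OF a(1), of m] by simp
      \<comment> \<open>A possible factor \<open>z1\<close> in the square of \<open>a\<close> does
        no harm, since \<open>z1 = c\<close> lies in the subgroup generated by the plane and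
        \<open>c\<close>.\<close>
      have "z2 = inv (z1 [^] e) \<otimes> (a \<otimes> a)" by (simp add: aa m_assoc[symmetric])
      moreover have "inv (z1 [^] e) \<in> generate G {a, b, c}"
        using z1c generate_m_inv_closed[of "{a, b, c}"] a(1) b(1)
        by (auto simp: e_def of_bool_def intro: generate.one generate.inv)
      ultimately have z2: "z2 \<in> generate G {a, b, c}" by (auto intro: generate.eng generate.incl)
      have "\<not> odd2 u2" using u2 by simp
      then have "b \<otimes> b = \<one> \<or> b \<otimes> b = c" using b(2) z1c by auto
      then show ?thesis
      proof
        assume bb: "b \<otimes> b = \<one>"
        have "{a, b, c, z1} = {a, b, c}" using z1c by auto
        then have ?VII using z2 by (intro shape_VII[OF a(1) b(1) ab sq a4 bb]) simp_all
        then show ?thesis by blast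
      next
        assume bb: "b \<otimes> b = c"
        \<comment> \<open>The generators change roles: \<open>b\<close> with square \<open>c\<close>
          is the one whose 2^n-th power is \<open>c\<close>, and \<open>a\<close> becomes the second
          generator.\<close>
        have ba: "noncomm b a" using ab by (simp add: noncomm_sym)
        have "orthogonal (carrier G) b a = orthogonal (carrier G) a b" by (auto simp: orthogonal_def)
        then have sq': "square_mod_c h" if "h \<in> orthogonal (carrier G) b a" for h using sq that by simp
        have bn: "b [^] (2 ^ n :: nat) = c" using bb n b(1) by (simp add: numeral_2_eq_2)
        have "{b, a, c} = {a, b, c}" by auto
        then have ?I using z2 z1c
          by (intro shape_I[OF b(1) a(1) ba sq' bn a4]) (auto intro: generate.incl)
        then show ?thesis by blast
      qed
    next
      case False
      then have n: "2 \<le> n" using nm by simp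
      obtain u1 where u1: "u1 \<in> carrier G" "\<And>h. h \<in> carrier G \<Longrightarrow> odd1 h \<longleftrightarrow> noncomm u1 h"
        using odd1_repr[OF n] by blast
      \<comment> \<open>\<open>b1\<close> and \<open>b2\<close> represent \<open>odd1\<close> and
        \<open>odd2\<close> as well, and below they serve as generators of planes: on the complement
        of a plane through \<open>b1\<close>, for instance, \<open>odd1\<close> vanishes.\<close>
      obtain b1 where "adjusted u1 b1" using normalize[OF u1(1)] by blast
      note b1 = adjustedD[OF this]
      obtain b2 where "adjusted u2 b2" using normalize[OF u2(1)] by blast
      note b2 = adjustedD[OF this]
      have nc1: "noncomm b1 h \<longleftrightarrow> odd1 h" "noncomm h b1 \<longleftrightarrow> odd1 h" if "h \<in> carrier G" for h
        using b1(3)[OF that] u1(2)[OF that] by (auto simp: noncomm_sym)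
      have nc2: "noncomm b2 h \<longleftrightarrow> odd2 h" "noncomm h b2 \<longleftrightarrow> odd2 h" if "h \<in> carrier G" for h
        using b2(3)[OF that] u2(2)[OF that] by (auto simp: noncomm_sym)
      \<comment> \<open>\<open>odd1 u1\<close> and \<open>odd2 u2\<close> are pairings of an element
        with itself; \<open>odd2 u1\<close> and \<open>odd1 u2\<close> are both the pairing of
        \<open>u1\<close> with \<open>u2\<close>.\<close>
      have self: "\<not> odd1 u1" "\<not> odd2 u2" using u1 u2 by auto
      have u12: "odd2 u1 \<longleftrightarrow> odd1 u2" using u1 u2 by (auto simp: noncomm_sym)
      have z1n: "z1 [^] (2 ^ n :: nat) = \<one>" "z2 [^] (2 ^ m :: nat) = \<one>" using z1 z2 by auto
      have split: "z = inv w \<otimes> (w \<otimes> z)" "w = w \<otimes> z \<otimes> inv z"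
        if "z \<in> carrier G" "w \<in> carrier G" for w z
        using that by (simp_all add: m_assoc m_assoc[symmetric])
      \<comment> \<open>Over the field with two elements, two functionals are dependent exactly if
        one of them is zero or they are equal.\<close>
      consider (eq2) "\<And>h. h \<in> carrier G \<Longrightarrow> \<not> odd2 h" | (eq1) "\<And>h. h \<in> carrier G \<Longrightarrow> \<not> odd1 h"
        | (eq12) "\<And>h. h \<in> carrier G \<Longrightarrow> odd1 h \<longleftrightarrow> odd2 h"
        | (indep) x y d where "x \<in> carrier G" "odd1 x" "y \<in> carrier G" "odd2 y" "d \<in> carrier G" "odd1 d \<noteq> odd2 d"
        by blast
      then show ?thesis
      proof cases
        case eq2
        then obtain x where x: "x \<in> carrier G" "odd1 x" using not_IX by blast
        obtain a where "adjusted x a" using normalize[OF x(1)] by blast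
        note a = adjustedD[OF this]
        have aa: "a \<otimes> a = z1" using a(2) x eq2 by simp
        have ab: "noncomm a b1" using a(3)[OF b1(1)] nc1(2)[OF x(1)] x(2) by simp
        have bb: "b1 \<otimes> b1 = \<one>" using b1(2) self eq2[OF u1(1)] by simp
        have an: "a [^] (2 ^ n :: nat) = c" using pow_double[OF a(1), of "n - 1"] z1(3) by (simp only: nS aa)
        have sq: "square_mod_c h" if "h \<in> orthogonal (carrier G) a b1" for h
          using that eq2 nc1 by (intro square_mod_c_if_even) (auto simp: orthogonal_def)
        have "z1 \<in> generate G {a, b1, c, z2}"
          unfolding aa[symmetric] by (intro generate.eng generate.incl) auto
        then have ?V by (intro shape_V[OF a(1) b1(1) ab sq an bb z2]) (auto intro: generate.incl)
        then show ?thesis by blast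
      next
        case eq1
        then obtain x where x: "x \<in> carrier G" "odd2 x" using not_IX by blast
        obtain a where "adjusted x a" using normalize[OF x(1)] by blast
        note a = adjustedD[OF this]
        have aa: "a \<otimes> a = z2" using a(2) x eq1 by simp
        have ab: "noncomm a b2" using a(3)[OF b2(1)] nc2(2)[OF x(1)] x(2) by simp
        have bb: "b2 \<otimes> b2 = \<one>" using b2(2) self eq1[OF u2(1)] by simp
        have am: "a [^] (2 ^ (m + 1) :: nat) = \<one>" using pow_double[OF a(1), of m] z1n by (simp add: aa)
        have sq: "square_mod_c h" if "h \<in> orthogonal (carrier G) a b2" for h
          using that eq1 nc2 by (intro square_mod_c_if_even) (auto simp: orthogonal_def)
        have "z2 \<in> generate G {a, b2, c, z1}"
          unfolding aa[symmetric] by (intro generate.eng generate.incl) auto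
        then have ?VII by (intro shape_VII[OF a(1) b2(1) ab sq am bb])
        then show ?thesis by blast
      next
        case eq12
        then obtain x where x: "x \<in> carrier G" "odd1 x" "odd2 x" using not_IX by blast
        obtain a where "adjusted x a" using normalize[OF x(1)] by blast
        note a = adjustedD[OF this]
        have aa: "a \<otimes> a = z1 \<otimes> z2" using a(2) x by simp
        have ab: "noncomm a b1" using a(3)[OF b1(1)] nc1(2)[OF x(1)] x(2) by simp
        have bb: "b1 \<otimes> b1 = \<one>" using b1(2) self eq12[OF u1(1)] by simp
        have sq: "square_mod_c h" if "h \<in> orthogonal (carrier G) a b1" for h
          using that eq12 nc1 by (intro square_mod_c_if_even) (auto simp: orthogonal_def)
        have aak: "(a \<otimes> a) [^] (k::nat) = z1 [^] k \<otimes> z2 [^] k" for k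
          using z_prod_pow[of 1 1 k] by (simp add: aa)
        show ?thesis
        \<comment> \<open>The square of \<open>a\<close> is the product of \<open>z1\<close> and
          \<open>z2\<close>. For m < n the power of \<open>z2\<close> with exponent 2^(n-1) is
          trivial, so the 2^n-th power of \<open>a\<close> is \<open>c\<close>, as if its square
          were \<open>z1\<close>. For m = n the 2^(m+1)-th power of \<open>a\<close> is trivial, and
          \<open>a\<close> takes the place of a square root of \<open>z2\<close>, which is recovered
          with the help of \<open>z1\<close>.\<close>
        proof (cases "m < n")
          case True
          then have "z2 [^] (2 ^ (n - 1) :: nat) = \<one>" by (intro z2_pow le_imp_power_dvd) simp
          then have an: "a [^] (2 ^ n :: nat) = c"
            using pow_double[OF a(1), of "n - 1"] z1(3) by (simp only: nS aak c_closed r_one)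
          have "z1 = a \<otimes> a \<otimes> inv z2" unfolding aa by (rule split(2)) simp_all
          then have "z1 \<in> generate G {a, b1, c, z2}" by (auto intro: generate.eng generate.incl generate.inv)
          then have ?V by (intro shape_V[OF a(1) b1(1) ab sq an bb z2]) (auto intro: generate.incl)
          then show ?thesis by blast
        next
          case False
          then have mn: "m = n" using nm by simp
          have am: "a [^] (2 ^ (m + 1) :: nat) = \<one>"
            using pow_double[OF a(1), of m] z1n by (simp add: aak mn)
          have "z2 = inv z1 \<otimes> (a \<otimes> a)" unfolding aa by (rule split(1)) simp_all
          then have "z2 \<in> generate G {a, b1, c, z1}" by (auto intro: generate.eng generate.incl generate.inv)
          then have ?VII by (intro shape_VII[OF a(1) b1(1) ab sq am bb])
          then show ?thesis by blast
        qed
      next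
        case indep
        show ?thesis
        proof (cases "odd1 u2")
          case True
          have aa: "b2 \<otimes> b2 = z1" using b2(2) self True by simp
          have bb: "b1 \<otimes> b1 = z2" using b1(2) self u12 True by simp
          have ab: "noncomm b2 b1" using b2(3)[OF b1(1)] b1(3)[OF u2(1)] u1(2)[OF u2(1)] True
            by (simp add: noncomm_sym)
          have an: "b2 [^] (2 ^ n :: nat) = c" using pow_double[OF b2(1), of "n - 1"] z1(3) by (simp only: nS aa)
          have bm: "b1 [^] (2 ^ (m + 1) :: nat) = \<one>" using pow_double[OF b1(1), of m] z1n by (simp add: bb)
          have sq: "square_mod_c h" if "h \<in> orthogonal (carrier G) b2 b1" for h
            using that nc1 nc2 by (intro square_mod_c_if_even) (auto simp: orthogonal_def)
          have "z1 \<in> generate G {b2, b1, c}" "z2 \<in> generate G {b2, b1, c}"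
            unfolding aa[symmetric] bb[symmetric] by (intro generate.eng generate.incl; simp)+
          then have ?I by (intro shape_I[OF b2(1) b1(1) ab sq an bm])
          then show ?thesis by blast
        next
          case False
          \<comment> \<open>Independent functionals take all pairs of values; suitable products of
            the three witnesses realise the two mixed ones.\<close>
          have xy: "\<exists>x\<in>carrier G. odd1 x \<and> \<not> odd2 x" "\<exists>y\<in>carrier G. \<not> odd1 y \<and> odd2 y"
            using indep odd_mult(1) odd_mult(2)[OF _ _ n] m_closed by metis+
          obtain x0 where x0: "x0 \<in> carrier G" "odd1 x0" "\<not> odd2 x0" using xy by blast
          obtain y0 where y0: "y0 \<in> carrier G" "\<not> odd1 y0" "odd2 y0" using xy by blast
          obtain a where "adjusted x0 a" using normalize[OF x0(1)] by blast
          note a = adjustedD[OF this]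
          have aa: "a \<otimes> a = z1" using a(2) x0 by simp
          \<comment> \<open>The second plane must be orthogonal to the first, so \<open>y0\<close>
            has to commute with \<open>a\<close>. Multiplying by \<open>u1\<close> changes exactly
            this pairing and keeps both parities, since \<open>odd1\<close> and \<open>odd2\<close>
            vanish at \<open>u1\<close>.\<close>
          define y1 where "y1 = (if noncomm y0 a then y0 \<otimes> u1 else y0)"
          have a1: "noncomm a u1" "noncomm u1 a"
            using a(3)[OF u1(1)] u1(2)[OF x0(1)] x0(2) by (simp_all add: noncomm_sym)
          have y1: "y1 \<in> carrier G" "\<not> odd1 y1" "odd2 y1" "\<not> noncomm y1 a"
            using y0 u1(1) self u12 False a(1) a1 odd_mult(1)[OF y0(1) u1(1)] odd_mult(2)[OF y0(1) u1(1) n]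
            by (auto simp: y1_def noncomm_mult_left)
          obtain x where "adjusted y1 x" using normalize[OF y1(1)] by blast
          note x = adjustedD[OF this]
          have xx: "x \<otimes> x = z2" using x(2) y1 by simp
          have b11: "b1 \<otimes> b1 = \<one>" using b1(2) self u12 False by simp
          have b22: "b2 \<otimes> b2 = \<one>" using b2(2) self False by simp
          have ab: "noncomm a b1" using a(3)[OF b1(1)] nc1(2)[OF x0(1)] x0(2) by simp
          have xb: "noncomm x b2" using x(3)[OF b2(1)] nc2(2)[OF y1(1)] y1(3) by simp
          have xO: "x \<in> orthogonal (carrier G) a b1"
            using x(1) x(3)[OF a(1)] x(3)[OF b1(1)] y1 nc1(2)[OF y1(1)] by (simp add: orthogonal_def)
          have "\<not> noncomm b2 b1"
            using b2(3)[OF b1(1)] nc1(2)[OF u2(1)] False by simp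
          moreover have "\<not> noncomm b2 a"
            using a(3)[OF b2(1)] nc2(2)[OF x0(1)] x0(3) by (simp add: noncomm_sym)
          ultimately have bO: "b2 \<in> orthogonal (carrier G) a b1" using b2(1) by (simp add: orthogonal_def)
          have sq: "square_mod_c h" if "h \<in> orthogonal (orthogonal (carrier G) a b1) x b2" for h
            using that nc1 nc2 by (intro square_mod_c_if_even) (auto simp: orthogonal_def)
          have an: "a [^] (2 ^ n :: nat) = c" using pow_double[OF a(1), of "n - 1"] z1(3) by (simp only: nS aa)
          have xm: "x [^] (2 ^ (m + 1) :: nat) = \<one>" using pow_double[OF x(1), of m] z1n by (simp add: xx)
          have "z1 \<in> generate G {a, b1, c, x, b2}" "z2 \<in> generate G {a, b1, c, x, b2}"
            unfolding aa[symmetric] xx[symmetric] by (intro generate.eng generate.incl; simp)+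
          then have ?III by (intro shape_III[OF a(1) b1(1) ab xO bO xb sq an b11 xm b22])
          then show ?thesis by blast
        qed
      qed
    qed
  qed
qed

end

section \<open>The classification\<close>

context group
begin

lemma finite_ord_pos: "finite (carrier G) \<Longrightarrow> x \<in> carrier G \<Longrightarrow> 0 < ord x"
  using ord_ge_1 by fastforce

lemma generate_singleton_nat_pow:
  assumes "finite (carrier G)" "x \<in> carrier G" "g \<in> generate G {x}"
  obtains i :: nat where "g = x [^] i"
  using generate_singleton_pow[of x "ord x"] finite_ord_pos[OF assms(1,2)] assms by auto

text \<open>Induction on the number of generators: the next cyclic group meets the subgroup
  generated by the earlier ones trivially, so products of their elements are distinct. This is the
  source of the lower bound for the order of the centre.\<close>

lemma card_generate_independent:
  assumes fin: "finite (carrier G)"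
    and z: "\<And>i. i \<in> {1..t} \<Longrightarrow> z i \<in> carrier G"
    and comm: "\<And>i x. i \<in> {1..t} \<Longrightarrow> x \<in> carrier G \<Longrightarrow> z i \<otimes> x = x \<otimes> z i"
    and indep: "\<And>i. i \<in> {1..t} \<Longrightarrow> generate G {z i} \<inter> generate G (\<Union>j\<in>{1..t} - {i}. generate G {z j}) = {\<one>}"
  shows "(\<Prod>i = 1..t. ord (z i)) \<le> card (generate G (\<Union>i\<in>{1..t::nat}. generate G {z i}))"
proof -
  let ?A = "\<lambda>k. generate G (\<Union>i\<in>{1..k}. generate G {z i})"
  have sub: "(\<Union>i\<in>I. generate G {z i}) \<subseteq> carrier G" if "I \<subseteq> {1..t}" for I
    using z that generate_incl[of "{z i}" for i] by fastforce
  have "(\<Prod>i = 1..k. ord (z i)) \<le> card (?A k)" if "k \<le> t" for k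
    using that
  proof (induction k)
    case 0
    have "generate G {} = {\<one>}" by (rule generate_empty)
    then show ?case by simp
  next
    case (Suc k)
    let ?C = "generate G {z (Suc k)}"
    have zk: "z (Suc k) \<in> carrier G" using z Suc.prems by simp
    have A: "?A k \<subseteq> carrier G" "?A (Suc k) \<subseteq> carrier G" "subgroup (?A k) G" "subgroup (?A (Suc k)) G"
      using sub[of "{1..k}"] sub[of "{1..Suc k}"] Suc.prems generate_incl generate_is_subgroup by auto
    have C: "?C \<subseteq> carrier G" "subgroup ?C G"
      using zk generate_incl generate_is_subgroup by auto
    have "?A k \<subseteq> generate G (\<Union>j\<in>{1..t} - {Suc k}. generate G {z j})"
      using Suc.prems by (intro mono_generate UN_mono) auto
    then have int: "?C \<inter> ?A k \<subseteq> {\<one>}" using indep[of "Suc k"] Suc.prems by auto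
    have inj: "inj_on (\<lambda>(a, b). a \<otimes> b) (?A k \<times> ?C)"
    proof (rule inj_onI)
      fix p q assume pq: "p \<in> ?A k \<times> ?C" "q \<in> ?A k \<times> ?C"
        "(case p of (a, b) \<Rightarrow> a \<otimes> b) = (case q of (a, b) \<Rightarrow> a \<otimes> b)"
      obtain a b where p: "p = (a, b)" by (cases p)
      obtain a' b' where q: "q = (a', b')" by (cases q)
      have ab: "a \<in> ?A k" "b \<in> ?C" "a' \<in> ?A k" "b' \<in> ?C" "a \<otimes> b = a' \<otimes> b'"
        using pq by (auto simp: p q)
      then have G: "a \<in> carrier G" "b \<in> carrier G" "a' \<in> carrier G" "b' \<in> carrier G"
        using A(1) C(1) by auto
      have "inv a' \<otimes> a = inv a' \<otimes> (a \<otimes> b) \<otimes> inv b" using G by (simp add: m_assoc)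
      also have "\<dots> = b' \<otimes> inv b" using G by (simp add: ab(5) m_assoc[symmetric])
      finally have eq: "inv a' \<otimes> a = b' \<otimes> inv b" .
      have "b' \<otimes> inv b \<in> ?C"
        using ab C(2) by (simp add: subgroup.m_closed subgroup.m_inv_closed)
      moreover have "inv a' \<otimes> a \<in> ?A k"
        using ab A(3) by (simp add: subgroup.m_closed subgroup.m_inv_closed)
      ultimately have "inv a' \<otimes> a = \<one>" using int eq by auto
      then have "a = a'" using G by (metis inv_closed inv_equality inv_inv)
      then show "p = q" using ab(5) G by (simp add: p q)
    qed
    have "?A k \<subseteq> ?A (Suc k)" by (intro mono_generate UN_mono) auto
    moreover have "?C \<subseteq> (\<Union>i\<in>{1..Suc k}. generate G {z i})"
      by (rule UN_upper) simp
    then have "?C \<subseteq> ?A (Suc k)" using generate_superset by (rule order_trans)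
    ultimately have img: "(\<lambda>(a, b). a \<otimes> b) ` (?A k \<times> ?C) \<subseteq> ?A (Suc k)"
      using A(4) by (auto intro: subgroup.m_closed)
    have "finite (?A (Suc k))" using A(2) fin finite_subset by blast
    then have "card (?A k \<times> ?C) \<le> card (?A (Suc k))" using card_inj_on_le[OF inj img] by simp
    then have "card (?A k) * ord (z (Suc k)) \<le> card (?A (Suc k))"
      using generate_pow_card[OF zk] by (simp add: card_cartesian_product)
    moreover have "(\<Prod>i = 1..k. ord (z i)) * ord (z (Suc k)) \<le> card (?A k) * ord (z (Suc k))"
      using Suc by simp
    moreover have "(\<Prod>i = 1..Suc k. ord (z i)) = (\<Prod>i = 1..k. ord (z i)) * ord (z (Suc k))" by simp
    ultimately show ?case by (simp only:)
  qed
  then show ?thesis by simp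
qed

lemma ordered_prod_in_subgroup:
  assumes "subgroup K G" "\<And>i. i < k \<Longrightarrow> \<phi> i (f i) \<in> K"
  shows "ordered_prod G \<phi> k f \<in> K"
  using assms(2) by (induction k) (auto simp: subgroup.one_closed[OF assms(1)] subgroup.m_closed[OF assms(1)])

text \<open>Provides the parametrisation \<open>\<psi>\<close> of the elementary abelian part of the
  centre.\<close>

lemma Z2_power_hom:
  assumes K: "subgroup K G" "\<And>x y. x \<in> K \<Longrightarrow> y \<in> K \<Longrightarrow> x \<otimes> y = y \<otimes> x"
    and w: "\<And>i. i < s \<Longrightarrow> w i \<in> K" "\<And>i. i < s \<Longrightarrow> w i [^] (2::nat) = \<one>"
  obtains \<psi> where "\<psi> \<in> hom (Z2_power s) G" "\<psi> ` carrier (Z2_power s) \<subseteq> K"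
    "\<And>i. i < s \<Longrightarrow> w i \<in> \<psi> ` carrier (Z2_power s)"
proof -
  define \<phi> where "\<phi> i x = w i [^] (x::int)" for i x
  define \<psi> where "\<psi> = ordered_prod G \<phi> s"
  have wG: "w i \<in> carrier G" if "i < s" for i using w(1)[OF that] subgroup.subset[OF K(1)] by auto
  have hom: "\<phi> i \<in> hom (integer_mod_group 2) G" if "i < s" for i
    using integer_mod_group_hom[OF wG[OF that] w(2)[OF that]] by (simp add: \<phi>_def[abs_def])
  have \<phi>K: "\<phi> i x \<in> K" if "i < s" for i x
    unfolding \<phi>_def using K(1) w(1)[OF that] by (rule subgroup_int_pow_closed)
  have "\<psi> \<in> hom (Z2_power s) G"
    unfolding \<psi>_def Z2_power_def
    by (rule ordered_prod_hom) (use hom \<phi>K K(2) in \<open>auto simp: commuting_sets_def\<close>)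
  moreover have "\<psi> ` carrier (Z2_power s) \<subseteq> K"
    using \<phi>K by (auto simp: \<psi>_def intro!: ordered_prod_in_subgroup[OF K(1)])
  moreover have "w j \<in> \<psi> ` carrier (Z2_power s)" if j: "j < s" for j
  proof -
    let ?f = "\<lambda>i\<in>{..<s}. if i = j then 1 else \<one>\<^bsub>integer_mod_group 2\<^esub>"
    have "\<psi> ?f = \<phi> j 1"
      unfolding \<psi>_def
      by (rule ordered_prod_single[where H = "\<lambda>_. integer_mod_group 2"])
        (use j hom in \<open>auto simp: carrier_integer_mod_group\<close>)
    then have "\<psi> ?f = w j" using wG[OF j] by (simp add: \<phi>_def int_pow_1)
    moreover have "?f \<in> carrier (Z2_power s)" by (auto simp: Z2_power_def carrier_integer_mod_group)
    ultimately show ?thesis by (metis image_eqI)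
  qed
  ultimately show thesis by (rule that)
qed

lemma elementary_abelian_quotient_square:
  assumes N: "N \<lhd> G" and quot: "elementary_abelian_2 (G Mod N)" and x: "x \<in> carrier G"
  shows "x \<otimes> x \<in> N"
proof -
  interpret N: normal N G by (rule N)
  have "N #> x \<in> carrier (G Mod N)" using x by (auto simp: carrier_FactGroup)
  then have "(N #> x) [^]\<^bsub>G Mod N\<^esub> (2::nat) = N"
    using quot by (simp add: elementary_abelian_2_def)
  then have "N #> (x [^] (2::nat)) = N" using N.FactGroup_pow[OF x, of 2] by simp
  moreover have "x [^] (2::nat) \<in> N #> (x [^] (2::nat))" using x by (intro rcos_self N.is_subgroup) simp
  ultimately show ?thesis using x by (simp add: numeral_2_eq_2)
qed

lemma central_subgroup_normal:
  assumes "subgroup N G" "N \<subseteq> center G"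
  shows "N \<lhd> G"
  unfolding normal_inv_iff
proof (intro conjI ballI)
  fix x h assume "x \<in> carrier G" "h \<in> N"
  then have "x \<otimes> h = h \<otimes> x" "h \<in> carrier G" using assms(2) by (auto simp: center_def)
  then have "x \<otimes> h \<otimes> inv x = h" using \<open>x \<in> carrier G\<close> by (simp add: m_assoc)
  then show "x \<otimes> h \<otimes> inv x \<in> N" using \<open>h \<in> N\<close> by simp
qed (rule assms(1))

lemma commutator_in_derived:
  assumes "x \<in> carrier G" "y \<in> carrier G"
  shows "\<exists>s\<in>derived G (carrier G). x \<otimes> y = s \<otimes> (y \<otimes> x)"
proof (rule bexI)
  show "x \<otimes> y \<otimes> inv x \<otimes> inv y \<in> derived G (carrier G)"
    unfolding derived_def using assms by (intro generate.incl) blast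
  show "x \<otimes> y = x \<otimes> y \<otimes> inv x \<otimes> inv y \<otimes> (y \<otimes> x)"
  proof -
    have "inv x \<otimes> (inv y \<otimes> (y \<otimes> x)) = \<one>" using assms by (simp add: m_assoc[symmetric])
    then show ?thesis using assms by (simp add: m_assoc)
  qed
qed

end

text \<open>\<open>hyperbolic_list\<close> counts only the hyperbolic planes, whereas the index in
  the final statement also counts the \<open>j\<close> planes of the special factors. A Q_8 takes up
  one plane more, hence \<open>j'\<close>.\<close>

lemma hyperbolic_list_reindex:
  assumes "\<exists>k Qs. hyperbolic_list k Qs \<and> P Qs"
    and "j' = Suc j"
  shows "(\<exists>k\<ge>j. P (replicate (k - j) D8)) \<or> (\<exists>k\<ge>j'. P (Q8 # replicate (k - j') D8))"
proof -
  obtain k Qs where Qs: "Qs = replicate k D8 \<or> 1 \<le> k \<and> Qs = Q8 # replicate (k - 1) D8" "P Qs"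
    using assms(1) by (elim exE conjE)
  from Qs(1) show ?thesis
  proof
    assume "Qs = replicate k D8"
    then have "j \<le> k + j \<and> P (replicate (k + j - j) D8)" using Qs(2) by simp
    then show ?thesis by blast
  next
    assume "1 \<le> k \<and> Qs = Q8 # replicate (k - 1) D8"
    then have "j' \<le> k + j \<and> P (Q8 # replicate (k + j - j') D8)" using Qs(2) assms(2) by auto
    then show ?thesis by blast
  qed
qed

theorem theorem3p6:
  fixes G :: "('a, 'b) monoid_scheme" (structure)
    and n m r :: nat and N :: "'a set" and c :: 'a and z :: "nat \<Rightarrow> 'a"
  assumes nm: "n \<ge> m" "m \<ge> 1"
    and G: "group G" "finite (carrier G)" "\<exists>e. order G = 2 ^ e" "\<not> comm_group G"
    and N: "subgroup N G" "N \<subseteq> center G"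
      "G\<lparr>carrier := N\<rparr> \<cong> integer_mod_group (2 ^ n) \<times>\<times> integer_mod_group (2 ^ m)"
    and quot: "elementary_abelian_2 (G Mod N)"
    and derived: "c \<in> carrier G" "group.ord G c = 2" "derived G (carrier G) = generate G {c}"
    and r: "r \<ge> 2"
    and z: "\<And>i. i \<in> {1..r} \<Longrightarrow> z i \<in> carrier G"
    and z_ord: "group.ord G (z 1) = 2 ^ n" "group.ord G (z 2) = 2 ^ m"
      "\<And>i. i \<in> {3..r} \<Longrightarrow> group.ord G (z i) = 2"
    and center: "internal_direct_product G {1..r} (\<lambda>i. generate G {z i}) (center G)"
    and N_eq: "internal_direct_product G {1, 2} (\<lambda>i. generate G {z i}) N"
    and c: "c \<in> generate G {z 1}"
  shows
    "(\<exists>k\<ge>1. G \<cong> central_product (M2 (n + 1) (m + 1) # replicate (k - 1) D8)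
              \<times>\<times> Z2_power (r - 2)) \<or>
     (\<exists>k\<ge>2. G \<cong> central_product (M2 (n + 1) (m + 1) # Q8 # replicate (k - 2) D8)
              \<times>\<times> Z2_power (r - 2)) \<or>
     (\<exists>k\<ge>2. G \<cong> central_product (M2 (n + 1) 1 # M2_1_1 (m + 1) # replicate (k - 2) D8)
              \<times>\<times> Z2_power (r - 2)) \<or>
     (\<exists>k\<ge>3. G \<cong> central_product (M2 (n + 1) 1 # M2_1_1 (m + 1) # Q8 # replicate (k - 3) D8)
              \<times>\<times> Z2_power (r - 2)) \<or>
     (\<exists>k\<ge>1. G \<cong> central_product (M2 (n + 1) 1 # replicate (k - 1) D8)
              \<times>\<times> integer_mod_group (2 ^ m) \<times>\<times> Z2_power (r - 2)) \<or>
     (\<exists>k\<ge>2. G \<cong> central_product (M2 (n + 1) 1 # Q8 # replicate (k - 2) D8)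
              \<times>\<times> integer_mod_group (2 ^ m) \<times>\<times> Z2_power (r - 2)) \<or>
     (\<exists>k\<ge>1. G \<cong> central_product (M2_1_1 (m + 1) # replicate (k - 1) D8 @ [Cyc (2 ^ n)])
              \<times>\<times> Z2_power (r - 2)) \<or>
     (\<exists>k\<ge>2. G \<cong> central_product (M2_1_1 (m + 1) # Q8 # replicate (k - 2) D8 @ [Cyc (2 ^ n)])
              \<times>\<times> Z2_power (r - 2)) \<or>
     (\<exists>k\<ge>1. G \<cong> central_product (replicate k D8 @ [Cyc (2 ^ n)])
              \<times>\<times> integer_mod_group (2 ^ m) \<times>\<times> Z2_power (r - 2)) \<or>
     (\<exists>k\<ge>1. G \<cong> central_product (Q8 # replicate (k - 1) D8 @ [Cyc (2 ^ n)])
              \<times>\<times> integer_mod_group (2 ^ m) \<times>\<times> Z2_power (r - 2))"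
proof -
  interpret group G by (rule G(1))
  define s where "s = r - 2"
  let ?U = "\<lambda>I. \<Union>i\<in>I. generate G {z i}"
  have C: "subgroup (center G) G" "generate G (?U {1..r}) = center G"
    and C_indep: "\<And>i. i \<in> {1..r} \<Longrightarrow> generate G {z i} \<inter> generate G (?U ({1..r} - {i})) = {\<one>}"
    using center by (auto simp: internal_direct_product_def)
  have N_gen: "generate G (?U {1, 2}) = N"
    and N_indep: "generate G {z 1} \<inter> generate G (?U ({1, 2} - {1})) = {\<one>}"
    using N_eq by (auto simp: internal_direct_product_def)
  have U: "generate G {z i} \<subseteq> center G" if "i \<in> {1..r}" for i
  proof -
    have "generate G {z i} \<subseteq> ?U {1..r}" using that by blast
    then show ?thesis using generate_superset[of "?U {1..r}" G] C(2) by blast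
  qed
  have zC: "z i \<in> center G" if "i \<in> {1..r}" for i
    using U[OF that] generate.incl[of "z i" "{z i}" G] by auto
  have i12: "1 \<in> {1..r}" "2 \<in> {1..r}" using r by auto
  have central: "w \<otimes> x = x \<otimes> w" if "w \<in> center G" "x \<in> carrier G" for w x
    using that by (simp add: center_def)
  have closed: "w \<in> carrier G" if "w \<in> center G" for w using that by (simp add: center_def)
  have c1: "c \<noteq> \<one>" using derived(2) by auto
  have c2: "c [^] (2::nat) = \<one>" using pow_ord_eq_1[OF derived(1)] derived(2) by simp
  then have cc: "c \<otimes> c = \<one>" using derived(1) by (simp add: numeral_2_eq_2)
  have cC: "c \<in> center G" using c U[OF i12(1)] by auto
  have "derived G (carrier G) \<subseteq> {\<one>, c}"
    unfolding derived(3)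
    using derived(1) by (intro generate_subgroup_incl subgroup_involution cc) auto
  then have comm: "x \<otimes> y = y \<otimes> x \<or> x \<otimes> y = y \<otimes> x \<otimes> c" if "x \<in> carrier G" "y \<in> carrier G" for x y
    using commutator_in_derived[OF that] that central[OF cC, of "y \<otimes> x"] by auto
  interpret involution_commutator_group G c
  proof unfold_locales
    show "finite (carrier G)" "c \<in> carrier G" "c \<noteq> \<one>" "c \<otimes> c = \<one>" by fact+
    show "c \<otimes> x = x \<otimes> c" if "x \<in> carrier G" for x using cC that by (rule central)
    show "x \<otimes> y = y \<otimes> x \<or> x \<otimes> y = y \<otimes> x \<otimes> c" if "x \<in> carrier G" "y \<in> carrier G" for x y
      using that by (rule comm)
  qed
  have zpow: "z 1 [^] (2 ^ n :: nat) = \<one>" "z 2 [^] (2 ^ m :: nat) = \<one>"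
    using pow_ord_eq_1[OF z[OF i12(1)]] pow_ord_eq_1[OF z[OF i12(2)]] z_ord by simp_all
  have n1: "1 \<le> n" using nm by simp
  \<comment> \<open>A cyclic group of order 2^n contains only one involution.\<close>
  have zc: "z 1 [^] (2 ^ (n - 1) :: nat) = c"
  proof -
    obtain i :: nat where i: "c = z 1 [^] i"
      using generate_singleton_nat_pow[OF G(2) z[OF i12(1)] c] .
    have "z 1 [^] (i * 2) = \<one>" using c2 z[OF i12(1)] by (simp add: i nat_pow_pow)
    then have "2 ^ n dvd i * 2" using pow_eq_id[OF z[OF i12(1)]] z_ord(1) by simp
    then have "2 ^ (n - 1) dvd i" using n1 by (cases n) auto
    then obtain j where j: "i = 2 ^ (n - 1) * j" by (rule dvdE)
    have nn: "(2::nat) ^ (n - 1) * 2 = 2 ^ n" using n1 by (cases n) auto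
    define t where "t = z 1 [^] (2 ^ (n - 1) :: nat)"
    have t: "t \<in> carrier G" "t [^] (2::nat) = \<one>"
      using z[OF i12(1)] zpow(1) nn by (simp_all add: t_def nat_pow_pow)
    have "c = t [^] (j mod 2)"
      using nat_pow_mod[OF t] z[OF i12(1)] by (simp add: i j t_def flip: nat_pow_pow)
    then show ?thesis using c1 t(1) by (cases "j mod 2 = 0") (auto simp: t_def mod2_eq_if)
  qed
  \<comment> \<open>The \<open>s = r - 2\<close> involutions are \<open>z 3\<close>, ...,
    \<open>z r\<close>; numbering them from 0 produces the shift by 3.\<close>
  obtain \<psi> where \<psi>: "\<psi> \<in> hom (Z2_power s) G" "\<psi> ` carrier (Z2_power s) \<subseteq> center G"
    and \<psi>z: "\<And>i. i < s \<Longrightarrow> z (i + 3) \<in> \<psi> ` carrier (Z2_power s)"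
  proof (rule Z2_power_hom[OF C(1), of s "\<lambda>i. z (i + 3)"])
    fix i assume "i < s"
    then have i: "i + 3 \<in> {1..r}" "i + 3 \<in> {3..r}" by (auto simp: s_def)
    show "z (i + 3) \<in> center G" by (rule zC[OF i(1)])
    show "z (i + 3) [^] (2::nat) = \<one>" using pow_ord_eq_1[OF z[OF i(1)]] z_ord(3)[OF i(2)] by simp
  qed (use central closed in auto)
  have gen: "center G \<subseteq> generate G ({z 1, z 2} \<union> \<psi> ` carrier (Z2_power s))" (is "_ \<subseteq> generate G ?A")
  proof -
    have A: "?A \<subseteq> carrier G" using \<psi>(2) closed zC i12 by auto
    have "z i \<in> ?A" if "i \<in> {1..r}" for i
    proof -
      have "i = 1 \<or> i = 2 \<or> i - 3 < s \<and> i - 3 + 3 = i" using that by (auto simp: s_def)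
      then show ?thesis using \<psi>z[of "i - 3"] by auto
    qed
    then have "generate G {z i} \<subseteq> generate G ?A" if "i \<in> {1..r}" for i
      using that by (intro mono_generate) auto
    then have "generate G (?U {1..r}) \<subseteq> generate G ?A"
      by (intro generate_subgroup_incl[OF _ generate_is_subgroup[OF A]]) blast
    then show ?thesis by (simp only: C(2))
  qed
  have "(\<Prod>i = 1..r. ord (z i)) \<le> card (center G)"
    using card_generate_independent[OF G(2) z central[OF zC] C_indep] by (simp only: C(2))
  moreover have "(\<Prod>i = 1..r. ord (z i)) = 2 ^ (n + m + s)"
  proof -
    have "{1..r} = {1, 2} \<union> {3..r}" using r by auto
    then have "(\<Prod>i = 1..r. ord (z i)) = (\<Prod>i\<in>{1, 2}. ord (z i)) * (\<Prod>i = 3..r. ord (z i))"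
      by (simp only:) (rule prod.union_disjoint; auto)
    also have "(\<Prod>i = 3..r. ord (z i)) = (\<Prod>i = 3..r. 2)" by (rule prod.cong) (auto simp: z_ord(3))
    also have "\<dots> = 2 ^ s" by (simp add: s_def)
    finally show ?thesis using z_ord(1,2) by (simp add: power_add)
  qed
  ultimately have card: "2 ^ (n + m + s) \<le> card (center G)" by simp
  interpret split_center_group G c n m s "z 1" "z 2" \<psi>
    by unfold_locales (use nm zC i12 zpow zc \<psi> gen card in auto)
  have [simp]: "z (Suc 0) \<in> carrier G" using z_closed(1) by simp
  have pow_gen: "\<exists>k::nat. g = z i [^] k" if "i \<in> {1..r}" "g \<in> generate G {z i}" for i g
    using generate_singleton_nat_pow[OF G(2) z[OF that(1)] that(2)] by blast
  have invU: "inv g \<in> generate G {z i}" if "i \<in> {1..r}" "g \<in> generate G {z i}" for i g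
    using generate_m_inv_closed[of "{z i}" g] z[OF that(1)] that(2) by simp
  have N_form: "\<exists>(i::nat) (j::nat). g = z 1 [^] i \<otimes> z 2 [^] j" if "g \<in> N" for g
  proof -
    have base: "\<exists>(i::nat) (j::nat). g = z 1 [^] i \<otimes> z 2 [^] j" if "g \<in> ?U {1, 2}" for g
    proof -
      consider k :: nat where "g = z 1 [^] k" | k :: nat where "g = z 2 [^] k"
        using \<open>g \<in> ?U {1, 2}\<close> pow_gen i12 by blast
      then show ?thesis
      proof cases
        case (1 k)
        then have "g = z 1 [^] k \<otimes> z 2 [^] (0::nat)" by simp
        then show ?thesis by blast
      next
        case (2 k)
        then have "g = z 1 [^] (0::nat) \<otimes> z 2 [^] k" by simp
        then show ?thesis by blast
      qed
    qed
    have "g \<in> generate G (?U {1, 2})" using that by (simp only: N_gen)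
    then show ?thesis
    proof (induction rule: generate.induct)
      case one
      have "\<one> = z 1 [^] (0::nat) \<otimes> z 2 [^] (0::nat)" by simp
      then show ?case by blast
    next
      case (incl h)
      then show ?case by (rule base)
    next
      case (inv h)
      then have "inv h \<in> ?U {1, 2}" using invU i12 by auto
      then show ?case by (rule base)
    next
      case (eng g h)
      then show ?case using z_mult by metis
    qed
  qed
  have N_normal: "N \<lhd> G" using N(1,2) by (rule central_subgroup_normal)
  have squares: "\<exists>(i::nat) (j::nat). h \<otimes> h = z 1 [^] i \<otimes> z 2 [^] j" if "h \<in> carrier G" for h
    using N_form[OF elementary_abelian_quotient_square[OF N_normal quot that]] .
  \<comment> \<open>Squaring is multiplicative on the centre and kills the generators from
    \<open>z 3\<close> on, so only even powers of \<open>z 1\<close> and \<open>z 2\<close>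
    remain.\<close>
  have center_squares: "\<exists>(i::nat) (j::nat). w \<otimes> w = z 1 [^] (2 * i) \<otimes> z 2 [^] (2 * j)"
    if "w \<in> center G" for w
  proof -
    have base: "\<exists>(i::nat) (j::nat). w \<otimes> w = z 1 [^] (2 * i) \<otimes> z 2 [^] (2 * j)"
      if "w \<in> ?U {1..r}" for w
    proof -
      obtain l k :: nat where l: "l \<in> {1..r}" "w = z l [^] k"
        using \<open>w \<in> ?U {1..r}\<close> pow_gen by blast
      have ww: "w \<otimes> w = z l [^] (2 * k)" using z[OF l(1)] by (simp add: l(2) nat_pow_mult mult_2)
      have "l = 1 \<or> l = 2 \<or> l \<in> {3..r}" using l(1) by auto
      then consider "l = 1" | "l = 2" | "l \<in> {3..r}" by blast
      then show ?thesis
      proof cases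
        case 1
        then have "w \<otimes> w = z 1 [^] (2 * k) \<otimes> z 2 [^] (2 * 0 :: nat)" using ww by simp
        then show ?thesis by blast
      next
        case 2
        then have "w \<otimes> w = z 1 [^] (2 * 0 :: nat) \<otimes> z 2 [^] (2 * k)" using ww by simp
        then show ?thesis by blast
      next
        case 3
        then have "z l [^] (2 * k) = \<one>" using pow_eq_id[OF z[OF l(1)]] z_ord(3) by simp
        then have "w \<otimes> w = z 1 [^] (2 * 0 :: nat) \<otimes> z 2 [^] (2 * 0 :: nat)" using ww by simp
        then show ?thesis by blast
      qed
    qed
    have "w \<in> generate G (?U {1..r})" using that by (simp only: C(2))
    then show ?thesis
    proof (induction rule: generate.induct)
      case one
      have "\<one> \<otimes> \<one> = z 1 [^] (2 * 0 :: nat) \<otimes> z 2 [^] (2 * 0 :: nat)" by simp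
      then show ?case by blast
    next
      case (incl h)
      then show ?case by (rule base)
    next
      case (inv h)
      then have "inv h \<in> ?U {1..r}" using invU by blast
      then show ?case by (rule base)
    next
      case (eng g h)
      have gh: "g \<in> center G" "h \<in> center G" using eng.hyps by (simp_all only: C(2))
      have "g \<otimes> h \<otimes> (g \<otimes> h) = g \<otimes> g \<otimes> (h \<otimes> h)"
        using square_mult[of g h] center_noncomm[OF gh(1) closed[OF gh(2)]] closed[OF gh(1)] closed[OF gh(2)]
        by simp
      then show ?case using eng.IH z_mult by (metis distrib_left)
    qed
  qed
  \<comment> \<open>The cyclic groups of \<open>z 1\<close> and \<open>z 2\<close> meet trivially,
    so the exponents agree modulo 2^n and 2^m. Both moduli are even because m >= 1, so the parities
    agree.\<close>
  have indep: "even i = even i' \<and> even j = even j'"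
    if eq: "z 1 [^] (i::nat) \<otimes> z 2 [^] (j::nat) = z 1 [^] (i'::nat) \<otimes> z 2 [^] (j'::nat)" for i j i' j'
  proof -
    have z12: "z 1 \<in> carrier G" "z 2 \<in> carrier G" using z i12 by auto
    let ?g = "inv (z 1 [^] i') \<otimes> z 1 [^] i"
    have "?g = inv (z 1 [^] i') \<otimes> (z 1 [^] i \<otimes> z 2 [^] j) \<otimes> inv (z 2 [^] j)"
      using z12 by (simp add: m_assoc)
    also have "\<dots> = z 2 [^] j' \<otimes> inv (z 2 [^] j)"
      unfolding eq using z12 by (simp add: m_assoc[symmetric])
    finally have g: "?g = z 2 [^] j' \<otimes> inv (z 2 [^] j)" .
    have powin: "x [^] (k::nat) \<in> generate G {x}" "inv (x [^] k) \<in> generate G {x}"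
      if "x \<in> carrier G" for x k
    proof -
      show "x [^] k \<in> generate G {x}" by (induction k) (auto intro: generate.intros)
      then show "inv (x [^] k) \<in> generate G {x}" using generate_m_inv_closed[of "{x}"] that by simp
    qed
    have "?g \<in> generate G {z 1}" using powin[OF z12(1)] by (intro generate.eng)
    moreover have "z 2 [^] j' \<otimes> inv (z 2 [^] j) \<in> generate G (?U ({1, 2} - {1}))"
    proof -
      have "{1, 2} - {1} = {2::nat}" by auto
      then have "generate G {z 2} \<subseteq> generate G (?U ({1, 2} - {1}))"
        using generate_superset[of "generate G {z 2}" G] by simp
      then show ?thesis using powin[OF z12(2)] by (blast intro: generate.eng)
    qed
    ultimately have one: "?g = \<one>" "z 2 [^] j' \<otimes> inv (z 2 [^] j) = \<one>"
      using N_indep g by auto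
    then have "z 1 [^] i' = z 1 [^] i" "z 2 [^] j' = z 2 [^] j"
      using z12 by (metis inv_closed inv_equality inv_inv nat_pow_closed)+
    then have "int (ord (z 1)) dvd int i - int i'" "int (ord (z 2)) dvd int j - int j'"
      using int_pow_eq[OF z12(1), of "int i'" "int i"] int_pow_eq[OF z12(2), of "int j'" "int j"]
      by (simp_all add: int_pow_int)
    moreover have "2 dvd int (ord (z 1))" "2 dvd int (ord (z 2))" using z_ord(1,2) nm by simp_all
    ultimately have "even (int i - int i')" "even (int j - int j')" using dvd_trans by blast+
    then show ?thesis by simp
  qed
  have nonab: "center G \<noteq> carrier G"
  proof
    assume *: "center G = carrier G"
    have "comm_group G" by (rule group_comm_groupI) (use * central in auto)
    then show False using G(4) by contradiction
  qed
  interpret two_generated_squares G c n m s "z 1" "z 2" \<psi>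
    by unfold_locales (use squares center_squares indep nonab in blast)+
  \<comment> \<open>The special factors occupy two planes in the product of
    \<open>M2 (n + 1) 1\<close> with \<open>M2_1_1 (m + 1)\<close> and one plane in the other cases
    that need reindexing.\<close>
  have j: "2 = Suc 1" "3 = Suc 2" by simp_all
  show ?thesis
    using classification unfolding s_def
  proof (elim disjE, goal_cases)
    case 1
    from hyperbolic_list_reindex[OF 1 j(1)] show ?case by (elim disjE) (simp_all only: simp_thms)
  next
    case 2
    from hyperbolic_list_reindex[OF 2 j(2)] show ?case by (elim disjE) (simp_all only: simp_thms)
  next
    case 3
    from hyperbolic_list_reindex[OF 3 j(1)] show ?case by (elim disjE) (simp_all only: simp_thms)
  next
    case 4
    from hyperbolic_list_reindex[OF 4 j(1)] show ?case
      unfolding append_Cons by (elim disjE) (simp_all only: simp_thms)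
  next
    case 5
    then show ?case
      unfolding conj_disj_distribL ex_disj_distrib by (elim disjE) (simp_all only: simp_thms)
  qed
qed

end
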